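(* Let $a,c,f,\gamma,\varepsilon_0,\lambda$ be as in the context and let $0<\alpha\le\min\{\lambda/2,\,1/4\}$. Then there is a constant $C>0$, independent of $\varepsilon$ and $N$ (it may depend on $\alpha$ and the data $a,c,f,\lambda$), such that for all $\varepsilon\in(0,\varepsilon_0]$ and all integers $N\ge 1$ the following holds. If $u$ is the solution of the boundary value problem $$-\varepsilon u''(x)+a(x)u'(x)+c(x)u(x)=f(x)\ \text{ in }(-1,1),\qquad u(-1)=u(1)=0,$$ and $u_N\in V^N$ is the linear finite element solution on the mesh $x_i=\varphi(i/N,\varepsilon)$, $i=-N,\dots,N$, i.e. $B_\varepsilon(u_N,v_N)=(f,v_N)$ for all $v_N\in V^N$, then $$|||u-u_N|||_\varepsilon\le C N^{-1}\qquad\text{and}\qquad \|u-u_N\|\le C N^{-2}.$$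
   Context: Data: $a,c,f$ are sufficiently smooth functions on $[-1,1]$ (independent of $\varepsilon$) with $a(x)=-x\,b(x)$, $b(x)>0$, $c(x)\ge 0$ on $[-1,1]$ and $c(0)>0$ (simple interior turning point at $x_0=0$). There is a constant $\gamma>0$ with $(c-\tfrac12 a')(x)\ge\gamma$ for all $x\in[-1,1]$, and $\varepsilon$ is sufficiently small: $0<\varepsilon\le\varepsilon_0$ for some sufficiently small $\varepsilon_0\in(0,1]$. Parameter $\lambda$: put $\bar\lambda=c(0)/|a'(0)|$; $\lambda$ is a fixed number with $0<\lambda<\bar\lambda$ ($\lambda=\bar\lambda$ is also allowed if $\bar\lambda$ is not an integer). It is known that the solution $u=u(\cdot,\varepsilon)$ then satisfies $|u^{(i)}(x)|\le C\bigl(1+(\varepsilon^{1/2}+|x|)^{\lambda-i}\bigr)$ for $x\in[-1,1]$, with $C$ independent of $\varepsilon$ and $x$, for all derivative orders $i$ permitted by the smoothness of the data (in particular for $0\le i\le 3$); this may be used. Mesh generating function: for $0\le\xi\le1$, $$\varphi(\xi,\varepsilon)=\Bigl(\varepsilon^{\alpha/2}+\xi\bigl[(1+\varepsilon^{1/2})^\alpha-\varepsilon^{\alpha/2}\bigr]\Bigr)^{1/\alpha}-\varepsilon^{1/2},$$ and for $-1\le\xi\le0$, $\varphi(\xi,\varepsilon)=\varepsilon^{1/2}-\bigl(\varepsilon^{\alpha/2}-\xi[(1+\varepsilon^{1/2})^\alpha-\varepsilon^{\alpha/2}]\bigr)^{1/\alpha}$. Linear finite element space: $V^N=\{v\in C([-1,1]):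 v|_{(x_{i-1},x_i)}\text{ is a polynomial of degree}\le 1\ \forall i=-N+1,\dots,N,\ v(-1)=v(1)=0\}$. Bilinear form: $B_\varepsilon(v,w)=\varepsilon(v',w')+(av',w)+(cv,w)$, where $(\cdot,\cdot)$ is the $L^2((-1,1))$ inner product with norm $\|\cdot\|$. Energy norm: $|||v|||_\varepsilon=\bigl(\varepsilon\|v'\|^2+\|v\|^2\bigr)^{1/2}$ for $v\in H^1((-1,1))$. *)

theory Defs
  imports "HOL-Analysis.Analysis" "HOL-Computational_Algebra.Polynomial"
begin

text \<open>Membership in \<open>C\<^sup>k(S)\<close>; on \<open>S = [-1,1]\<close> the derivatives at the endpoints are one-sided.\<close>

definition Ck_on :: "nat \<Rightarrow> real set \<Rightarrow> (real \<Rightarrow> real) \<Rightarrow> bool" where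
  "Ck_on k S g \<longleftrightarrow>
     (\<exists>D :: nat \<Rightarrow> real \<Rightarrow> real. D 0 = g \<and>
        (\<forall>j<k. \<forall>x\<in>S. (D j has_real_derivative D (Suc j) x) (at x within S)) \<and>
        (\<forall>j\<le>k. continuous_on S (D j)))"

text \<open>Assumptions on the data; \<open>a'\<close> is the derivative of \<open>a\<close> on \<open>[-1,1]\<close>. Continuity of
  \<open>b\<close> pins down \<open>b 0\<close>, so that \<open>a' 0 = - b 0 < 0\<close> and the turning point is simple.\<close>

definition turning_point_data ::
  "nat \<Rightarrow> (real \<Rightarrow> real) \<Rightarrow> (real \<Rightarrow> real) \<Rightarrow> (real \<Rightarrow> real) \<Rightarrow> (real \<Rightarrow> real) \<Rightarrow> (real \<Rightarrow> real) \<Rightarrow> real \<Rightarrow> bool"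
  where
  "turning_point_data k a a' b c f \<gamma> \<longleftrightarrow>
     Ck_on k {-1..1} a \<and> Ck_on k {-1..1} c \<and> Ck_on k {-1..1} f \<and>
     (\<forall>x\<in>{-1..1}. (a has_real_derivative a' x) (at x within {-1..1})) \<and>
     continuous_on {-1..1} b \<and>
     (\<forall>x\<in>{-1..1}. a x = - x * b x \<and> b x > 0) \<and>
     (\<forall>x\<in>{-1..1}. c x \<ge> 0) \<and> c 0 > 0 \<and>
     \<gamma> > 0 \<and> (\<forall>x\<in>{-1..1}. c x - a' x / 2 \<ge> \<gamma>)"

text \<open>Classical solutions, in \<open>C[-1,1]\<close> and twice differentiable in \<open>(-1,1)\<close>.\<close>

definition bvp_solution ::
  "real \<Rightarrow> (real \<Rightarrow> real) \<Rightarrow> (real \<Rightarrow> real) \<Rightarrow> (real \<Rightarrow> real) \<Rightarrow> (real \<Rightarrow> real) \<Rightarrow> bool" where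
  "bvp_solution \<epsilon> a c f u \<longleftrightarrow>
     continuous_on {-1..1} u \<and> u (-1) = 0 \<and> u 1 = 0 \<and>
     (\<exists>u' u'' :: real \<Rightarrow> real. \<forall>x\<in>{-1<..<1}.
        (u has_real_derivative u' x) (at x) \<and>
        (u' has_real_derivative u'' x) (at x) \<and>
        - \<epsilon> * u'' x + a x * u' x + c x * u x = f x)"

definition mesh_fun :: "real \<Rightarrow> real \<Rightarrow> real \<Rightarrow> real" where
  "mesh_fun \<alpha> \<epsilon> \<xi> =
     (if \<xi> \<ge> 0
      then (\<epsilon> powr (\<alpha>/2) + \<xi> * ((1 + sqrt \<epsilon>) powr \<alpha> - \<epsilon> powr (\<alpha>/2))) powr (1/\<alpha>) - sqrt \<epsilon>
      else sqrt \<epsilon> - (\<epsilon> powr (\<alpha>/2) - \<xi> * ((1 + sqrt \<epsilon>) powr \<alpha> - \<epsilon> powr (\<alpha>/2))) powr (1/\<alpha>))"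

definition mesh :: "real \<Rightarrow> real \<Rightarrow> nat \<Rightarrow> int \<Rightarrow> real" where
  "mesh \<alpha> \<epsilon> N i = mesh_fun \<alpha> \<epsilon> (of_int i / real N)"

definition fe_space :: "nat \<Rightarrow> (int \<Rightarrow> real) \<Rightarrow> (real \<Rightarrow> real) set" where
  "fe_space N x =
     {v. continuous_on {-1..1} v \<and>
         (\<forall>i\<in>{- int N + 1..int N}. \<exists>p :: real poly. degree p \<le> 1 \<and>
            (\<forall>t\<in>{x (i - 1)<..<x i}. v t = poly p t)) \<and>
         v (-1) = 0 \<and> v 1 = 0}"

definition L2_inner :: "(real \<Rightarrow> real) \<Rightarrow> (real \<Rightarrow> real) \<Rightarrow> real" where
  "L2_inner v w = (LBINT x:{-1<..<1}. v x * w x)"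

definition L2_norm :: "(real \<Rightarrow> real) \<Rightarrow> real" where
  "L2_norm v = sqrt (L2_inner v v)"

text \<open>A continuous representative of an \<open>H\<^sup>1(-1,1)\<close> function is differentiable almost everywhere
  and \<^const>\<open>deriv\<close> then represents its weak derivative. For differences of a classical solution
  and a finite element function, \<^const>\<open>deriv\<close> is unspecified at most at the mesh nodes, a null
  set.\<close>

definition bilinear_form ::
  "real \<Rightarrow> (real \<Rightarrow> real) \<Rightarrow> (real \<Rightarrow> real) \<Rightarrow> (real \<Rightarrow> real) \<Rightarrow> (real \<Rightarrow> real) \<Rightarrow> real" where
  "bilinear_form \<epsilon> a c v w =
     \<epsilon> * L2_inner (deriv v) (deriv w) + L2_inner (\<lambda>x. a x * deriv v x) w
       + L2_inner (\<lambda>x. c x * v x) w"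

definition energy_norm :: "real \<Rightarrow> (real \<Rightarrow> real) \<Rightarrow> real" where
  "energy_norm \<epsilon> v = sqrt (\<epsilon> * (L2_norm (deriv v))\<^sup>2 + (L2_norm v)\<^sup>2)"

definition fe_solution ::
  "real \<Rightarrow> (real \<Rightarrow> real) \<Rightarrow> (real \<Rightarrow> real) \<Rightarrow> (real \<Rightarrow> real) \<Rightarrow> (real \<Rightarrow> real) set \<Rightarrow> (real \<Rightarrow> real) \<Rightarrow> bool"
  where
  "fe_solution \<epsilon> a c f V w \<longleftrightarrow> w \<in> V \<and> (\<forall>v\<in>V. bilinear_form \<epsilon> a c w v = L2_inner f v)"

end

theory Submission
  imports Defs
begin

text \<open>
  Write \<open>X x = sqrt \<epsilon> + \<bar>x\<bar>\<close> for the layer distance. The proof combines weighted a priori estimates of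
  the solution with a supercloseness argument on the mesh.

  \<^bold>\<open>The solution.\<close> The regularity of the interior layer enters through the integrals
  \<open>\<integral> X u'\<^sup>2\<close>, \<open>\<integral> X\<^sup>3 u''\<^sup>2\<close> and \<open>\<integral> X\<^sup>5 u'''\<^sup>2\<close>, which are bounded uniformly in \<open>\<epsilon>\<close>
  (\<open>weighted_a_priori_estimates\<close>). Near the turning point the convection coefficient behaves like
  \<open>- x b\<close> with \<open>b > 0\<close>, so testing the equation with \<open>v = u'\<close>, its first derivative with
  \<open>v = u''\<close>, and its second with \<open>v = u'''\<close>, each times \<open>- x \<omega>\<close> with an even weight \<open>\<omega> > 0\<close>, makes the
  convection term at least \<open>\<beta> x\<^sup>2 \<omega> v\<^sup>2\<close>, where \<open>\<beta> = min b\<close> (\<open>energy_core\<close>). The diffusion term has good boundary values, and its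
  interior part is absorbed where \<open>\<bar>x\<bar>\<close> is large compared with \<open>sqrt \<epsilon>\<close>. In the remaining layer of
  width \<open>sqrt \<epsilon>\<close> the pointwise bounds \<open>u\<^bsup>(n)\<^esup> = O(\<epsilon>\<^bsup>- n/2\<^esup>)\<close> suffice. They start from the maximum
  principle for \<open>u\<close> with the barrier \<open>2 - x\<^sup>2\<close>.

  \<^bold>\<open>The mesh.\<close> In the variable \<open>X\<^bsup>\<alpha>\<^esup>\<close> the nodes are equidistant. Hence the step size \<open>h\<close> is of order
  \<open>N\<^bsup>-1\<^esup> X\<^bsup>1-\<alpha>\<^esup>\<close>, and \<open>\<alpha> \<le> 1/4\<close> gives \<open>h\<^sup>2 = O(N\<^bsup>-2\<^esup> X\<^bsup>3/2\<^esup>)\<close>, which matches the weight of \<open>u''\<close>. The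
  exceptions are the two cells at the turning point when \<open>sqrt \<epsilon>\<close> is small; their length is then
  \<open>O(N\<^bsup>-1/\<alpha>\<^esup>) = O(N\<^bsup>-4\<^esup>)\<close> (\<open>mesh_cells\<close>).

  \<^bold>\<open>The error.\<close> Let \<open>e = u - u\<^sub>I\<close> be the interpolation error and \<open>v = u\<^sub>I - u\<^sub>N\<close> the discrete error.
  By the weighted estimates \<open>e\<close> is \<open>O(N\<^bsup>-2\<^esup>)\<close> in \<open>L\<^sup>2\<close> and \<open>O(N\<^bsup>-1\<^esup>)\<close> in the energy norm. Coercivity and
  Galerkin orthogonality bound \<open>v\<close> by the consistency error, whose diffusive part vanishes because \<open>v'\<close>
  is constant on each cell. The critical part is \<open>\<integral> a e v'\<close>, which an inverse inequality alone would
  only bound to first order. Its leading part is \<open>- (1/12) \<Sum> h\<^sup>2 \<integral> a u'' v'\<close> over the cells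
  (\<open>interpolation_error_identity\<close>). Replacing \<open>h\<^sup>2\<close> by a continuous model of the squared step size costs
  only second order terms, after which one global integration by parts removes the derivative from
  \<open>v\<close> (\<open>weighted_by_parts\<close>). It needs \<open>u'''\<close>, the smoothness of the mesh grading, and the factor
  \<open>\<bar>a\<bar> = O(X)\<close>. Thus \<open>v\<close> is of second order in the energy norm (\<open>discrete_error\<close>), and both error bounds
  follow from \<open>u - u\<^sub>N = e + v\<close>.
\<close>

section \<open>Calculus on compact intervals\<close>

lemma ftc_has_integral:
  fixes F f :: "real \<Rightarrow> real"
  assumes "p \<le> q" "\<And>x. x \<in> {p..q} \<Longrightarrow> (F has_real_derivative f x) (at x within {p..q})"
  shows "(f has_integral F q - F p) {p..q}"
  using assms fundamental_theorem_of_calculus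
  by (metis has_real_derivative_iff_has_vector_derivative)

lemma integral_mono_continuous:
  fixes f g :: "real \<Rightarrow> real"
  assumes "continuous_on {p..q} f" "continuous_on {p..q} g" "\<And>x. x \<in> {p..q} \<Longrightarrow> f x \<le> g x"
  shows "integral {p..q} f \<le> integral {p..q} g"
  using assms by (intro integral_le integrable_continuous_real) auto

lemma integral_add_continuous:
  fixes f g :: "real \<Rightarrow> real"
  assumes "continuous_on {p..q} f" "continuous_on {p..q} g"
  shows "integral {p..q} (\<lambda>x. f x + g x) = integral {p..q} f + integral {p..q} g"
  using assms by (intro integral_add integrable_continuous_real) auto

lemma integral_diff_continuous:
  fixes f g :: "real \<Rightarrow> real"
  assumes "continuous_on {p..q} f" "continuous_on {p..q} g"
  shows "integral {p..q} (\<lambda>x. f x - g x) = integral {p..q} f - integral {p..q} g"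
  using assms by (intro integral_diff integrable_continuous_real) auto

lemma mvt_abs_bound:
  fixes F F' :: "real \<Rightarrow> real"
  assumes d: "\<And>x. x \<in> {p..q} \<Longrightarrow> (F has_real_derivative F' x) (at x within {p..q})"
    and b: "\<And>x. x \<in> {p..q} \<Longrightarrow> \<bar>F' x\<bar> \<le> L" and xy: "x \<in> {p..q}" "y \<in> {p..q}"
  shows "\<bar>F x - F y\<bar> \<le> L * \<bar>x - y\<bar>"
  using field_differentiable_bound[of "{p..q}" F F' L y x] d b xy by (auto simp: abs_minus_commute)

lemma has_real_derivative_unique_Icc:
  fixes F :: "real \<Rightarrow> real"
  assumes "p < q" "x \<in> {p..q}" "(F has_real_derivative d1) (at x within {p..q})"
    "(F has_real_derivative d2) (at x within {p..q})"
  shows "d1 = d2"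
  using assms vector_derivative_unique_within_closed_interval[of p q x F d1 d2]
  by (simp add: has_real_derivative_iff_has_vector_derivative)

lemma interior_max_derivatives:
  fixes w w1 :: "real \<Rightarrow> real"
  assumes d1: "\<And>x. x \<in> {p<..<q} \<Longrightarrow> (w has_real_derivative w1 x) (at x)"
    and x: "x \<in> {p<..<q}" and d2: "(w1 has_real_derivative w2) (at x)"
    and mx: "\<And>y. y \<in> {p<..<q} \<Longrightarrow> w y \<le> w x"
  shows "w1 x = 0 \<and> w2 \<le> 0"
proof -
  have e: "\<exists>d>0. \<forall>y. \<bar>x - y\<bar> < d \<longrightarrow> w y \<le> w x"
    using x by (intro exI[of _ "min (x - p) (q - x)"]) (auto intro!: mx simp: abs_if split: if_splits)
  then have z: "w1 x = 0" using DERIV_local_max d1 x by blast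
  have "w2 \<le> 0"
  proof (rule ccontr)
    assume "\<not> w2 \<le> 0"
    then obtain d where d: "d > 0" "\<And>h. 0 < h \<Longrightarrow> h < d \<Longrightarrow> w1 x < w1 (x + h)"
      using DERIV_pos_inc_right[OF d2] by auto
    define h where "h = min (d/2) ((q - x)/2)"
    have h: "0 < h" "h < d" "x + h < q" using d x by (auto simp: h_def min_def field_simps)
    have "\<exists>z>x. z < x + h \<and> w (x + h) - w x = (x + h - x) * w1 z"
      using h x by (intro MVT2 d1) auto
    then obtain z where z': "z > x" "z < x + h" "w (x + h) - w x = h * w1 z" by auto
    have "w1 z > 0" using d(2)[of "z - x"] z' h z by auto
    then have "w (x + h) > w x" using z' h by (metis diff_gt_0_iff_gt mult_pos_pos)
    then show False using mx[of "x + h"] h x by auto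
  qed
  then show ?thesis using z by auto
qed

section \<open>Regularity of the solution up to the boundary\<close>

text \<open>A classical solution is only known to be continuous at \<open>\<plusminus>1\<close>. Multiplying the equation by the
integrating factor \<open>exp (- A / \<epsilon>)\<close>, where \<open>A\<close> is a primitive of \<open>a\<close>, turns it into
\<open>(exp (- A / \<epsilon>) u')' = exp (- A / \<epsilon>) (c u - f) / \<epsilon>\<close> with a right-hand side continuous on
\<open>[-1, 1]\<close>, so that \<open>u'\<close> extends continuously to the closed interval. The equation then yields
\<open>u''\<close>, and differentiating it twice yields \<open>u'''\<close> and \<open>u''''\<close>.\<close>

lemma bvp_solution_regular:
  fixes a c f a1 c1 f1 a2 c2 f2 :: "real \<Rightarrow> real"
  assumes eps: "\<epsilon> > 0" and sol: "bvp_solution \<epsilon> a c f u"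
    and da: "\<And>x. x \<in> {-1..1} \<Longrightarrow> (a has_real_derivative a1 x) (at x within {-1..1})"
    and dc: "\<And>x. x \<in> {-1..1} \<Longrightarrow> (c has_real_derivative c1 x) (at x within {-1..1})"
    and df: "\<And>x. x \<in> {-1..1} \<Longrightarrow> (f has_real_derivative f1 x) (at x within {-1..1})"
    and da1: "\<And>x. x \<in> {-1..1} \<Longrightarrow> (a1 has_real_derivative a2 x) (at x within {-1..1})"
    and dc1: "\<And>x. x \<in> {-1..1} \<Longrightarrow> (c1 has_real_derivative c2 x) (at x within {-1..1})"
    and df1: "\<And>x. x \<in> {-1..1} \<Longrightarrow> (f1 has_real_derivative f2 x) (at x within {-1..1})"
    and c2: "continuous_on {-1..1} a2" "continuous_on {-1..1} c2" "continuous_on {-1..1} f2"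
  shows "\<exists>u1 u2 u3 u4.
     (\<forall>x\<in>{-1..1}. (u has_real_derivative u1 x) (at x within {-1..1})) \<and>
     (\<forall>x\<in>{-1..1}. (u1 has_real_derivative u2 x) (at x within {-1..1})) \<and>
     (\<forall>x\<in>{-1..1}. (u2 has_real_derivative u3 x) (at x within {-1..1})) \<and>
     (\<forall>x\<in>{-1..1}. (u3 has_real_derivative u4 x) (at x within {-1..1})) \<and>
     continuous_on {-1..1} u4 \<and>
     (\<forall>x\<in>{-1..1}. \<epsilon> * u2 x = a x * u1 x + c x * u x - f x) \<and>
     (\<forall>x\<in>{-1..1}. \<epsilon> * u3 x = a1 x * u1 x + a x * u2 x + c1 x * u x + c x * u1 x - f1 x) \<and>
     (\<forall>x\<in>{-1..1}. \<epsilon> * u4 x = a2 x * u1 x + 2 * a1 x * u2 x + a x * u3 x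
          + c2 x * u x + 2 * c1 x * u1 x + c x * u2 x - f2 x)"
proof -
  let ?I = "{-1..1::real}"
  have cont: "continuous_on ?I a" "continuous_on ?I c" "continuous_on ?I f"
    using DERIV_continuous_on[OF da] DERIV_continuous_on[OF dc] DERIV_continuous_on[OF df] by blast+
  have uc: "continuous_on ?I u" using sol by (auto simp: bvp_solution_def)
  obtain v1 v2 where v: "\<And>x. x \<in> {-1<..<1} \<Longrightarrow> (u has_real_derivative v1 x) (at x)"
     "\<And>x. x \<in> {-1<..<1} \<Longrightarrow> (v1 has_real_derivative v2 x) (at x)"
     "\<And>x. x \<in> {-1<..<1} \<Longrightarrow> - \<epsilon> * v2 x + a x * v1 x + c x * u x = f x"
    using sol unfolding bvp_solution_def by blast
  define A where "A = (\<lambda>x. integral {-1..x} a)"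
  have dA: "\<And>x. x \<in> ?I \<Longrightarrow> (A has_real_derivative a x) (at x within ?I)"
    unfolding A_def using integral_has_real_derivative[OF cont(1)] by auto
  define q where "q = (\<lambda>x. exp (- A x / \<epsilon>) * ((c x * u x - f x) / \<epsilon>))"
  have Ac: "continuous_on ?I A" using DERIV_continuous_on[OF dA] by blast
  have qc: "continuous_on ?I q" unfolding q_def
    by (intro continuous_intros cont uc Ac) (use eps in auto)
  define Q where "Q = (\<lambda>x. integral {-1..x} q)"
  have dQ: "\<And>x. x \<in> ?I \<Longrightarrow> (Q has_real_derivative q x) (at x within ?I)"
    unfolding Q_def using integral_has_real_derivative[OF qc] by auto
  have at_in: "at x within ?I = at x" if "x \<in> {-1<..<1}" for x :: real
    using that by (intro at_within_interior) (auto simp: interior_atLeastAtMost_real)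
  have "\<exists>k. \<forall>x\<in>{-1<..<1}. exp (- A x / \<epsilon>) * v1 x - Q x = k"
  proof (rule has_field_derivative_zero_constant)
    fix x :: real assume x: "x \<in> {-1<..<1}"
    have d: "(A has_real_derivative a x) (at x)" "(Q has_real_derivative q x) (at x)"
      using dA[of x] dQ[of x] at_in[OF x] x by auto
    have v2: "v2 x = (a x * v1 x + c x * u x - f x) / \<epsilon>" using v(3)[OF x] eps by (simp add: field_simps)
    have "((\<lambda>x. exp (- A x / \<epsilon>) * v1 x - Q x) has_real_derivative
        (exp (- A x / \<epsilon>) * (- a x / \<epsilon>)) * v1 x + v2 x * exp (- A x / \<epsilon>) - q x) (at x)"
      by (intro DERIV_diff DERIV_mult DERIV_fun_exp DERIV_cdivide DERIV_minus d v(2)[OF x])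
    moreover have "(exp (- A x / \<epsilon>) * (- a x / \<epsilon>)) * v1 x + v2 x * exp (- A x / \<epsilon>) - q x = 0"
    proof -
      have "(E * (- a x / \<epsilon>)) * v1 x + ((a x * v1 x + c x * u x - f x) / \<epsilon>) * E - E * ((c x * u x - f x) / \<epsilon>) = 0"
        for E using eps by (simp add: divide_simps) (simp add: algebra_simps)
      then show ?thesis unfolding q_def v2 by simp
    qed
    ultimately have "((\<lambda>x. exp (- A x / \<epsilon>) * v1 x - Q x) has_real_derivative 0) (at x)" by simp
    then show "((\<lambda>x. exp (- A x / \<epsilon>) * v1 x - Q x) has_real_derivative 0) (at x within {-1<..<1})"
      using has_field_derivative_at_within by blast
  qed auto
  then obtain k where k: "\<And>x. x\<in>{-1<..<1} \<Longrightarrow> exp (- A x / \<epsilon>) * v1 x - Q x = k" by blast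
  define u1 where "u1 = (\<lambda>x. exp (A x / \<epsilon>) * (Q x + k))"
  have u1v: "u1 x = v1 x" if "x \<in> {-1<..<1}" for x
  proof -
    have "exp (A x / \<epsilon>) * exp (- A x / \<epsilon>) = 1" by (simp flip: exp_add)
    moreover have "Q x + k = exp (- A x / \<epsilon>) * v1 x" using k[OF that] by simp
    ultimately show ?thesis unfolding u1_def by (metis mult.assoc mult_1)
  qed
  define u2 where "u2 = (\<lambda>x. (a x * u1 x + c x * u x - f x) / \<epsilon>)"
  have d1: "(u1 has_real_derivative u2 x) (at x within ?I)" if x: "x \<in> ?I" for x
  proof -
    have "exp (A x / \<epsilon>) * exp (- A x / \<epsilon>) = 1" by (simp flip: exp_add)
    then have e: "q x * exp (A x / \<epsilon>) = (c x * u x - f x) / \<epsilon>" unfolding q_def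
      by (metis mult.assoc mult.commute mult_1)
    have "(u1 has_real_derivative (exp (A x / \<epsilon>) * (a x / \<epsilon>)) * (Q x + k) + (q x + 0) * exp (A x / \<epsilon>)) (at x within ?I)"
      unfolding u1_def by (intro DERIV_add DERIV_mult DERIV_chain2[where f=exp] DERIV_exp DERIV_cdivide DERIV_const dA[OF x] dQ[OF x])
    moreover have "(exp (A x / \<epsilon>) * (a x / \<epsilon>)) * (Q x + k) + (q x + 0) * exp (A x / \<epsilon>) = u2 x"
      using e by (simp add: u2_def u1_def add_divide_distrib diff_divide_distrib mult_ac)
    ultimately show ?thesis by simp
  qed
  have u1c: "continuous_on ?I u1" using DERIV_continuous_on[OF d1] by blast
  define U where "U = (\<lambda>x. integral {-1..x} u1)"
  have dU: "\<And>x. x \<in> ?I \<Longrightarrow> (U has_real_derivative u1 x) (at x within ?I)"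
    unfolding U_def using integral_has_real_derivative[OF u1c] by auto
  have Uc: "continuous_on ?I U" using DERIV_continuous_on[OF dU] by blast
  \<comment> \<open>\<open>u\<close> differs by a constant from the primitive \<open>U\<close> of the extended derivative, also at \<open>\<plusminus>1\<close>\<close>
  have con: "u x - U x = u y - U y" if "x \<in> ?I" "y \<in> ?I" "x < y" for x y
  proof -
    have "(\<lambda>x. u x - U x) y = (\<lambda>x. u x - U x) x"
    proof (rule DERIV_isconst_end[OF that(3)])
      show "continuous_on {x..y} (\<lambda>x. u x - U x)"
        using that by (intro continuous_on_subset[OF continuous_on_diff[OF uc Uc]]) auto
      fix z assume z: "x < z" "z < y"
      then have zi: "z \<in> {-1<..<1}" using that by auto
      then have "(U has_real_derivative u1 z) (at z)" using dU[of z] at_in[OF zi] by auto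
      then show "((\<lambda>x. u x - U x) has_real_derivative 0) (at z)"
        using v(1)[OF zi] u1v[OF zi] DERIV_diff by fastforce
    qed
    then show ?thesis by simp
  qed
  have con': "u x = U x + (u 0 - U 0)" if "x \<in> ?I" for x
    using con[of x 0] con[of 0 x] that
    by (metis add.commute atLeastAtMost_iff diff_add_cancel less_linear neg_le_0_iff_le zero_le_one)
  have d0: "(u has_real_derivative u1 x) (at x within ?I)" if x: "x \<in> ?I" for x
  proof -
    have "((\<lambda>x. U x + (u 0 - U 0)) has_real_derivative u1 x) (at x within ?I)"
      by (auto intro!: derivative_eq_intros dU[OF x])
    then show ?thesis
      by (rule has_field_derivative_transform_within[where d = 1]) (simp, rule x, rule con'[symmetric])
  qed
  define u3 where "u3 = (\<lambda>x. (a1 x * u1 x + a x * u2 x + c1 x * u x + c x * u1 x - f1 x) / \<epsilon>)"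
  have d2: "(u2 has_real_derivative u3 x) (at x within ?I)" if x: "x \<in> ?I" for x
    unfolding u2_def
    by (auto intro!: derivative_eq_intros da[OF x] dc[OF x] df[OF x] d0[OF x] d1[OF x] simp: u3_def u2_def)
      (use eps in \<open>simp add: field_simps\<close>)?
  define u4 where "u4 = (\<lambda>x. (a2 x * u1 x + 2 * a1 x * u2 x + a x * u3 x
          + c2 x * u x + 2 * c1 x * u1 x + c x * u2 x - f2 x) / \<epsilon>)"
  have d3: "(u3 has_real_derivative u4 x) (at x within ?I)" if x: "x \<in> ?I" for x
  proof -
    have "((\<lambda>x. (a1 x * u1 x + a x * u2 x + c1 x * u x + c x * u1 x - f1 x) / \<epsilon>) has_real_derivative
       ((a2 x * u1 x + u2 x * a1 x) + (a1 x * u2 x + u3 x * a x) + (c2 x * u x + u1 x * c1 x)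
         + (c1 x * u1 x + u2 x * c x) - f2 x) / \<epsilon>) (at x within ?I)"
      using x by (intro DERIV_cdivide DERIV_diff DERIV_add DERIV_mult da dc df da1 dc1 df1 d0 d1 d2)
    then show ?thesis unfolding u3_def u4_def by (simp add: algebra_simps)
  qed
  have cc: "continuous_on ?I a1" "continuous_on ?I c1" "continuous_on ?I u2" "continuous_on ?I u3"
    using DERIV_continuous_on[OF da1] DERIV_continuous_on[OF dc1] DERIV_continuous_on[OF d2] DERIV_continuous_on[OF d3]
    by blast+
  have "continuous_on ?I u4" unfolding u4_def
    by (intro continuous_intros cont uc u1c cc c2) (use eps in auto)
  then show ?thesis
    using d0 d1 d2 d3 eps by (intro exI[of _ u1] exI[of _ u2] exI[of _ u3] exI[of _ u4]) (simp add: u2_def u3_def u4_def)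
qed

section \<open>A priori estimates in weighted norms\<close>

lemma abs_mult_le: "\<bar>p\<bar> \<le> P \<Longrightarrow> \<bar>q\<bar> \<le> Q \<Longrightarrow> \<bar>p * q\<bar> \<le> P * (Q::real)"
  unfolding abs_mult by (intro mult_mono) auto

lemma square_of_bound: "\<bar>w\<bar> \<le> r \<Longrightarrow> w^2 \<le> (r::real)^2"
  by (metis abs_ge_zero power2_abs power_mono)

text \<open>The data together with constants that quantify the hypotheses: \<open>B\<close> bounds all data and their
derivatives, \<open>\<beta>\<close> is a lower bound of \<open>b\<close>, and \<open>m\<close> is the value that the differential operator
assigns at least to the barrier \<open>2 - x\<^sup>2\<close>. All estimates below are expressed through these
constants only, which makes them uniform in \<open>\<epsilon>\<close>.\<close>

locale tp_data =
  fixes a a1 a2 c c1 c2 f f1 f2 :: "real \<Rightarrow> real" and \<beta> B m :: real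
  assumes da: "\<And>x. x \<in> {-1..1} \<Longrightarrow> (a has_real_derivative a1 x) (at x within {-1..1})"
    and dc: "\<And>x. x \<in> {-1..1} \<Longrightarrow> (c has_real_derivative c1 x) (at x within {-1..1})"
    and df: "\<And>x. x \<in> {-1..1} \<Longrightarrow> (f has_real_derivative f1 x) (at x within {-1..1})"
    and da1: "\<And>x. x \<in> {-1..1} \<Longrightarrow> (a1 has_real_derivative a2 x) (at x within {-1..1})"
    and dc1: "\<And>x. x \<in> {-1..1} \<Longrightarrow> (c1 has_real_derivative c2 x) (at x within {-1..1})"
    and df1: "\<And>x. x \<in> {-1..1} \<Longrightarrow> (f1 has_real_derivative f2 x) (at x within {-1..1})"
    and B1: "B \<ge> 1"
    and bd: "\<And>x. x \<in> {-1..1} \<Longrightarrow> \<bar>a x\<bar> \<le> B * \<bar>x\<bar>"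
      "\<And>x. x \<in> {-1..1} \<Longrightarrow> \<bar>a1 x\<bar> \<le> B" "\<And>x. x \<in> {-1..1} \<Longrightarrow> \<bar>a2 x\<bar> \<le> B"
      "\<And>x. x \<in> {-1..1} \<Longrightarrow> \<bar>c x\<bar> \<le> B" "\<And>x. x \<in> {-1..1} \<Longrightarrow> \<bar>c1 x\<bar> \<le> B"
      "\<And>x. x \<in> {-1..1} \<Longrightarrow> \<bar>c2 x\<bar> \<le> B" "\<And>x. x \<in> {-1..1} \<Longrightarrow> \<bar>f x\<bar> \<le> B"
      "\<And>x. x \<in> {-1..1} \<Longrightarrow> \<bar>f1 x\<bar> \<le> B" "\<And>x. x \<in> {-1..1} \<Longrightarrow> \<bar>f2 x\<bar> \<le> B"
    and \<beta>: "\<beta> > 0" "\<And>x. x \<in> {-1..1} \<Longrightarrow> - (x * a x) \<ge> \<beta> * x^2"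
    and c_nonneg: "\<And>x. x \<in> {-1..1} \<Longrightarrow> c x \<ge> 0"
    and m: "m > 0" "\<And>x. x \<in> {-1..1} \<Longrightarrow> c x - 2 * (x * a x) \<ge> m"
begin

text \<open>The constants of the estimates, in the order in which they arise: \<open>Msup\<close> bounds \<open>u\<close>; \<open>K1\<close>,
\<open>K2\<close>, \<open>K3\<close> belong to the pointwise bounds of \<open>u'\<close>, \<open>u''\<close>, \<open>u'''\<close>; \<open>Cen k\<close> is the contribution of
the layer to the energy estimate with weight index \<open>k\<close>; \<open>E1\<close>, \<open>E2\<close>, \<open>E3\<close> bound the weighted
integrals of \<open>u'\<^sup>2\<close>, \<open>u''\<^sup>2\<close>, \<open>u'''\<^sup>2\<close>.\<close>

definition Msup :: real where "Msup = 2 * (B + 1) / m"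
definition K1 :: real where "K1 = 6 * (B * (2 * Msup + 1)) + 2 * Msup"
definition K2 :: real where "K2 = B * (K1 + Msup + 1)"
definition K3 :: real where "K3 = 2 * B * K1 + B * K2 + B * (Msup + 1)"
definition Cen :: "nat \<Rightarrow> real" where
  "Cen k = 4 * ((\<beta> + real k + 1) * (4 * (\<beta> + real k + 1) / \<beta>) ^ (2 * Suc k))"
definition E1 :: real where "E1 = 4 / (3 * \<beta>) * (4 * (B * Msup + B * Msup^2) + Cen 0 * K1^2)"
definition E2 :: real where "E2 = 2 / \<beta> * (1 / \<beta> * (8 * B^2 * (1 + Msup)^2 + 8 * B^2 * E1) + Cen 1 * K2^2)"
definition E3 :: real where "E3 = 2 / \<beta> * (1 / \<beta> * (24 * B^2 * (1 + Msup)^2 + 54 * B^2 * E1 + 27 * B^2 * E2) + Cen 2 * K3^2)"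

end

locale tp_sol = tp_data +
  fixes \<epsilon> :: real and u u1 u2 u3 u4 :: "real \<Rightarrow> real"
  assumes eps: "0 < \<epsilon>" "\<epsilon> \<le> 1"
    and bc: "u (-1) = 0" "u 1 = 0"
    and du: "\<And>x. x \<in> {-1..1} \<Longrightarrow> (u has_real_derivative u1 x) (at x within {-1..1})"
    and du1: "\<And>x. x \<in> {-1..1} \<Longrightarrow> (u1 has_real_derivative u2 x) (at x within {-1..1})"
    and du2: "\<And>x. x \<in> {-1..1} \<Longrightarrow> (u2 has_real_derivative u3 x) (at x within {-1..1})"
    and du3: "\<And>x. x \<in> {-1..1} \<Longrightarrow> (u3 has_real_derivative u4 x) (at x within {-1..1})"
    and cu4: "continuous_on {-1..1} u4"
    and eq0: "\<And>x. x \<in> {-1..1} \<Longrightarrow> \<epsilon> * u2 x = a x * u1 x + c x * u x - f x"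
    and eq1: "\<And>x. x \<in> {-1..1} \<Longrightarrow>
        \<epsilon> * u3 x = a1 x * u1 x + a x * u2 x + c1 x * u x + c x * u1 x - f1 x"
    and eq2: "\<And>x. x \<in> {-1..1} \<Longrightarrow> \<epsilon> * u4 x = a2 x * u1 x + 2 * a1 x * u2 x + a x * u3 x
          + c2 x * u x + 2 * c1 x * u1 x + c x * u2 x - f2 x"
begin

lemma conts: "continuous_on {-1..1} a" "continuous_on {-1..1} c" "continuous_on {-1..1} f"
  "continuous_on {-1..1} a1" "continuous_on {-1..1} c1" "continuous_on {-1..1} f1"
  "continuous_on {-1..1} u" "continuous_on {-1..1} u1" "continuous_on {-1..1} u2" "continuous_on {-1..1} u3"
  using DERIV_continuous_on[OF da] DERIV_continuous_on[OF dc] DERIV_continuous_on[OF df]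
    DERIV_continuous_on[OF da1] DERIV_continuous_on[OF dc1] DERIV_continuous_on[OF df1]
    DERIV_continuous_on[OF du] DERIV_continuous_on[OF du1] DERIV_continuous_on[OF du2]
    DERIV_continuous_on[OF du3] by blast+

lemma at_interior: "x \<in> {-1<..<1} \<Longrightarrow> at x within {-1..1} = at (x::real)"
  by (intro at_within_interior) (auto simp: interior_atLeastAtMost_real)

text \<open>The operator maps \<open>2 - x\<^sup>2\<close> to \<open>2 \<epsilon> - 2 x a + c (2 - x\<^sup>2) \<ge> m\<close>: near the turning point the reaction
term is positive, and away from it the convection term is. Hence a multiple of \<open>2 - x\<^sup>2\<close> dominates
\<open>u\<close> and \<open>- u\<close> (\<open>s = \<plusminus>1\<close>) by the maximum principle.\<close>

lemma upper_barrier: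
  assumes s: "s = 1 \<or> s = -1" and x: "x \<in> {-1..1}"
  shows "s * u x \<le> (B + 1) / m * (2 - x^2)"
proof (rule ccontr)
  define k where "k = (B + 1) / m"
  have k: "k > 0" "k * m = B + 1" using B1 m by (auto simp: k_def)
  define w where "w = (\<lambda>x. s * u x - k * (2 - x^2))"
  define w1 where "w1 = (\<lambda>x. s * u1 x + 2 * k * x)"
  assume "\<not> s * u x \<le> (B + 1) / m * (2 - x^2)"
  then have pos: "w x > 0" by (simp add: w_def k_def)
  have wc: "continuous_on {-1..1} w" unfolding w_def by (intro continuous_intros conts)
  obtain y where y: "y \<in> {-1..1}" "\<And>z. z \<in> {-1..1} \<Longrightarrow> w z \<le> w y"
    using continuous_attains_sup[OF _ _ wc] by auto
  have wy: "w y > 0" using y(2)[OF x] pos by auto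
  have "w (-1) < 0" "w 1 < 0" using k by (auto simp: w_def bc)
  then have yi: "y \<in> {-1<..<1}" using y(1) wy by (cases "y = -1"; cases "y = 1"; auto)
  have d1: "(w has_real_derivative w1 z) (at z)" if "z \<in> {-1<..<1}" for z
    using du[of z] that at_interior[OF that] m(1) unfolding w_def w1_def
    by (auto intro!: derivative_eq_intros)
  have d2: "(w1 has_real_derivative s * u2 y + 2 * k) (at y)"
    using du1[of y] yi at_interior[OF yi] m(1) unfolding w1_def
    by (auto intro!: derivative_eq_intros)
  have z: "w1 y = 0" "s * u2 y + 2 * k \<le> 0"
    using interior_max_derivatives[OF d1 yi d2] y(2) by auto
  have "\<epsilon> * (s * u2 y) = a y * (s * u1 y) + c y * (s * u y) - s * f y"
    using eq0[OF y(1)] by (metis (no_types, opaque_lifting) mult.left_commute right_diff_distrib distrib_left)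
  moreover have "s * u1 y = - 2 * k * y" using z(1) unfolding w1_def by linarith
  moreover have "c y * (s * u y) \<ge> c y * (k * (2 - y^2))"
    using wy c_nonneg[OF y(1)] by (intro mult_left_mono) (auto simp: w_def)
  ultimately have "\<epsilon> * (s * u2 y) \<ge> a y * (- 2 * k * y) + c y * (k * (2 - y^2)) - s * f y" by simp
  also have "a y * (- 2 * k * y) + c y * (k * (2 - y^2)) = k * (c y - 2 * (y * a y)) + k * (c y * (1 - y^2))"
    by (simp add: algebra_simps)
  finally have 1: "k * (c y - 2 * (y * a y)) + k * (c y * (1 - y^2)) - s * f y \<le> \<epsilon> * (s * u2 y)" .
  have "k * (c y - 2 * (y * a y)) \<ge> k * m" using m(2)[OF y(1)] k by (intro mult_left_mono) auto
  moreover note k(2)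
  moreover have "y^2 \<le> 1" using y(1) by (simp add: abs_square_le_1 abs_le_iff)
  then have "k * (c y * (1 - y^2)) \<ge> 0" using k c_nonneg[OF y(1)] by (intro mult_nonneg_nonneg) auto
  moreover have "\<bar>s * f y\<bar> \<le> B" using bd(7)[OF y(1)] s by auto
  ultimately have "\<epsilon> * (s * u2 y) > 0" using 1 by linarith
  moreover have "s * u2 y \<le> 0" using z(2) k by linarith
  ultimately show False using eps mult_nonneg_nonpos[of \<epsilon> "s * u2 y"] by linarith
qed

lemma u_bound: "x \<in> {-1..1} \<Longrightarrow> \<bar>u x\<bar> \<le> Msup"
proof -
  assume x: "x \<in> {-1..1}"
  have "(B + 1) / m * (2 - x^2) \<le> (B + 1) / m * 2" using B1 m(1) by (intro mult_left_mono) auto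
  then show ?thesis using upper_barrier[of 1 x] upper_barrier[of "-1" x] x
    unfolding Msup_def times_divide_eq_left by (simp add: mult.commute[of 2] abs_le_iff)
qed

text \<open>\<open>sqrt (S x)\<close> is a smooth substitute for the layer distance \<open>sqrt \<epsilon> + \<bar>x\<bar>\<close>.\<close>

abbreviation S :: "real \<Rightarrow> real" where "S x \<equiv> \<epsilon> + x^2"

lemma S_pos: "S x > 0" and S_ge: "S x \<ge> \<epsilon>" using eps by (auto intro: add_pos_nonneg)

lemma abs_le_sqrtS: "\<bar>x\<bar> \<le> sqrt (S x)" "sqrt \<epsilon> \<le> sqrt (S x)"
  using eps by (auto intro!: real_le_rsqrt)

lemma Msup_pos: "Msup > 0" using B1 m by (auto simp: Msup_def)

text \<open>The function \<open>P = \<epsilon> u' - a u\<close> has the bounded derivative \<open>(c - a') u - f\<close>, because the equation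
absorbs \<open>u''\<close> and the term \<open>a u'\<close>. It is of size \<open>sqrt \<epsilon>\<close> at a point within distance \<open>sqrt \<epsilon>\<close> of
the origin, by the mean value theorem for \<open>u\<close> on \<open>[0, sqrt \<epsilon>]\<close>.\<close>

lemma u1_bound:
  assumes x: "x \<in> {-1..1}"
  shows "\<epsilon> * \<bar>u1 x\<bar> \<le> (6 * (B * (2 * Msup + 1)) + 2 * Msup) * sqrt (S x)"
proof -
  define P where "P = (\<lambda>x. \<epsilon> * u1 x - a x * u x)"
  have dP: "(P has_real_derivative c x * u x - f x - a1 x * u x) (at x within {-1..1})" if "x \<in> {-1..1}" for x
  proof -
    have "(P has_real_derivative \<epsilon> * u2 x - (a1 x * u x + u1 x * a x)) (at x within {-1..1})"
      unfolding P_def using that by (intro DERIV_diff DERIV_cmult DERIV_mult du du1 da)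
    then show ?thesis using eq0[OF that] by (simp add: algebra_simps)
  qed
  have bP: "\<bar>c x * u x - f x - a1 x * u x\<bar> \<le> B * (2 * Msup + 1)" if "x \<in> {-1..1}" for x
  proof -
    have "\<bar>c x * u x\<bar> \<le> B * Msup" "\<bar>a1 x * u x\<bar> \<le> B * Msup"
      by (intro abs_mult_le bd u_bound that)+
    moreover have "B * (2 * Msup + 1) = B * Msup + B * Msup + B" by (simp add: algebra_simps)
    ultimately show ?thesis using bd(7)[OF that] by linarith
  qed
  define s where "s = sqrt \<epsilon>"
  have s: "0 < s" "s \<le> 1" "s * s = \<epsilon>" using eps by (auto simp: s_def)
  have at: "(u has_real_derivative u1 x) (at x)" if "0 < x" "x < s" for x
    using du[of x] at_interior[of x] that s by auto
  have "\<exists>l z. z > 0 \<and> z < s \<and> (u has_real_derivative l) (at z) \<and> u s - u 0 = (s - 0) * l"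
    using s at by (intro MVT continuous_on_subset[OF conts(7)]) (auto simp: real_differentiable_def, blast?)
  then obtain l y where y: "y > 0" "y < s" "(u has_real_derivative l) (at y)" "u s - u 0 = s * l" by auto
  then have "u s - u 0 = s * u1 y" using at[OF y(1,2)] DERIV_unique by blast
  moreover have "\<bar>u s - u 0\<bar> \<le> 2 * Msup" using u_bound[of s] u_bound[of 0] s by auto
  ultimately have "\<bar>s * u1 y\<bar> \<le> 2 * Msup" by simp
  then have "s * \<bar>s * u1 y\<bar> \<le> s * (2 * Msup)" using s by (intro mult_left_mono) auto
  moreover have "\<bar>\<epsilon> * u1 y\<bar> = s * \<bar>s * u1 y\<bar>"
  proof -
    have "\<epsilon> * u1 y = s * (s * u1 y)" by (metis mult.assoc s(3))
    then show ?thesis using s(1) by (metis abs_mult abs_of_pos)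
  qed
  ultimately have e1: "\<bar>\<epsilon> * u1 y\<bar> \<le> 2 * Msup * s" by (simp add: mult_ac)
  have y1: "y \<in> {-1..1}" using y s by auto
  have au: "\<bar>a x * u x\<bar> \<le> B * Msup * \<bar>x\<bar>" if "x \<in> {-1..1}" for x
  proof -
    have "\<bar>a x\<bar> * \<bar>u x\<bar> \<le> (B * \<bar>x\<bar>) * Msup" using bd(1)[OF that] u_bound[OF that] B1 by (intro mult_mono) auto
    then show ?thesis by (simp add: abs_mult mult_ac)
  qed
  have "\<bar>P x - P y\<bar> \<le> B * (2 * Msup + 1) * \<bar>x - y\<bar>"
    by (rule mvt_abs_bound[OF dP bP x y1])
  also have "\<dots> \<le> B * (2 * Msup + 1) * (2 * sqrt (S x))"
  proof (intro mult_left_mono)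
    show "\<bar>x - y\<bar> \<le> 2 * sqrt (S x)" using y abs_le_sqrtS(1)[of x] abs_le_sqrtS(2)[of x] unfolding s_def by linarith
  qed (use B1 Msup_pos in auto)
  finally have e2: "\<bar>P x - P y\<bar> \<le> 2 * (B * (2 * Msup + 1)) * sqrt (S x)" by (simp only: mult_ac)
  have K: "B * Msup * \<bar>x\<bar> \<le> B * Msup * sqrt (S x)" "B * Msup * \<bar>y\<bar> \<le> B * Msup * sqrt (S x)"
     "2 * Msup * s \<le> 2 * Msup * sqrt (S x)"
  proof -
    have "\<bar>y\<bar> \<le> sqrt (S x)" using y abs_le_sqrtS(2)[of x] unfolding s_def by linarith
    then show "B * Msup * \<bar>x\<bar> \<le> B * Msup * sqrt (S x)" "B * Msup * \<bar>y\<bar> \<le> B * Msup * sqrt (S x)"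
        "2 * Msup * s \<le> 2 * Msup * sqrt (S x)"
      using abs_le_sqrtS[of x] B1 Msup_pos by (auto simp: s_def intro!: mult_left_mono)
  qed
  have "\<epsilon> * u1 x = a x * u x + (P x - P y) + (\<epsilon> * u1 y - a y * u y)" by (simp add: P_def)
  then have "\<bar>\<epsilon> * u1 x\<bar> \<le> B * Msup * sqrt (S x) + 2 * (B * (2 * Msup + 1)) * sqrt (S x) + 2 * Msup * sqrt (S x)
      + B * Msup * sqrt (S x)"
    using K e1 e2 au[OF x] au[OF y1] by linarith
  also have "\<dots> = (B * Msup + 2 * (B * (2 * Msup + 1)) + 2 * Msup + B * Msup) * sqrt (S x)"
    by (simp add: algebra_simps)
  also have "\<dots> \<le> (6 * (B * (2 * Msup + 1)) + 2 * Msup) * sqrt (S x)"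
  proof (intro mult_right_mono)
    have "B * Msup > 0" using B1 Msup_pos by auto
    then show "B * Msup + 2 * (B * (2 * Msup + 1)) + 2 * Msup + B * Msup \<le> 6 * (B * (2 * Msup + 1)) + 2 * Msup"
      using B1 by (simp add: algebra_simps)
  qed (use eps in auto)
  finally show ?thesis using eps by (simp add: abs_mult)
qed

end

context tp_sol begin

text \<open>The weight \<open>\<omega> k\<close> is \<open>sqrt (S x) ^ (2 k - 1)\<close>, written so that \<open>k = 0\<close> is covered.\<close>

definition \<omega> :: "nat \<Rightarrow> real \<Rightarrow> real" where "\<omega> k x = S x ^ k / sqrt (S x)"

lemma omega_Suc: "\<omega> (Suc k) x = S x * \<omega> k x" by (simp add: \<omega>_def)

lemma omega_pos: "\<omega> k x > 0" using S_pos[of x] by (simp add: \<omega>_def)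

lemma omega_deriv: "(\<omega> k has_real_derivative \<omega> k x * ((2 * real k - 1) * x / S x)) (at x within A)"
proof (induction k)
  case 0
  have "((\<lambda>x. inverse (sqrt (S x))) has_real_derivative
     - (inverse (sqrt (S x)) * (inverse (sqrt (S x)) / 2 * (2 * x)) * inverse (sqrt (S x)))) (at x within A)"
    using S_pos[of x] by (auto intro!: derivative_eq_intros simp: power2_eq_square)
  moreover have "- (inverse (sqrt (S x)) * (inverse (sqrt (S x)) / 2 * (2 * x)) * inverse (sqrt (S x)))
     = 1 / sqrt (S x) * ((- 1) * x / S x)"
    using S_pos[of x] abs_of_pos[OF S_pos[of x]] by (simp add: field_simps)
  ultimately show ?case using S_pos[of x] by (simp add: \<omega>_def[abs_def] inverse_eq_divide mult.commute abs_of_pos)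
next
  case (Suc k)
  have "((\<lambda>x. S x * \<omega> k x) has_real_derivative (0 + 2 * x) * \<omega> k x + \<omega> k x * ((2 * real k - 1) * x / S x) * S x) (at x within A)"
    by (intro DERIV_mult DERIV_add Suc) (auto intro!: derivative_eq_intros)
  moreover have "(0 + 2 * x) * \<omega> k x + \<omega> k x * ((2 * real k - 1) * x / S x) * S x =
    \<omega> (Suc k) x * ((2 * real (Suc k) - 1) * x / S x)"
    using S_pos[of x] by (simp add: omega_Suc) (simp add: field_simps)
  ultimately show ?case unfolding omega_Suc[abs_def] by simp
qed

lemma omega_cont: "continuous_on A (\<omega> k)"
  using DERIV_continuous_on[OF omega_deriv] by blast

text \<open>The kernel \<open>sqrt \<epsilon> / S\<close> has mass of order one concentrated in the layer \<open>\<bar>x\<bar> \<le> sqrt \<epsilon>\<close>. It serves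
as the majorant for everything that is only controlled pointwise there.\<close>

lemma arctan_kernel_integral:
  "((\<lambda>x. sqrt \<epsilon> / S x) has_integral 2 * arctan (1 / sqrt \<epsilon>)) {-1..1}"
proof -
  have "((\<lambda>x. sqrt \<epsilon> / S x) has_integral arctan (1 / sqrt \<epsilon>) - arctan (- 1 / sqrt \<epsilon>)) {-1..1}"
  proof (rule ftc_has_integral)
    fix x :: real
    have 1: "((\<lambda>x. arctan (x / sqrt \<epsilon>)) has_real_derivative inverse (1 + (x / sqrt \<epsilon>)^2) * (1 / sqrt \<epsilon>)) (at x within {-1..1})"
      by (intro DERIV_chain2[where f = arctan] DERIV_arctan DERIV_cdivide DERIV_ident)
    have "inverse (1 + (x / sqrt \<epsilon>)^2) = \<epsilon> / S x"
      using eps S_pos[of x] by (simp add: power_divide) (simp add: field_simps)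
    then have "inverse (1 + (x / sqrt \<epsilon>)^2) * (1 / sqrt \<epsilon>) = (\<epsilon> / sqrt \<epsilon>) / S x" by simp
    also have "\<dots> = sqrt \<epsilon> / S x" using eps by (simp add: real_div_sqrt)
    finally show "((\<lambda>x. arctan (x / sqrt \<epsilon>)) has_real_derivative sqrt \<epsilon> / S x) (at x within {-1..1})"
      using 1 by simp
  qed auto
  then show ?thesis by (simp add: arctan_minus)
qed

lemma arctan_kernel_bound: "integral {-1..1} (\<lambda>x. sqrt \<epsilon> / S x) \<le> 4"
  using arctan_kernel_integral arctan_ubound[of "1 / sqrt \<epsilon>"] pi_less_4 by (simp add: integral_unique)

text \<open>Outside the layer, where \<open>\<epsilon> \<le> \<theta> S\<close>, the diffusive term is absorbed by the next higher weight.
Inside, the pointwise bound on \<open>w = v\<^sup>2\<close> reduces it to the integrable kernel.\<close>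

lemma inner_layer_split:
  assumes th: "0 < \<theta>" "\<theta> \<le> 1" and K: "K \<ge> 0" and w: "w \<ge> 0" "w \<le> K * (S x / \<epsilon>^2) ^ Suc k"
  shows "\<epsilon> * \<omega> k x * w \<le> \<theta> * \<omega> (Suc k) x * w + K * (1 / \<theta>) ^ (2 * Suc k) * (sqrt \<epsilon> / S x)"
proof (cases "\<epsilon> \<le> \<theta> * S x")
  case True
  then have "\<epsilon> * (\<omega> k x * w) \<le> (\<theta> * S x) * (\<omega> k x * w)"
    using omega_pos[of k x] w by (intro mult_right_mono mult_nonneg_nonneg) auto
  moreover have "K * (1 / \<theta>) ^ (2 * Suc k) * (sqrt \<epsilon> / S x) \<ge> 0" using th K eps S_pos[of x] by auto
  ultimately show ?thesis by (simp add: omega_Suc mult_ac)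
next
  case False
  then have q: "S x / \<epsilon> \<le> 1 / \<theta>" using th eps by (simp add: field_simps)
  have s: "\<epsilon> \<le> sqrt \<epsilon> * sqrt (S x)"
  proof -
    have "sqrt \<epsilon> * sqrt \<epsilon> \<le> sqrt \<epsilon> * sqrt (S x)" using abs_le_sqrtS[of x] eps by (intro mult_left_mono) auto
    then show ?thesis using eps by simp
  qed
  have "\<epsilon> * \<omega> k x * w * S x \<le> \<epsilon> * \<omega> k x * (K * (S x / \<epsilon>^2) ^ Suc k) * S x"
    using w omega_pos[of k x] eps S_pos[of x] by (intro mult_left_mono mult_right_mono) auto
  also have "\<dots> = K * (S x / \<epsilon>) ^ (2 * Suc k) * (\<epsilon> / sqrt (S x))"
    using eps S_pos[of x] unfolding \<omega>_def
    by (simp add: power_divide power_mult power_mult_distrib power2_eq_square mult_ac)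
  also have "\<dots> \<le> K * (1 / \<theta>) ^ (2 * Suc k) * sqrt \<epsilon>"
    using K q eps S_pos[of x] th s by (intro mult_mono power_mono mult_nonneg_nonneg) (auto simp: divide_le_eq)
  finally have "\<epsilon> * \<omega> k x * w \<le> K * (1 / \<theta>) ^ (2 * Suc k) * (sqrt \<epsilon> / S x)"
    using S_pos[of x] unfolding times_divide_eq_right by (subst pos_le_divide_eq)
  moreover have "\<theta> * \<omega> (Suc k) x * w \<ge> 0" using th w omega_pos[of "Suc k" x] by auto
  ultimately show ?thesis by linarith
qed

text \<open>This is the identity obtained by testing \<open>- \<epsilon> v' + a v\<close> with \<open>- x \<omega>\<^sub>k v\<close>. Since \<open>- x a \<ge> \<beta> x\<^sup>2\<close>, the
convection term controls \<open>\<beta> \<integral> x\<^sup>2 \<omega>\<^sub>k v\<^sup>2\<close>; the boundary terms of the diffusion term have the good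
sign at both ends because \<open>x \<omega>\<^sub>k\<close> is odd, and its interior term \<open>\<epsilon> (x \<omega>\<^sub>k)' v\<^sup>2 / 2\<close> is split by
\<open>inner_layer_split\<close>. It is applied to \<open>v = u', u'', u'''\<close> with \<open>k = 0, 1, 2\<close>.\<close>

lemma energy_core:
  assumes dv: "\<And>x. x \<in> {-1..1} \<Longrightarrow> (v has_real_derivative v' x) (at x within {-1..1})"
    and cv': "continuous_on {-1..1} v'" and K: "K \<ge> 0"
    and bv: "\<And>x. x \<in> {-1..1} \<Longrightarrow> (v x)^2 \<le> K * (S x / \<epsilon>^2) ^ Suc k"
  shows "3/4 * \<beta> * integral {-1..1} (\<lambda>x. \<omega> (Suc k) x * (v x)^2)
    \<le> - integral {-1..1} (\<lambda>x. x * \<omega> k x * v x * (a x * v x - \<epsilon> * v' x)) + Cen k * K"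
proof -
  let ?I = "{-1..1::real}"
  \<comment> \<open>this choice lets the outer part absorb exactly a quarter of the main term\<close>
  define \<theta> where "\<theta> = \<beta> / (4 * (\<beta> + real k + 1))"
  have th: "0 < \<theta>" "\<theta> \<le> 1" "(\<beta> + real k + 1) * \<theta> = \<beta> / 4" "1 / \<theta> = 4 * (\<beta> + real k + 1) / \<beta>"
    using \<beta>(1) by (auto simp: \<theta>_def field_simps)
  define G where "G = (\<lambda>x. x * \<omega> k x * v x * (a x * v x - \<epsilon> * v' x))"
  define F where "F = (\<lambda>x. (- \<epsilon> / 2) * ((x * \<omega> k x) * (v x)^2))"
  define p1 where "p1 = (\<lambda>x. \<omega> k x * (1 + (2 * real k - 1) * x^2 / S x))"
  define F' where "F' = (\<lambda>x. (- \<epsilon> / 2) * (p1 x * (v x)^2 + (2 * v x * v' x) * (x * \<omega> k x)))"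
  have vc: "continuous_on ?I v" using DERIV_continuous_on[OF dv] by blast
  have p1c: "continuous_on ?I p1" unfolding p1_def
    by (intro continuous_intros omega_cont) (metis S_pos less_irrefl)
  have Gc: "continuous_on ?I G" unfolding G_def by (intro continuous_intros omega_cont conts cv' vc)
  have F'c: "continuous_on ?I F'" unfolding F'_def by (intro continuous_intros omega_cont p1c cv' vc)
  have dF: "(F has_real_derivative F' x) (at x within ?I)" if x: "x \<in> ?I" for x
  proof -
    have "((\<lambda>x. x * \<omega> k x) has_real_derivative 1 * \<omega> k x + \<omega> k x * ((2 * real k - 1) * x / S x) * x) (at x within ?I)"
      by (intro DERIV_mult DERIV_ident omega_deriv)
    moreover have "1 * \<omega> k x + \<omega> k x * ((2 * real k - 1) * x / S x) * x = p1 x"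
      by (simp add: p1_def power2_eq_square algebra_simps)
    ultimately have 1: "((\<lambda>x. x * \<omega> k x) has_real_derivative p1 x) (at x within ?I)" by simp
    have 2: "((\<lambda>x. (v x)^2) has_real_derivative 2 * v x * v' x) (at x within ?I)"
      by (rule derivative_eq_intros dv[OF x] refl | simp)+
    show ?thesis unfolding F_def F'_def by (intro DERIV_cmult DERIV_mult 1 2)
  qed
  have "(F' has_integral F 1 - F (-1)) ?I" by (rule ftc_has_integral) (auto intro: dF)
  then have iF: "integral ?I F' \<le> 0"
  proof -
    have "\<epsilon> / 2 * (\<omega> k 1 * (v 1)^2) \<ge> 0" "\<epsilon> / 2 * (\<omega> k (-1) * (v (-1))^2) \<ge> 0"
      using eps omega_pos[of k 1] omega_pos[of k "-1"] by (auto intro!: mult_nonneg_nonneg)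
    moreover have "F 1 - F (-1) = - (\<epsilon> / 2 * (\<omega> k 1 * (v 1)^2)) - \<epsilon> / 2 * (\<omega> k (-1) * (v (-1))^2)"
      by (simp add: F_def)
    ultimately have "F 1 - F (-1) \<le> 0" by linarith
    then show ?thesis using \<open>(F' has_integral F 1 - F (-1)) ?I\<close> by (simp add: integral_unique)
  qed
  define Q where "Q = K * (1 / \<theta>) ^ (2 * Suc k)"
  have pw: "3/4 * \<beta> * (\<omega> (Suc k) x * (v x)^2) \<le> - G x + F' x
      + (\<beta> + real k + 1) * Q * (sqrt \<epsilon> / S x)" if x: "x \<in> ?I" for x
  proof -
    let ?w = "(v x)^2"
    have e: "(- (x * a x)) * (\<omega> k x * ?w) = - G x + F' x + \<epsilon> / 2 * (p1 x * ?w)"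
      unfolding G_def F'_def by (simp add: power2_eq_square algebra_simps)
    have l: "(- (x * a x)) * (\<omega> k x * ?w) \<ge> \<beta> * x^2 * (\<omega> k x * ?w)"
      using \<beta>(2)[OF x] omega_pos[of k x] by (intro mult_right_mono mult_nonneg_nonneg) auto
    have l2: "\<beta> * x^2 * (\<omega> k x * ?w) = \<beta> * (\<omega> (Suc k) x * ?w) - \<beta> * (\<epsilon> * \<omega> k x * ?w)"
      by (simp add: omega_Suc algebra_simps)
    have "(2 * real k - 1) * x^2 / S x \<le> 2 * real k"
    proof -
      have "(2 * real k - 1) * x^2 \<le> 2 * real k * x^2" by (intro mult_right_mono) auto
      also have "\<dots> \<le> 2 * real k * S x" using eps by (intro mult_left_mono) auto
      finally show ?thesis using S_pos[of x] by (simp add: pos_divide_le_eq)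
    qed
    then have "p1 x \<le> \<omega> k x * (2 * real k + 1)" unfolding p1_def
      using omega_pos[of k x] by (intro mult_left_mono) auto
    then have "\<epsilon> / 2 * (p1 x * ?w) \<le> \<epsilon> / 2 * ((\<omega> k x * (2 * real k + 1)) * ?w)"
      using eps by (intro mult_left_mono mult_right_mono) auto
    also have "\<dots> \<le> (real k + 1) * (\<epsilon> * \<omega> k x * ?w)"
      using eps omega_pos[of k x] by (simp add: algebra_simps)
    finally have "\<beta> * (\<omega> (Suc k) x * ?w) \<le> - G x + F' x + (\<beta> + real k + 1) * (\<epsilon> * \<omega> k x * ?w)"
      using e l l2 by (simp add: algebra_simps)
    also have "(\<beta> + real k + 1) * (\<epsilon> * \<omega> k x * ?w) \<le> (\<beta> + real k + 1) *
       (\<theta> * \<omega> (Suc k) x * ?w + Q * (sqrt \<epsilon> / S x))"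
      unfolding Q_def using inner_layer_split[OF th(1,2) K zero_le_power2 bv[OF x]] \<beta>(1) by (intro mult_left_mono) auto
    also have "\<dots> = \<beta> / 4 * (\<omega> (Suc k) x * ?w) + (\<beta> + real k + 1) * Q * (sqrt \<epsilon> / S x)"
      unfolding th(3)[symmetric] by (simp add: algebra_simps)
    finally show ?thesis by (simp add: algebra_simps)
  qed
  let ?L = "(\<beta> + real k + 1) * Q"
  have kc: "continuous_on ?I (\<lambda>x. sqrt \<epsilon> / S x)" by (intro continuous_intros) (metis S_pos less_irrefl)
  have "3/4 * \<beta> * integral ?I (\<lambda>x. \<omega> (Suc k) x * (v x)^2) = integral ?I (\<lambda>x. 3/4 * \<beta> * (\<omega> (Suc k) x * (v x)^2))"
    by simp
  also have "\<dots> \<le> integral ?I (\<lambda>x. (- G x + F' x) + ?L * (sqrt \<epsilon> / S x))"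
    by (intro integral_mono_continuous continuous_intros omega_cont vc Gc F'c pw kc) auto
  also have "\<dots> = (- integral ?I G + integral ?I F') + ?L * integral ?I (\<lambda>x. sqrt \<epsilon> / S x)"
    by (simp only: integral_add_continuous[OF continuous_on_add[OF continuous_on_minus[OF Gc] F'c] continuous_on_mult_left[OF kc]]
         integral_add_continuous[OF continuous_on_minus[OF Gc] F'c] integral_neg integral_mult_right)
  also have "\<dots> \<le> - integral ?I G + ?L * 4"
    using iF arctan_kernel_bound \<beta>(1) K th unfolding Q_def by (intro add_mono mult_left_mono mult_nonneg_nonneg) auto
  also have "?L * 4 = Cen k * K" unfolding Q_def th(4) Cen_def by (simp only: mult_ac)
  finally show ?thesis by (simp add: G_def)
qed

end

context tp_sol begin

lemma sqrt_S_div_eps: "1 \<le> sqrt (S x) / \<epsilon>" "1 / \<epsilon> \<le> (sqrt (S x) / \<epsilon>)^2" "(sqrt (S x) / \<epsilon>)^2 = S x / \<epsilon>^2"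
proof -
  have "\<epsilon> \<le> sqrt \<epsilon>" using eps by (simp add: real_le_rsqrt power2_eq_square mult_le_one)
  then have "\<epsilon> \<le> sqrt (S x)" using abs_le_sqrtS(2)[of x] by (rule order.trans)
  then show "1 \<le> sqrt (S x) / \<epsilon>" using eps by (simp add: pos_le_divide_eq)
  show 3: "(sqrt (S x) / \<epsilon>)^2 = S x / \<epsilon>^2" using S_pos[of x] by (simp add: power_divide)
  show "1 / \<epsilon> \<le> (sqrt (S x) / \<epsilon>)^2" unfolding 3 using eps S_ge[of x]
    by (simp add: field_simps power2_eq_square)
qed

text \<open>Each differentiation costs one factor \<open>\<rho> = sqrt (S x) / \<epsilon> \<ge> 1\<close>. This is crude away from the turning
point but of the correct order \<open>\<epsilon>\<^bsup>- n/2\<^esup>\<close> inside the layer, where it will be used. The bounds for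
\<open>u''\<close> and \<open>u'''\<close> are read off from the equation and its derivative.\<close>

lemma derivative_bounds:
  assumes x: "x \<in> {-1..1}"
  shows "\<bar>u1 x\<bar> \<le> K1 * (sqrt (S x) / \<epsilon>)" "\<bar>u2 x\<bar> \<le> K2 * (sqrt (S x) / \<epsilon>)^2"
    "\<bar>u3 x\<bar> \<le> K3 * (sqrt (S x) / \<epsilon>) ^ 3"
proof -
  define \<rho> where "\<rho> = sqrt (S x) / \<epsilon>"
  have r: "1 \<le> \<rho>" "1 / \<epsilon> \<le> \<rho>^2" "\<bar>x\<bar> / \<epsilon> \<le> \<rho>"
    using sqrt_S_div_eps[of x] abs_le_sqrtS(1)[of x] eps unfolding \<rho>_def by (auto intro: divide_right_mono)
  have r3: "1 / \<epsilon> \<le> \<rho> ^ 3" "\<rho> / \<epsilon> \<le> \<rho> ^ 3"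
  proof -
    have "\<rho>^2 \<le> \<rho> ^ 3" using r by (intro power_increasing) auto
    then show "1 / \<epsilon> \<le> \<rho> ^ 3" using r by linarith
    have "\<rho> * (1 / \<epsilon>) \<le> \<rho> * \<rho>^2" using r by (intro mult_left_mono) auto
    then show "\<rho> / \<epsilon> \<le> \<rho> ^ 3" by (simp add: power3_eq_cube power2_eq_square)
  qed
  have K: "K1 > 0" "K2 > 0" using B1 Msup_pos by (auto simp: K1_def K2_def intro!: add_pos_pos mult_pos_pos)
  have 1: "\<bar>u1 x\<bar> \<le> K1 * \<rho>"
    using u1_bound[OF x] eps by (simp add: \<rho>_def K1_def pos_le_divide_eq mult.commute)
  then show "\<bar>u1 x\<bar> \<le> K1 * (sqrt (S x) / \<epsilon>)" by (simp add: \<rho>_def)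
  have cu: "\<bar>c x * u x\<bar> \<le> B * Msup" "\<bar>c1 x * u x\<bar> \<le> B * Msup"
    by (intro abs_mult_le bd u_bound x)+
  have au: "\<bar>a1 x * u1 x\<bar> \<le> B * (K1 * \<rho>)" "\<bar>c x * u1 x\<bar> \<le> B * (K1 * \<rho>)"
    by (intro abs_mult_le bd 1 x)+
  have a1: "\<bar>a x * u1 x\<bar> \<le> (B * \<bar>x\<bar>) * (K1 * \<rho>)"
    by (intro abs_mult_le bd 1 x)+
  have "\<bar>\<epsilon> * u2 x\<bar> \<le> (B * \<bar>x\<bar>) * (K1 * \<rho>) + B * (Msup + 1)"
    using eq0[OF x] a1 cu bd(7)[OF x] unfolding distrib_left mult_1_right by linarith
  then have "\<bar>u2 x\<bar> \<le> ((B * \<bar>x\<bar>) * (K1 * \<rho>) + B * (Msup + 1)) / \<epsilon>"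
    using eps by (simp add: abs_mult pos_le_divide_eq mult.commute)
  also have "\<dots> = B * K1 * \<rho> * (\<bar>x\<bar> / \<epsilon>) + B * (Msup + 1) * (1 / \<epsilon>)"
    by (simp add: add_divide_distrib)
  also have "\<dots> \<le> B * K1 * \<rho> * \<rho> + B * (Msup + 1) * \<rho>^2"
    using r K B1 Msup_pos by (intro add_mono mult_left_mono) auto
  also have "\<dots> = K2 * \<rho>^2" by (simp add: K2_def power2_eq_square algebra_simps)
  finally have 2: "\<bar>u2 x\<bar> \<le> K2 * \<rho>^2" .
  then show "\<bar>u2 x\<bar> \<le> K2 * (sqrt (S x) / \<epsilon>)^2" by (simp add: \<rho>_def)
  have a2: "\<bar>a x * u2 x\<bar> \<le> (B * \<bar>x\<bar>) * (K2 * \<rho>^2)"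
    by (intro abs_mult_le bd 2 x)
  have "\<bar>\<epsilon> * u3 x\<bar> \<le> 2 * (B * (K1 * \<rho>)) + (B * \<bar>x\<bar>) * (K2 * \<rho>^2) + B * (Msup + 1)"
    using eq1[OF x] a2 au cu bd(8)[OF x] unfolding distrib_left mult_1_right by linarith
  then have "\<bar>u3 x\<bar> \<le> (2 * (B * (K1 * \<rho>)) + (B * \<bar>x\<bar>) * (K2 * \<rho>^2) + B * (Msup + 1)) / \<epsilon>"
    using eps by (simp add: abs_mult pos_le_divide_eq mult.commute)
  also have "\<dots> = 2 * B * K1 * (\<rho> / \<epsilon>) + B * K2 * \<rho>^2 * (\<bar>x\<bar> / \<epsilon>) + B * (Msup + 1) * (1 / \<epsilon>)"
    using eps by (simp add: field_simps)
  also have "\<dots> \<le> 2 * B * K1 * \<rho> ^ 3 + B * K2 * \<rho>^2 * \<rho> + B * (Msup + 1) * \<rho> ^ 3"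
    using r r3 K B1 Msup_pos by (intro add_mono mult_left_mono) auto
  also have "\<dots> = K3 * \<rho> ^ 3" by (simp add: K3_def power2_eq_square power3_eq_cube algebra_simps)
  finally show "\<bar>u3 x\<bar> \<le> K3 * (sqrt (S x) / \<epsilon>) ^ 3" by (simp add: \<rho>_def)
qed

lemma derivative_sq_bounds:
  assumes x: "x \<in> {-1..1}"
  shows "(u1 x)^2 \<le> K1^2 * (S x / \<epsilon>^2) ^ Suc 0" "(u2 x)^2 \<le> K2^2 * (S x / \<epsilon>^2) ^ Suc 1"
    "(u3 x)^2 \<le> K3^2 * (S x / \<epsilon>^2) ^ Suc 2"
proof -
  have *: "w^2 \<le> K^2 * (S x / \<epsilon>^2) ^ n" if "\<bar>w\<bar> \<le> K * (sqrt (S x) / \<epsilon>) ^ n" for w K n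
  proof -
    have "w^2 \<le> (K * (sqrt (S x) / \<epsilon>) ^ n)^2" using that by (metis abs_ge_zero power2_abs power_mono)
    also have "\<dots> = K^2 * ((sqrt (S x) / \<epsilon>)^2) ^ n" by (simp only: power_mult_distrib power_mult[symmetric] mult.commute[of n 2])
    finally show ?thesis by (simp only: sqrt_S_div_eps(3))
  qed
  show "(u1 x)^2 \<le> K1^2 * (S x / \<epsilon>^2) ^ Suc 0" using *[of "u1 x" K1 1] derivative_bounds(1)[OF x] by simp
  show "(u2 x)^2 \<le> K2^2 * (S x / \<epsilon>^2) ^ Suc 1" using *[of "u2 x" K2 2] derivative_bounds(2)[OF x] by (simp add: numeral_2_eq_2)
  show "(u3 x)^2 \<le> K3^2 * (S x / \<epsilon>^2) ^ Suc 2" using *[OF derivative_bounds(3)[OF x]] by (simp add: numeral_3_eq_3 numeral_2_eq_2)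
qed

lemma S_le_2: "x \<in> {-1..1} \<Longrightarrow> S x \<le> 2"
  using eps abs_square_le_1[of x] by (simp add: abs_le_iff)

lemma omega_le:
  assumes x: "x \<in> {-1..1}" shows "\<omega> 1 x \<le> 2" "\<omega> 2 x \<le> 4" "\<omega> 2 x \<le> 2 * \<omega> 1 x"
proof -
  have "\<omega> 1 x = sqrt (S x)" using S_pos[of x] by (simp add: \<omega>_def real_div_sqrt)
  also have "\<dots> \<le> sqrt 4" using S_le_2[OF x] by (intro real_sqrt_le_mono) auto
  finally show 1: "\<omega> 1 x \<le> 2" by simp
  have "\<omega> 2 x = S x * \<omega> 1 x" using omega_Suc[of 1 x] by (simp add: numeral_2_eq_2)
  then show "\<omega> 2 x \<le> 2 * \<omega> 1 x" using S_le_2[OF x] omega_pos[of 1 x] by simp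
  then show "\<omega> 2 x \<le> 4" using 1 by linarith
qed

text \<open>For \<open>v = u'\<close> the right-hand side \<open>c u - f\<close> involves no derivative, and the test function contains
\<open>u'\<close>, so one integration by parts moves the derivative onto data and weight. The boundary terms
vanish with \<open>u\<close>, and the derivative \<open>p1\<close> of the bounded increasing function \<open>p = x \<omega>\<^sub>0\<close> is
nonnegative with integral at most \<open>2\<close>.\<close>

lemma energy_first: "integral {-1..1} (\<lambda>x. \<omega> 1 x * (u1 x)^2) \<le> E1"
proof -
  let ?I = "{-1..1::real}"
  define p where "p = (\<lambda>x. x * \<omega> 0 x)"
  define p1 where "p1 = (\<lambda>x. \<omega> 0 x * (\<epsilon> / S x))"
  define L where "L = B * Msup + B * Msup^2"
  define F where "F = (\<lambda>x. p x * (f x * u x - c x * (u x)^2 / 2))"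
  define F' where "F' = (\<lambda>x. p1 x * (f x * u x - c x * (u x)^2 / 2) +
      (f1 x * u x + u1 x * f x - (c1 x * (u x)^2 + (2 * u x * u1 x) * c x) / 2) * p x)"
  have p1: "(p has_real_derivative p1 x) (at x within ?I)" for x
  proof -
    have "((\<lambda>x. x * \<omega> 0 x) has_real_derivative 1 * \<omega> 0 x + \<omega> 0 x * ((2 * real 0 - 1) * x / S x) * x) (at x within ?I)"
      by (intro DERIV_mult DERIV_ident omega_deriv)
    moreover have "1 * \<omega> 0 x + \<omega> 0 x * ((2 * real 0 - 1) * x / S x) * x = \<omega> 0 x * ((S x - x^2) / S x)"
      using S_pos[of x] by (simp add: diff_divide_distrib power2_eq_square) (simp add: field_simps)
    ultimately show ?thesis by (simp add: p_def p1_def)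
  qed
  have p1c: "continuous_on ?I p1" unfolding p1_def
    by (intro continuous_intros omega_cont) (metis S_pos less_irrefl)
  have pc: "continuous_on ?I p" using DERIV_continuous_on[OF p1] by blast
  have p1n: "p1 x \<ge> 0" for x using omega_pos[of 0 x] S_pos[of x] eps by (simp add: p1_def)
  have pb: "\<bar>p x\<bar> \<le> 1" for x
    using abs_le_sqrtS(1)[of x] S_pos[of x] by (simp add: p_def \<omega>_def abs_mult)
  have dF: "(F has_real_derivative F' x) (at x within ?I)" if x: "x \<in> ?I" for x
  proof -
    have "((\<lambda>x. (u x)^2) has_real_derivative 2 * u x * u1 x) (at x within ?I)"
      by (rule derivative_eq_intros du[OF x] refl | simp)+
    then show ?thesis unfolding F_def F'_def
      by (intro DERIV_mult DERIV_diff DERIV_cdivide p1 df[OF x] dc[OF x] du[OF x])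
  qed
  have F'c: "continuous_on ?I F'" unfolding F'_def by (intro continuous_intros conts pc p1c) auto
  have "(F' has_integral F 1 - F (-1)) ?I" by (rule ftc_has_integral) (auto intro: dF)
  then have iF: "integral ?I F' = 0" by (simp add: F_def bc integral_unique)
  have "(p1 has_integral p 1 - p (-1)) ?I" by (rule ftc_has_integral) (auto intro: p1)
  then have ip: "integral ?I p1 \<le> 2" using pb[of 1] pb[of "-1"] by (simp add: integral_unique)
  have L: "L \<ge> 0" using B1 Msup_pos by (simp add: L_def)
  have pw: "- (x * \<omega> 0 x * u1 x * (a x * u1 x - \<epsilon> * u2 x)) \<le> - F' x + (p1 x * L + L)" if x: "x \<in> ?I" for x
  proof -
    have "a x * u1 x - \<epsilon> * u2 x = f x - c x * u x" using eq0[OF x] by simp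
    then have e: "- (x * \<omega> 0 x * u1 x * (a x * u1 x - \<epsilon> * u2 x)) = - F' x + p1 x * (f x * u x - c x * (u x)^2 / 2)
       + p x * (f1 x * u x - c1 x * (u x)^2 / 2)"
      by (simp add: F'_def p_def) (simp add: algebra_simps power2_eq_square)
    have u2: "(u x)^2 \<le> Msup^2" using u_bound[OF x] by (metis abs_ge_zero power2_abs power_mono)
    then have u2': "\<bar>(u x)^2\<bar> \<le> Msup^2" by simp
    have "\<bar>f x * u x\<bar> \<le> B * Msup" "\<bar>f1 x * u x\<bar> \<le> B * Msup" "\<bar>c x * (u x)^2\<bar> \<le> B * Msup^2" "\<bar>c1 x * (u x)^2\<bar> \<le> B * Msup^2"
      by (intro abs_mult_le bd u_bound u2' x)+
    then have "\<bar>f x * u x - c x * (u x)^2 / 2\<bar> \<le> L" "\<bar>f1 x * u x - c1 x * (u x)^2 / 2\<bar> \<le> L"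
      unfolding L_def by linarith+
    then have "p1 x * (f x * u x - c x * (u x)^2 / 2) \<le> p1 x * L"
      "\<bar>p x * (f1 x * u x - c1 x * (u x)^2 / 2)\<bar> \<le> 1 * L"
      unfolding abs_mult using p1n[of x] pb[of x] by (intro mult_left_mono mult_mono; simp)+
    then show ?thesis using e by linarith
  qed
  have "- integral ?I (\<lambda>x. x * \<omega> 0 x * u1 x * (a x * u1 x - \<epsilon> * u2 x))
     = integral ?I (\<lambda>x. - (x * \<omega> 0 x * u1 x * (a x * u1 x - \<epsilon> * u2 x)))" by (simp only: integral_neg)
  also have "\<dots> \<le> integral ?I (\<lambda>x. - F' x + (p1 x * L + L))"
    by (intro integral_mono_continuous continuous_intros conts F'c omega_cont p1c pw) auto
  also have "\<dots> = - integral ?I F' + (integral ?I p1 * L + 2 * L)"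
    by (simp only: integral_add_continuous[OF continuous_on_minus[OF F'c] continuous_on_add[OF continuous_on_mult_right[OF p1c] continuous_on_const]]
      integral_add_continuous[OF continuous_on_mult_right[OF p1c] continuous_on_const] integral_neg integral_mult_left) simp
  also have "\<dots> \<le> 4 * L" using iF mult_right_mono[OF ip L] by simp
  finally have *: "- integral ?I (\<lambda>x. x * \<omega> 0 x * u1 x * (a x * u1 x - \<epsilon> * u2 x)) \<le> 4 * L" .
  have "3/4 * \<beta> * integral ?I (\<lambda>x. \<omega> (Suc 0) x * (u1 x)^2)
    \<le> - integral ?I (\<lambda>x. x * \<omega> 0 x * u1 x * (a x * u1 x - \<epsilon> * u2 x)) + Cen 0 * K1^2"
    by (rule energy_core[OF du1 conts(9) zero_le_power2 derivative_sq_bounds(1)])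
  then have "3/4 * \<beta> * integral ?I (\<lambda>x. \<omega> 1 x * (u1 x)^2) \<le> 4 * L + Cen 0 * K1^2" using * by simp
  then show ?thesis using \<beta>(1) by (simp add: E1_def L_def field_simps)
qed

text \<open>For \<open>k \<ge> 1\<close> the right-hand side of \<open>energy_core\<close> is absorbed by Young's inequality, which uses
\<open>x\<^sup>2 \<omega>\<^sub>k \<le> \<omega>\<^bsub>k+1\<^esub>\<close>. The remaining weight on the source is lower by one index, precisely the weight in
which the preceding derivative has already been bounded.\<close>

lemma energy_young:
  assumes dv: "\<And>x. x \<in> {-1..1} \<Longrightarrow> (v has_real_derivative v' x) (at x within {-1..1})"
    and cv': "continuous_on {-1..1} v'" and K: "K \<ge> 0"
    and bv: "\<And>x. x \<in> {-1..1} \<Longrightarrow> (v x)^2 \<le> K * (S x / \<epsilon>^2) ^ Suc k"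
    and cg: "continuous_on {-1..1} g" and g: "\<And>x. x \<in> {-1..1} \<Longrightarrow> (a x * v x - \<epsilon> * v' x)^2 \<le> g x"
  shows "integral {-1..1} (\<lambda>x. \<omega> (Suc k) x * (v x)^2) \<le> 2 / \<beta> * (1 / \<beta> * integral {-1..1} (\<lambda>x. \<omega> k x * g x) + Cen k * K)"
proof -
  let ?I = "{-1..1::real}"
  have vc: "continuous_on ?I v" using DERIV_continuous_on[OF dv] by blast
  have pw: "- (x * \<omega> k x * v x * (a x * v x - \<epsilon> * v' x)) \<le> \<beta> / 4 * (\<omega> (Suc k) x * (v x)^2) + 1 / \<beta> * (\<omega> k x * g x)"
    if x: "x \<in> ?I" for x
  proof -
    define h where "h = a x * v x - \<epsilon> * v' x"
    have "0 \<le> (\<beta> * x * v x / 2 + h)^2 / \<beta>" using \<beta>(1) by simp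
    also have "\<dots> = \<beta> / 4 * (x^2 * (v x)^2) + x * v x * h + 1 / \<beta> * h^2"
      using \<beta>(1) by (simp add: power2_eq_square field_simps)
    also have "\<dots> \<le> \<beta> / 4 * (S x * (v x)^2) + x * v x * h + 1 / \<beta> * g x"
    proof -
      have "\<beta> / 4 * (x^2 * (v x)^2) \<le> \<beta> / 4 * (S x * (v x)^2)" "1 / \<beta> * h^2 \<le> 1 / \<beta> * g x"
        using \<beta>(1) g[OF x] eps unfolding h_def by (intro mult_left_mono mult_right_mono; simp)+
      then show ?thesis by linarith
    qed
    finally have "0 \<le> \<omega> k x * (\<beta> / 4 * (S x * (v x)^2) + x * v x * h + 1 / \<beta> * g x)"
      using omega_pos[of k x] by simp
    then show ?thesis unfolding omega_Suc h_def by (simp add: algebra_simps)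
  qed
  have c1: "continuous_on ?I (\<lambda>x. \<omega> (Suc k) x * (v x)^2)" "continuous_on ?I (\<lambda>x. \<omega> k x * g x)"
    by (intro continuous_intros omega_cont vc cg)+
  have "- integral ?I (\<lambda>x. x * \<omega> k x * v x * (a x * v x - \<epsilon> * v' x))
     = integral ?I (\<lambda>x. - (x * \<omega> k x * v x * (a x * v x - \<epsilon> * v' x)))" by (simp only: integral_neg)
  also have "\<dots> \<le> integral ?I (\<lambda>x. \<beta> / 4 * (\<omega> (Suc k) x * (v x)^2) + 1 / \<beta> * (\<omega> k x * g x))"
    by (intro integral_mono_continuous continuous_intros conts omega_cont vc cv' cg pw) auto
  also have "\<dots> = \<beta> / 4 * integral ?I (\<lambda>x. \<omega> (Suc k) x * (v x)^2) + 1 / \<beta> * integral ?I (\<lambda>x. \<omega> k x * g x)"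
    by (simp only: integral_add_continuous[OF continuous_on_mult_left[OF c1(1)] continuous_on_mult_left[OF c1(2)]] integral_mult_right)
  finally have "\<beta> / 2 * integral ?I (\<lambda>x. \<omega> (Suc k) x * (v x)^2) \<le> 1 / \<beta> * integral ?I (\<lambda>x. \<omega> k x * g x) + Cen k * K"
    using energy_core[OF dv cv' K bv] by (simp add: algebra_simps)
  then have "2 / \<beta> * (\<beta> / 2 * integral ?I (\<lambda>x. \<omega> (Suc k) x * (v x)^2)) \<le> 2 / \<beta> * (1 / \<beta> * integral ?I (\<lambda>x. \<omega> k x * g x) + Cen k * K)"
    using \<beta>(1) by (intro mult_left_mono) auto
  moreover have "2 / \<beta> * (\<beta> / 2 * integral ?I (\<lambda>x. \<omega> (Suc k) x * (v x)^2)) = integral ?I (\<lambda>x. \<omega> (Suc k) x * (v x)^2)"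
    using \<beta>(1) by simp
  ultimately show ?thesis by linarith
qed

text \<open>Differentiating the equation shows that \<open>a u'' - \<epsilon> u'''\<close> contains only \<open>u\<close> and \<open>u'\<close>.\<close>

lemma energy_second: "integral {-1..1} (\<lambda>x. \<omega> 2 x * (u2 x)^2) \<le> E2"
proof -
  let ?I = "{-1..1::real}"
  define g where "g = (\<lambda>x. 2 * B^2 * (1 + Msup)^2 + 8 * B^2 * (u1 x)^2)"
  have gc: "continuous_on ?I g" unfolding g_def by (intro continuous_intros conts)
  have g: "(a x * u2 x - \<epsilon> * u3 x)^2 \<le> g x" if x: "x \<in> ?I" for x
  proof -
    have "\<bar>c1 x * u x\<bar> \<le> B * Msup" "\<bar>a1 x * u1 x\<bar> \<le> B * \<bar>u1 x\<bar>" "\<bar>c x * u1 x\<bar> \<le> B * \<bar>u1 x\<bar>"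
      by (intro abs_mult_le bd u_bound x order_refl)+
    then have "\<bar>a x * u2 x - \<epsilon> * u3 x\<bar> \<le> B * (1 + Msup) + 2 * B * \<bar>u1 x\<bar>"
      using eq1[OF x] bd(8)[OF x] unfolding distrib_left mult_1_right mult.assoc by linarith
    then have "(a x * u2 x - \<epsilon> * u3 x)^2 \<le> (B * (1 + Msup) + 2 * B * \<bar>u1 x\<bar>)^2" by (rule square_of_bound)
    also have "\<dots> \<le> 2 * (B * (1 + Msup))^2 + 2 * (2 * B * \<bar>u1 x\<bar>)^2"
      using sum_squares_ge_zero zero_le_power2[of "B * (1 + Msup) - 2 * B * \<bar>u1 x\<bar>"]
      by (simp add: power2_sum power2_diff)
    finally show ?thesis by (simp add: g_def power_mult_distrib)
  qed
  have c1: "continuous_on ?I (\<lambda>x. \<omega> 1 x * (u1 x)^2)" by (intro continuous_intros conts omega_cont)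
  have "integral ?I (\<lambda>x. \<omega> 1 x * g x) \<le> integral ?I (\<lambda>x. 4 * B^2 * (1 + Msup)^2 + 8 * B^2 * (\<omega> 1 x * (u1 x)^2))"
  proof (intro integral_mono_continuous continuous_intros conts omega_cont gc)
    fix x :: real assume x: "x \<in> ?I"
    have "\<omega> 1 x * (2 * B^2 * (1 + Msup)^2) \<le> 2 * (2 * B^2 * (1 + Msup)^2)"
      using omega_le[OF x] by (intro mult_right_mono) auto
    then show "\<omega> 1 x * g x \<le> 4 * B^2 * (1 + Msup)^2 + 8 * B^2 * (\<omega> 1 x * (u1 x)^2)"
      by (simp add: g_def algebra_simps)
  qed
  also have "\<dots> = 8 * B^2 * (1 + Msup)^2 + 8 * B^2 * integral ?I (\<lambda>x. \<omega> 1 x * (u1 x)^2)"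
    by (simp only: integral_add_continuous[OF continuous_on_const continuous_on_mult_left[OF c1]] integral_mult_right) simp
  also have "\<dots> \<le> 8 * B^2 * (1 + Msup)^2 + 8 * B^2 * E1"
    using energy_first by (intro add_mono mult_left_mono) auto
  finally have "1 / \<beta> * integral ?I (\<lambda>x. \<omega> 1 x * g x) + Cen 1 * K2^2
     \<le> 1 / \<beta> * (8 * B^2 * (1 + Msup)^2 + 8 * B^2 * E1) + Cen 1 * K2^2"
    using \<beta>(1) by (intro add_right_mono mult_left_mono) auto
  then have "2 / \<beta> * (1 / \<beta> * integral ?I (\<lambda>x. \<omega> 1 x * g x) + Cen 1 * K2^2) \<le> E2"
    unfolding E2_def using \<beta>(1) by (intro mult_left_mono) auto
  then show ?thesis using energy_young[OF du2 conts(10) zero_le_power2 derivative_sq_bounds(2) gc g]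
    by (simp add: numeral_2_eq_2)
qed

text \<open>Differentiating once more leaves \<open>u\<close>, \<open>u'\<close> and \<open>u''\<close> on the right-hand side.\<close>

lemma energy_third: "integral {-1..1} (\<lambda>x. \<omega> 3 x * (u3 x)^2) \<le> E3"
proof -
  let ?I = "{-1..1::real}"
  define g where "g = (\<lambda>x. 3 * B^2 * (1 + Msup)^2 + 27 * B^2 * (u1 x)^2 + 27 * B^2 * (u2 x)^2)"
  have gc: "continuous_on ?I g" unfolding g_def by (intro continuous_intros conts)
  have g: "(a x * u3 x - \<epsilon> * u4 x)^2 \<le> g x" if x: "x \<in> ?I" for x
  proof -
    define w1 w2 where w: "w1 = \<bar>u1 x\<bar>" "w2 = \<bar>u2 x\<bar>"
    have "\<bar>c2 x * u x\<bar> \<le> B * Msup" "\<bar>a2 x * u1 x\<bar> \<le> B * w1" "\<bar>c1 x * u1 x\<bar> \<le> B * w1"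
      "\<bar>a1 x * u2 x\<bar> \<le> B * w2" "\<bar>c x * u2 x\<bar> \<le> B * w2" "\<bar>f2 x\<bar> \<le> B"
      unfolding w by (intro abs_mult_le bd u_bound x order_refl)+
    moreover have "a x * u3 x - \<epsilon> * u4 x = f2 x - a2 x * u1 x - 2 * (a1 x * u2 x)
          - c2 x * u x - 2 * (c1 x * u1 x) - c x * u2 x" using eq2[OF x] by simp
    ultimately have "\<bar>a x * u3 x - \<epsilon> * u4 x\<bar> \<le> B + B * Msup + 3 * (B * w1) + 3 * (B * w2)"
      unfolding abs_le_iff by linarith
    then have "\<bar>a x * u3 x - \<epsilon> * u4 x\<bar> \<le> B * (1 + Msup) + 3 * B * \<bar>u1 x\<bar> + 3 * B * \<bar>u2 x\<bar>"
      by (simp add: w distrib_left mult.assoc)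
    then have "(a x * u3 x - \<epsilon> * u4 x)^2 \<le> (B * (1 + Msup) + 3 * B * \<bar>u1 x\<bar> + 3 * B * \<bar>u2 x\<bar>)^2" by (rule square_of_bound)
    also have "\<dots> \<le> 3 * (B * (1 + Msup))^2 + 3 * (3 * B * \<bar>u1 x\<bar>)^2 + 3 * (3 * B * \<bar>u2 x\<bar>)^2"
    proof -
      have "(p + q + r)^2 \<le> 3 * p^2 + 3 * q^2 + 3 * r^2" for p q r :: real
        using zero_le_power2[of "p - q"] zero_le_power2[of "p - r"] zero_le_power2[of "q - r"]
        by (simp add: power2_eq_square algebra_simps)
      then show ?thesis by blast
    qed
    finally show ?thesis by (simp add: g_def power_mult_distrib)
  qed
  have c1: "continuous_on ?I (\<lambda>x. \<omega> 1 x * (u1 x)^2)" "continuous_on ?I (\<lambda>x. \<omega> 2 x * (u2 x)^2)"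
    by (intro continuous_intros conts omega_cont)+
  have "integral ?I (\<lambda>x. \<omega> 2 x * g x) \<le> integral ?I (\<lambda>x. 12 * B^2 * (1 + Msup)^2 + (54 * B^2 * (\<omega> 1 x * (u1 x)^2)
     + 27 * B^2 * (\<omega> 2 x * (u2 x)^2)))"
  proof (intro integral_mono_continuous continuous_intros conts omega_cont gc)
    fix x :: real assume x: "x \<in> ?I"
    have "\<omega> 2 x * (3 * B^2 * (1 + Msup)^2) \<le> 4 * (3 * B^2 * (1 + Msup)^2)"
      "\<omega> 2 x * (27 * B^2 * (u1 x)^2) \<le> (2 * \<omega> 1 x) * (27 * B^2 * (u1 x)^2)"
      using omega_le[OF x] by (intro mult_right_mono; simp)+
    then show "\<omega> 2 x * g x \<le> 12 * B^2 * (1 + Msup)^2 + (54 * B^2 * (\<omega> 1 x * (u1 x)^2) + 27 * B^2 * (\<omega> 2 x * (u2 x)^2))"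
      by (simp add: g_def algebra_simps)
  qed
  also have "\<dots> = 24 * B^2 * (1 + Msup)^2 + (54 * B^2 * integral ?I (\<lambda>x. \<omega> 1 x * (u1 x)^2)
     + 27 * B^2 * integral ?I (\<lambda>x. \<omega> 2 x * (u2 x)^2))"
    by (simp only: integral_add_continuous[OF continuous_on_const continuous_on_add[OF continuous_on_mult_left[OF c1(1)] continuous_on_mult_left[OF c1(2)]]]
       integral_add_continuous[OF continuous_on_mult_left[OF c1(1)] continuous_on_mult_left[OF c1(2)]] integral_mult_right) simp
  also have "\<dots> \<le> 24 * B^2 * (1 + Msup)^2 + (54 * B^2 * E1 + 27 * B^2 * E2)"
    using energy_first energy_second by (intro add_mono mult_left_mono) auto
  finally have "1 / \<beta> * integral ?I (\<lambda>x. \<omega> 2 x * g x) + Cen 2 * K3^2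
     \<le> 1 / \<beta> * (24 * B^2 * (1 + Msup)^2 + 54 * B^2 * E1 + 27 * B^2 * E2) + Cen 2 * K3^2"
    using \<beta>(1) by (intro add_right_mono mult_left_mono) auto
  then have "2 / \<beta> * (1 / \<beta> * integral ?I (\<lambda>x. \<omega> 2 x * g x) + Cen 2 * K3^2) \<le> E3"
    unfolding E3_def using \<beta>(1) by (intro mult_left_mono) auto
  then show ?thesis using energy_young[OF du3 cu4 zero_le_power2 derivative_sq_bounds(3) gc g]
    by (simp add: numeral_3_eq_3 numeral_2_eq_2)
qed

lemma weight_le_omega: "(sqrt \<epsilon> + \<bar>x\<bar>) ^ (2 * k + 1) \<le> 2 ^ (2 * k + 1) * \<omega> (Suc k) x"
proof -
  have "(sqrt \<epsilon> + \<bar>x\<bar>) ^ (2 * k + 1) \<le> (2 * sqrt (S x)) ^ (2 * k + 1)"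
  proof (intro power_mono)
    show "sqrt \<epsilon> + \<bar>x\<bar> \<le> 2 * sqrt (S x)" using abs_le_sqrtS(1)[of x] abs_le_sqrtS(2)[of x] by linarith
  qed (use eps in auto)
  also have "\<dots> = 2 ^ (2 * k + 1) * (sqrt (S x) ^ (2 * k) * sqrt (S x))" by (simp add: power_mult_distrib)
  also have "sqrt (S x) ^ (2 * k) * sqrt (S x) = \<omega> (Suc k) x"
    using S_pos[of x] by (simp add: \<omega>_def power_mult real_div_sqrt mult.commute[of "S x"] flip: times_divide_eq_right)
  finally show ?thesis .
qed

lemma weighted_integrals:
  "integral {-1..1} (\<lambda>x. (sqrt \<epsilon> + \<bar>x\<bar>) * (u1 x)^2) \<le> 2 * E1"
  "integral {-1..1} (\<lambda>x. (sqrt \<epsilon> + \<bar>x\<bar>) ^ 3 * (u2 x)^2) \<le> 8 * E2"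
  "integral {-1..1} (\<lambda>x. (sqrt \<epsilon> + \<bar>x\<bar>) ^ 5 * (u3 x)^2) \<le> 32 * E3"
proof -
  have *: "integral {-1..1} (\<lambda>x. (sqrt \<epsilon> + \<bar>x\<bar>) ^ (2 * k + 1) * (w x)^2)
    \<le> 2 ^ (2 * k + 1) * integral {-1..1} (\<lambda>x. \<omega> (Suc k) x * (w x)^2)"
    if w: "continuous_on {-1..1} w" for k w
  proof -
    have "integral {-1..1} (\<lambda>x. (sqrt \<epsilon> + \<bar>x\<bar>) ^ (2 * k + 1) * (w x)^2)
      \<le> integral {-1..1} (\<lambda>x. 2 ^ (2 * k + 1) * (\<omega> (Suc k) x * (w x)^2))"
    proof (intro integral_mono_continuous continuous_intros w omega_cont)
      fix x show "(sqrt \<epsilon> + \<bar>x\<bar>) ^ (2 * k + 1) * (w x)^2 \<le> 2 ^ (2 * k + 1) * (\<omega> (Suc k) x * (w x)^2)"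
        using mult_right_mono[OF weight_le_omega[of x k] zero_le_power2[of "w x"]] by (simp only: mult.assoc)
    qed
    then show ?thesis by (simp only: integral_mult_right)
  qed
  have e: "2 * 1 + 1 = (3::nat)" "2 * 2 + 1 = (5::nat)" "Suc 1 = 2" "Suc 2 = 3" by simp_all
  show "integral {-1..1} (\<lambda>x. (sqrt \<epsilon> + \<bar>x\<bar>) * (u1 x)^2) \<le> 2 * E1"
    using *[OF conts(8), of 0] energy_first by simp
  show "integral {-1..1} (\<lambda>x. (sqrt \<epsilon> + \<bar>x\<bar>) ^ 3 * (u2 x)^2) \<le> 8 * E2"
    using *[OF conts(9), of 1, unfolded e] energy_second by simp
  show "integral {-1..1} (\<lambda>x. (sqrt \<epsilon> + \<bar>x\<bar>) ^ 5 * (u3 x)^2) \<le> 32 * E3"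
    using *[OF conts(10), of 2, unfolded e] energy_third by simp
qed

end

section \<open>The estimates in uniform form\<close>

text \<open>What the error analysis uses about the solution, with one constant \<open>M\<close>: the equation, the bound
of \<open>u\<close>, and three integrals in which each derivative is compensated by one power of the layer
distance \<open>sqrt \<epsilon> + \<bar>x\<bar>\<close>, up to the common factor \<open>(sqrt \<epsilon> + \<bar>x\<bar>)\<^bsup>-1/2\<^esup>\<close>.\<close>

definition layer_solution ::
  "real \<Rightarrow> real \<Rightarrow> (real \<Rightarrow> real) \<Rightarrow> (real \<Rightarrow> real) \<Rightarrow> (real \<Rightarrow> real) \<Rightarrow>
   (real \<Rightarrow> real) \<Rightarrow> (real \<Rightarrow> real) \<Rightarrow> (real \<Rightarrow> real) \<Rightarrow> (real \<Rightarrow> real) \<Rightarrow> bool" where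
  "layer_solution \<epsilon> M a c f u u1 u2 u3 \<longleftrightarrow>
     u (-1) = 0 \<and> u 1 = 0 \<and>
     (\<forall>x\<in>{-1..1}. (u has_real_derivative u1 x) (at x within {-1..1}) \<and>
        (u1 has_real_derivative u2 x) (at x within {-1..1}) \<and>
        (u2 has_real_derivative u3 x) (at x within {-1..1}) \<and>
        \<epsilon> * u2 x = a x * u1 x + c x * u x - f x \<and> \<bar>u x\<bar> \<le> M) \<and>
     continuous_on {-1..1} u3 \<and>
     integral {-1..1} (\<lambda>x. (sqrt \<epsilon> + \<bar>x\<bar>) * (u1 x)^2) \<le> M \<and>
     integral {-1..1} (\<lambda>x. (sqrt \<epsilon> + \<bar>x\<bar>) ^ 3 * (u2 x)^2) \<le> M \<and>
     integral {-1..1} (\<lambda>x. (sqrt \<epsilon> + \<bar>x\<bar>) ^ 5 * (u3 x)^2) \<le> M"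

lemma continuous_on_Icc_bounded:
  fixes g :: "real \<Rightarrow> real"
  assumes "continuous_on {p..q} g"
  shows "\<exists>K. \<forall>x\<in>{p..q}. \<bar>g x\<bar> \<le> K"
proof -
  have "bounded (g ` {p..q})" using assms compact_continuous_image compact_imp_bounded by blast
  then show ?thesis unfolding bounded_iff by auto
qed

lemma continuous_on_Icc_pos_lower_bound:
  fixes g :: "real \<Rightarrow> real"
  assumes "continuous_on {p..q} g" "p \<le> q" "\<And>x. x \<in> {p..q} \<Longrightarrow> g x > 0"
  shows "\<exists>m>0. \<forall>x\<in>{p..q}. m \<le> g x"
proof -
  obtain y where "y \<in> {p..q}" "\<And>x. x \<in> {p..q} \<Longrightarrow> g y \<le> g x"
    using continuous_attains_inf[OF _ _ assms(1)] assms(2) by auto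
  then show ?thesis using assms(3) by blast
qed

lemma Ck_on_2D:
  assumes "Ck_on 2 {-1..1} g"
  obtains g1 g2 where "\<And>x. x \<in> {-1..1} \<Longrightarrow> (g has_real_derivative g1 x) (at x within {-1..1})"
    "\<And>x. x \<in> {-1..1} \<Longrightarrow> (g1 has_real_derivative g2 x) (at x within {-1..1})"
    "continuous_on {-1..1} g2"
proof -
  obtain D :: "nat \<Rightarrow> real \<Rightarrow> real" where D: "D 0 = g"
      "\<And>j x. j < 2 \<Longrightarrow> x \<in> {-1..1} \<Longrightarrow> (D j has_real_derivative D (Suc j) x) (at x within {-1..1})"
      "\<And>j. j \<le> 2 \<Longrightarrow> continuous_on {-1..1} (D j)"
    using assms unfolding Ck_on_def by blast
  show ?thesis
    by (rule that[of "D 1" "D 2"])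
       (use D(2)[of 0] D(2)[of 1] D(3)[of 2] D(1) in \<open>simp_all add: numeral_2_eq_2\<close>)
qed

definition convection_data ::
  "(real \<Rightarrow> real) \<Rightarrow> (real \<Rightarrow> real) \<Rightarrow> (real \<Rightarrow> real) \<Rightarrow> (real \<Rightarrow> real) \<Rightarrow> real \<Rightarrow> real \<Rightarrow> bool" where
  "convection_data a a1 c f B \<gamma> \<longleftrightarrow> B > 0 \<and> \<gamma> > 0 \<and>
     (\<forall>x\<in>{-1..1}. (a has_real_derivative a1 x) (at x within {-1..1}) \<and> \<bar>a x\<bar> \<le> B * \<bar>x\<bar> \<and>
        \<bar>a1 x\<bar> \<le> B \<and> \<bar>c x\<bar> \<le> B \<and> c x - a1 x / 2 \<ge> \<gamma>) \<and>
     continuous_on {-1..1} a1 \<and> continuous_on {-1..1} c \<and> continuous_on {-1..1} f"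

text \<open>Compactness of \<open>[-1, 1]\<close> provides the constants of \<open>tp_data\<close>; they precede the choice of \<open>\<epsilon>\<close> and \<open>u\<close>,
and so does \<open>M\<close>.\<close>

lemma weighted_a_priori_estimates:
  assumes data: "turning_point_data 2 a a' b c f \<gamma>"
  obtains a1 B M where "convection_data a a1 c f B \<gamma>" "M > 0"
    "\<And>\<epsilon> u. 0 < \<epsilon> \<Longrightarrow> \<epsilon> \<le> 1 \<Longrightarrow> bvp_solution \<epsilon> a c f u \<Longrightarrow>
       \<exists>u1 u2 u3. layer_solution \<epsilon> M a c f u u1 u2 u3"
proof -
  let ?I = "{-1..1::real}"
  obtain a1 a2 where a: "\<And>x. x \<in> ?I \<Longrightarrow> (a has_real_derivative a1 x) (at x within ?I)"
    "\<And>x. x \<in> ?I \<Longrightarrow> (a1 has_real_derivative a2 x) (at x within ?I)" "continuous_on ?I a2"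
    using data Ck_on_2D[of a] unfolding turning_point_data_def by metis
  obtain c1 c2 where c: "\<And>x. x \<in> ?I \<Longrightarrow> (c has_real_derivative c1 x) (at x within ?I)"
    "\<And>x. x \<in> ?I \<Longrightarrow> (c1 has_real_derivative c2 x) (at x within ?I)" "continuous_on ?I c2"
    using data Ck_on_2D[of c] unfolding turning_point_data_def by metis
  obtain f1 f2 where f: "\<And>x. x \<in> ?I \<Longrightarrow> (f has_real_derivative f1 x) (at x within ?I)"
    "\<And>x. x \<in> ?I \<Longrightarrow> (f1 has_real_derivative f2 x) (at x within ?I)" "continuous_on ?I f2"
    using data Ck_on_2D[of f] unfolding turning_point_data_def by metis
  have d: "continuous_on ?I b" "\<And>x. x \<in> ?I \<Longrightarrow> a x = - x * b x" "\<And>x. x \<in> ?I \<Longrightarrow> b x > 0"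
    "\<And>x. x \<in> ?I \<Longrightarrow> c x \<ge> 0" "c 0 > 0" "\<gamma> > 0" "\<And>x. x \<in> ?I \<Longrightarrow> c x - a' x / 2 \<ge> \<gamma>"
    "\<And>x. x \<in> ?I \<Longrightarrow> (a has_real_derivative a' x) (at x within ?I)"
    using data unfolding turning_point_data_def by blast+
  have a'1: "a' x = a1 x" if "x \<in> ?I" for x
    using has_real_derivative_unique_Icc[OF _ that d(8)[OF that] a(1)[OF that]] by simp
  note cc = DERIV_continuous_on[OF a(2)] DERIV_continuous_on[OF c(1)] DERIV_continuous_on[OF c(2)]
     DERIV_continuous_on[OF f(1)] DERIV_continuous_on[OF f(2)]
  obtain Kb where Kb: "\<And>x. x \<in> ?I \<Longrightarrow> \<bar>b x\<bar> \<le> Kb" using continuous_on_Icc_bounded[OF d(1)] by blast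
  obtain Ka1 where Ka1: "\<And>x. x \<in> ?I \<Longrightarrow> \<bar>a1 x\<bar> \<le> Ka1" using continuous_on_Icc_bounded[OF cc(1)] by blast
  obtain Ka2 where Ka2: "\<And>x. x \<in> ?I \<Longrightarrow> \<bar>a2 x\<bar> \<le> Ka2" using continuous_on_Icc_bounded[OF a(3)] by blast
  obtain Kc where Kc: "\<And>x. x \<in> ?I \<Longrightarrow> \<bar>c x\<bar> \<le> Kc" using continuous_on_Icc_bounded[OF cc(2)] by blast
  obtain Kc1 where Kc1: "\<And>x. x \<in> ?I \<Longrightarrow> \<bar>c1 x\<bar> \<le> Kc1" using continuous_on_Icc_bounded[OF cc(3)] by blast
  obtain Kc2 where Kc2: "\<And>x. x \<in> ?I \<Longrightarrow> \<bar>c2 x\<bar> \<le> Kc2" using continuous_on_Icc_bounded[OF c(3)] by blast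
  obtain Kf where Kf: "\<And>x. x \<in> ?I \<Longrightarrow> \<bar>f x\<bar> \<le> Kf" using continuous_on_Icc_bounded[OF cc(4)] by blast
  obtain Kf1 where Kf1: "\<And>x. x \<in> ?I \<Longrightarrow> \<bar>f1 x\<bar> \<le> Kf1" using continuous_on_Icc_bounded[OF cc(5)] by blast
  obtain Kf2 where Kf2: "\<And>x. x \<in> ?I \<Longrightarrow> \<bar>f2 x\<bar> \<le> Kf2" using continuous_on_Icc_bounded[OF f(3)] by blast
  define B where "B = Max {1, Kb, Ka1, Ka2, Kc, Kc1, Kc2, Kf, Kf1, Kf2}"
  have B: "1 \<le> B" "Kb \<le> B" "Ka1 \<le> B" "Ka2 \<le> B" "Kc \<le> B" "Kc1 \<le> B" "Kc2 \<le> B" "Kf \<le> B" "Kf1 \<le> B" "Kf2 \<le> B"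
    unfolding B_def by (intro Max_ge; simp)+
  obtain \<beta> where \<beta>: "\<beta> > 0" "\<And>x. x \<in> ?I \<Longrightarrow> \<beta> \<le> b x"
    using continuous_on_Icc_pos_lower_bound[OF d(1) _ d(3)] by auto
  \<comment> \<open>\<open>c\<close> may vanish away from the turning point, where \<open>x\<^sup>2 b\<close> takes over\<close>
  have p: "c x + 2 * x^2 * b x > 0" if x: "x \<in> ?I" for x
  proof (cases "x = 0")
    case False
    then have "2 * x^2 * b x > 0" using d(3)[OF x] by simp
    then show ?thesis using d(4)[OF x] by linarith
  qed (use d(5) in simp)
  have cm: "continuous_on ?I (\<lambda>x. c x + 2 * x^2 * b x)" by (intro continuous_intros cc(2) d(1))
  obtain m where m: "m > 0" "\<And>x. x \<in> ?I \<Longrightarrow> m \<le> c x + 2 * x^2 * b x"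
    using continuous_on_Icc_pos_lower_bound[OF cm _ p] by auto
  have ab: "\<bar>a x\<bar> \<le> B * \<bar>x\<bar>" if x: "x \<in> ?I" for x
  proof -
    have "\<bar>x\<bar> * \<bar>b x\<bar> \<le> \<bar>x\<bar> * B" using Kb[OF x] B(2) by (intro mult_left_mono) auto
    then show ?thesis using d(2)[OF x] by (simp add: abs_mult mult.commute)
  qed
  have tp: "tp_data a a1 a2 c c1 c2 f f1 f2 \<beta> B m"
  proof
    fix x assume x: "x \<in> ?I"
    show "\<beta> * x^2 \<le> - (x * a x)"
      using mult_right_mono[OF \<beta>(2)[OF x] zero_le_power2[of x]] d(2)[OF x]
      by (simp add: power2_eq_square mult_ac)
    show "m \<le> c x - 2 * (x * a x)" using m(2)[OF x] d(2)[OF x] by (simp add: power2_eq_square mult_ac)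
    show "\<bar>a1 x\<bar> \<le> B" "\<bar>a2 x\<bar> \<le> B" "\<bar>c x\<bar> \<le> B" "\<bar>c1 x\<bar> \<le> B" "\<bar>c2 x\<bar> \<le> B" "\<bar>f x\<bar> \<le> B" "\<bar>f1 x\<bar> \<le> B" "\<bar>f2 x\<bar> \<le> B"
      using Ka1[OF x] Ka2[OF x] Kc[OF x] Kc1[OF x] Kc2[OF x] Kf[OF x] Kf1[OF x] Kf2[OF x] B by linarith+
  qed (use a c f d(4) B(1) \<beta>(1) m(1) ab in auto)
  interpret tp_data a a1 a2 c c1 c2 f f1 f2 \<beta> B m by (rule tp)
  define M where "M = Max {1, Msup, 2 * E1, 8 * E2, 32 * E3}"
  have M: "1 \<le> M" "Msup \<le> M" "2 * E1 \<le> M" "8 * E2 \<le> M" "32 * E3 \<le> M"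
    unfolding M_def by (intro Max_ge; simp)+
  show ?thesis
  proof (rule that[of a1 B M])
    show "convection_data a a1 c f B \<gamma>"
      unfolding convection_data_def using B(1) d(6) a(1) cc(1,2,4) ab bd(2,4) d(7) a'1 by auto
    fix \<epsilon> u assume e: "0 < \<epsilon>" "\<epsilon> \<le> 1" "bvp_solution \<epsilon> a c f u"
    from bvp_solution_regular[OF e(1,3) a(1) c(1) f(1) a(2) c(2) f(2) a(3) c(3) f(3)]
    obtain u1 u2 u3 u4 where u:
     "\<forall>x\<in>{-1..1}. (u has_real_derivative u1 x) (at x within {-1..1})"
     "\<forall>x\<in>{-1..1}. (u1 has_real_derivative u2 x) (at x within {-1..1})"
     "\<forall>x\<in>{-1..1}. (u2 has_real_derivative u3 x) (at x within {-1..1})"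
     "\<forall>x\<in>{-1..1}. (u3 has_real_derivative u4 x) (at x within {-1..1})"
     "continuous_on {-1..1} u4"
     "\<forall>x\<in>{-1..1}. \<epsilon> * u2 x = a x * u1 x + c x * u x - f x"
     "\<forall>x\<in>{-1..1}. \<epsilon> * u3 x = a1 x * u1 x + a x * u2 x + c1 x * u x + c x * u1 x - f1 x"
     "\<forall>x\<in>{-1..1}. \<epsilon> * u4 x = a2 x * u1 x + 2 * a1 x * u2 x + a x * u3 x
          + c2 x * u x + 2 * c1 x * u1 x + c x * u2 x - f2 x" by blast
    interpret tp_sol a a1 a2 c c1 c2 f f1 f2 \<beta> B m \<epsilon> u u1 u2 u3 u4
      by unfold_locales (use u e in \<open>auto simp: bvp_solution_def\<close>)
    have "layer_solution \<epsilon> M a c f u u1 u2 u3"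
      unfolding layer_solution_def
      using bc du du1 du2 eq0 conts(10) weighted_integrals M u_bound by (meson order.trans)
    then show "\<exists>u1 u2 u3. layer_solution \<epsilon> M a c f u u1 u2 u3" by blast
  qed (use M(1) in simp)
qed

section \<open>Piecewise linear functions and integration cell by cell\<close>

lemma LBINT_Ioo_of_continuous:
  fixes F g :: "real \<Rightarrow> real"
  assumes "continuous_on {p..q} g" "\<And>t. t \<in> {p<..<q} \<Longrightarrow> F t = g t"
  shows "set_integrable lborel {p<..<q} F" "(LBINT x:{p<..<q}. F x) = integral {p..q} g"
proof -
  have g: "set_integrable lborel {p<..<q} g"
    by (rule set_integrable_subset[OF borel_integrable_atLeastAtMost'[OF assms(1)]]) auto
  show "set_integrable lborel {p<..<q} F"
  proof -
    have "set_integrable lborel {p<..<q} F = set_integrable lborel {p<..<q} g"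
      by (rule set_integrable_cong) (use assms(2) in auto)
    then show ?thesis using g by simp
  qed
  have "(LBINT x:{p<..<q}. F x) = (LBINT x:{p<..<q}. g x)"
    by (rule set_lebesgue_integral_cong) (use assms(2) in auto)
  also have "\<dots> = integral {p<..<q} g" by (rule set_borel_integral_eq_integral(2)[OF g])
  finally show "(LBINT x:{p<..<q}. F x) = integral {p..q} g" by (simp add: integral_open_interval_real)
qed

lemma LBINT_singleton:
  fixes F :: "real \<Rightarrow> real"
  shows "set_integrable lborel {p} F" "(LBINT x:{p}. F x) = 0"
proof -
  have "set_integrable lborel {p} (\<lambda>x. F p)"
    unfolding set_integrable_def by (intro integrable_scaleR_left) simp
  then show "set_integrable lborel {p} F"
    using set_integrable_cong[of lborel lborel "{p}" "{p}" F "\<lambda>x. F p"] by simp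
  have "(LBINT x:{p}. F x) = (LBINT x:{p}. F p)" by (rule set_lebesgue_integral_cong) auto
  then show "(LBINT x:{p}. F x) = 0" by (simp add: set_lebesgue_integral_def)
qed

text \<open>The integrands of the bilinear form are known only inside the cells, since \<^const>\<open>deriv\<close> is
unspecified at the nodes. This replaces them on every cell by a function continuous on the closed
cell and so passes to gauge integrals, for which integration by parts is available.\<close>

lemma LBINT_sum_cells:
  fixes y :: "nat \<Rightarrow> real" and F :: "real \<Rightarrow> real" and g :: "nat \<Rightarrow> real \<Rightarrow> real"
  assumes "\<And>j. j < n \<Longrightarrow> y j < y (Suc j)" "\<And>j. j < n \<Longrightarrow> continuous_on {y j..y (Suc j)} (g j)"
    "\<And>j t. j < n \<Longrightarrow> t \<in> {y j<..<y (Suc j)} \<Longrightarrow> F t = g j t"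
  shows "set_integrable lborel {y 0<..<y n} F \<and>
    (LBINT x:{y 0<..<y n}. F x) = (\<Sum>j<n. integral {y j..y (Suc j)} (g j)) \<and> y 0 \<le> y n"
  using assms
proof (induction n)
  case (Suc n)
  have IH: "set_integrable lborel {y 0<..<y n} F"
    "(LBINT x:{y 0<..<y n}. F x) = (\<Sum>j<n. integral {y j..y (Suc j)} (g j))" "y 0 \<le> y n"
    using Suc by simp_all
  have lt: "y n < y (Suc n)" using Suc.prems(1) by simp
  have c: "set_integrable lborel {y n<..<y (Suc n)} F"
    "(LBINT x:{y n<..<y (Suc n)}. F x) = integral {y n..y (Suc n)} (g n)"
    using Suc.prems(2,3) by (intro LBINT_Ioo_of_continuous[where g = "g n"]; simp)+
  show ?case
  proof (cases "y 0 = y n")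
    case True
    then have "(\<Sum>j<n. integral {y j..y (Suc j)} (g j)) = 0" using IH(2) by (simp add: set_lebesgue_integral_def)
    then show ?thesis using True c lt by simp
  next
    case False
    have s: "{y 0<..<y (Suc n)} = ({y 0<..<y n} \<union> {y n}) \<union> {y n<..<y (Suc n)}"
      using IH(3) lt False by auto
    have 1: "set_integrable lborel ({y 0<..<y n} \<union> {y n}) F"
      by (intro set_integrable_Un IH LBINT_singleton) auto
    have "set_integrable lborel {y 0<..<y (Suc n)} F" unfolding s
      by (intro set_integrable_Un 1 c) auto
    moreover have "(LBINT x:{y 0<..<y (Suc n)}. F x) =
      (LBINT x:{y 0<..<y n}. F x) + (LBINT x:{y n}. F x) + (LBINT x:{y n<..<y (Suc n)}. F x)"
      unfolding s by (subst set_integral_Un[OF _ 1 c(1)], simp)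
        (subst set_integral_Un[OF _ IH(1) LBINT_singleton(1)], simp_all)
    ultimately show ?thesis using IH lt c by (simp add: LBINT_singleton)
  qed
qed (simp add: set_integrable_def set_lebesgue_integral_def)

lemma integral_sum_cells:
  fixes y :: "nat \<Rightarrow> real" and g :: "real \<Rightarrow> real"
  assumes "\<And>j. j < n \<Longrightarrow> y j \<le> y (Suc j)" "continuous_on {y 0..y n} g"
  shows "(\<Sum>j<n. integral {y j..y (Suc j)} g) = integral {y 0..y n} g \<and> y 0 \<le> y n"
  using assms
proof (induction n)
  case (Suc n)
  have m: "y 0 \<le> y k" if "k \<le> Suc n" for k
    using that Suc.prems(1) by (induction k) (auto intro: order.trans)
  have l: "y n \<le> y (Suc n)" using Suc.prems(1) by simp
  have "continuous_on {y 0..y n} g" using Suc.prems(2) l by (auto intro: continuous_on_subset)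
  then have "(\<Sum>j<n. integral {y j..y (Suc j)} g) = integral {y 0..y n} g" using Suc by simp
  moreover have "integral {y 0..y n} g + integral {y n..y (Suc n)} g = integral {y 0..y (Suc n)} g"
    using m[of n] l Suc.prems(2) by (intro Henstock_Kurzweil_Integration.integral_combine integrable_continuous_real) auto
  ultimately show ?case using m[of "Suc n"] by simp
qed auto

text \<open>The slopes \<open>s j\<close> are carried along explicitly: they are the values of the derivative on the open
cells, and all later computations refer to them instead of \<^const>\<open>deriv\<close>.\<close>

definition pw_linear :: "nat \<Rightarrow> (nat \<Rightarrow> real) \<Rightarrow> (real \<Rightarrow> real) \<Rightarrow> (nat \<Rightarrow> real) \<Rightarrow> bool" where
  "pw_linear n y v s \<longleftrightarrow> (\<forall>j<n. \<forall>t\<in>{y j..y (Suc j)}. v t = v (y j) + s j * (t - y j))"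

lemma pw_linearD:
  assumes "pw_linear n y v s" "j < n" "t \<in> {y j..y (Suc j)}"
  shows "v t = v (y j) + s j * (t - y j)"
  using assms unfolding pw_linear_def by blast

lemma mesh_mono_nat:
  fixes y :: "nat \<Rightarrow> real"
  assumes "\<And>j. j < n \<Longrightarrow> y j < y (Suc j)" "i \<le> j" "j \<le> n"
  shows "y i \<le> y j"
  using assms(2,3)
proof (induction j rule: dec_induct)
  case (step k)
  then show ?case using assms(1)[of k] by (smt (verit) Suc_le_eq Suc_leD)
qed simp

lemma fe_space_slopes:
  fixes x :: "int \<Rightarrow> real" and N :: nat
  defines "y \<equiv> \<lambda>j. x (int j - int N)"
  assumes v: "v \<in> fe_space N x" and y: "\<And>j. j < 2 * N \<Longrightarrow> y j < y (Suc j)" "y 0 = -1" "y (2 * N) = 1"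
  obtains s where "pw_linear (2 * N) y v s"
proof -
  have "\<exists>s. \<forall>t\<in>{y j..y (Suc j)}. v t = v (y j) + s * (t - y j)" if j: "j < 2 * N" for j
  proof -
    have i: "int j - int N + 1 \<in> {- int N + 1..int N}" using j by auto
    then obtain p :: "real poly" where p: "degree p \<le> 1" "\<And>t. t \<in> {y j<..<y (Suc j)} \<Longrightarrow> v t = poly p t"
    proof -
      have "x (int j - int N + 1 - 1) = y j" "x (int j - int N + 1) = y (Suc j)"
        by (simp_all add: y_def algebra_simps)
      moreover have "\<exists>p :: real poly. degree p \<le> 1 \<and>
          (\<forall>t\<in>{x (int j - int N + 1 - 1)<..<x (int j - int N + 1)}. v t = poly p t)"
        using v i unfolding fe_space_def by blast
      ultimately show ?thesis using that by auto
    qed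
    define p0 p1 where "p0 = coeff p 0" "p1 = coeff p 1"
    have pp: "p = [:p0, p1:]"
      by (rule poly_eqI) (use p(1) in \<open>auto simp: p0_p1_def coeff_pCons coeff_eq_0 split: nat.splits\<close>)
    have sub: "{y j..y (Suc j)} \<subseteq> {-1..1}"
      using mesh_mono_nat[of "2 * N" y 0 j, OF y(1)] mesh_mono_nat[of "2 * N" y "Suc j" "2 * N", OF y(1)] j y(2,3) by auto
    have c: "continuous_on (closure {y j<..<y (Suc j)}) (\<lambda>t. v t - (p0 + p1 * t))"
    proof (intro continuous_intros)
      have "continuous_on {-1..1} v" using v by (simp add: fe_space_def)
      then show "continuous_on (closure {y j<..<y (Suc j)}) v"
        by (rule continuous_on_subset) (use sub y(1)[OF j] in simp)
    qed
    have e: "v t = p0 + p1 * t" if t: "t \<in> {y j..y (Suc j)}" for t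
      using continuous_constant_on_closure[OF c, of 0 t] p(2) t y(1)[OF j] by (simp add: pp mult.commute)
    show ?thesis
    proof (intro exI[of _ p1] ballI)
      fix t assume t: "t \<in> {y j..y (Suc j)}"
      have "v (y j) = p0 + p1 * y j" using e[of "y j"] y(1)[OF j] by simp
      then show "v t = v (y j) + p1 * (t - y j)" using e[OF t] by (simp add: algebra_simps)
    qed
  qed
  then obtain s where "\<And>j. j < 2 * N \<Longrightarrow> \<forall>t\<in>{y j..y (Suc j)}. v t = v (y j) + s j * (t - y j)" by metis
  then show ?thesis using that unfolding pw_linear_def by blast
qed

lemma pw_linear_in_fe_space:
  fixes x :: "int \<Rightarrow> real" and N :: nat
  defines "y \<equiv> \<lambda>j. x (int j - int N)"
  assumes v: "pw_linear (2 * N) y v s" "continuous_on {-1..1} v" "v (-1) = 0" "v 1 = 0"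
  shows "v \<in> fe_space N x"
proof -
  have "\<exists>p :: real poly. degree p \<le> 1 \<and> (\<forall>t\<in>{x (i - 1)<..<x i}. v t = poly p t)"
    if i: "i \<in> {- int N + 1..int N}" for i
  proof -
    define j where "j = nat (i - 1 + int N)"
    have j: "j < 2 * N" "y j = x (i - 1)" "y (Suc j) = x i" using i by (auto simp: j_def y_def)
    show ?thesis
      by (rule exI[of _ "[:v (y j) - s j * y j, s j:]"])
         (use pw_linearD[OF v(1) j(1)] j(2,3) in \<open>simp add: algebra_simps\<close>)
  qed
  then show ?thesis using v unfolding fe_space_def by auto
qed

text \<open>The interpolant is the integral of its step-function derivative: cell \<open>j\<close> contributes its slope
times the length of the part of the cell to the left of \<open>t\<close>. Continuity is then evident, and the
values at the nodes telescope.\<close>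

lemma pw_linear_interpolant:
  fixes y g :: "nat \<Rightarrow> real"
  assumes y: "\<And>j. j < n \<Longrightarrow> y j < y (Suc j)" and g0: "g 0 = 0"
  obtains v where "continuous_on UNIV v" "\<And>j. j \<le> n \<Longrightarrow> v (y j) = g j"
    "pw_linear n y v (\<lambda>j. (g (Suc j) - g j) / (y (Suc j) - y j))"
proof -
  define s where "s = (\<lambda>j. (g (Suc j) - g j) / (y (Suc j) - y j))"
  define v where "v = (\<lambda>t. \<Sum>j<n. s j * (min (max t (y j)) (y (Suc j)) - y j))"
  have sy: "s j * (y (Suc j) - y j) = g (Suc j) - g j" if "j < n" for j
    using y[OF that] by (simp add: s_def)
  have cell: "v t = g k + s k * (t - y k)" if k: "k < n" and t: "t \<in> {y k..y (Suc k)}" for k t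
  proof -
    have "v t = (\<Sum>j<n. (if j < k then g (Suc j) - g j else 0) + (if j = k then s k * (t - y k) else 0))"
      unfolding v_def
    proof (rule sum.cong)
      fix j assume "j \<in> {..<n}"
      then have j: "j < n" by simp
      consider "j < k" | "j = k" | "k < j" by linarith
      then show "s j * (min (max t (y j)) (y (Suc j)) - y j)
         = (if j < k then g (Suc j) - g j else 0) + (if j = k then s k * (t - y k) else 0)"
      proof cases
        case 1
        then have "y (Suc j) \<le> t" using mesh_mono_nat[of n y "Suc j" k, OF y] k t by auto
        then have "min (max t (y j)) (y (Suc j)) = y (Suc j)" using y[OF j] by linarith
        then show ?thesis using 1 sy[OF j] by simp
      next
        case 2
        then have "min (max t (y j)) (y (Suc j)) = t" using t by auto
        then show ?thesis using 2 by simp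
      next
        case 3
        then have "t \<le> y j" using mesh_mono_nat[of n y "Suc k" j, OF y] j t by auto
        then have "min (max t (y j)) (y (Suc j)) = y j" using y[OF j] by linarith
        then show ?thesis using 3 by simp
      qed
    qed simp
    also have "\<dots> = (\<Sum>j<n. if j < k then g (Suc j) - g j else 0) + s k * (t - y k)"
      using k by (simp add: sum.distrib)
    also have "(\<Sum>j<n. if j < k then g (Suc j) - g j else 0) = (\<Sum>j<k. g (Suc j) - g j)"
      using k by (intro sum.mono_neutral_cong_right) auto
    also have "\<dots> = g k" using sum_lessThan_telescope[of g k] g0 by simp
    finally show ?thesis .
  qed
  have node: "v (y j) = g j" if j: "j \<le> n" for j
  proof (cases "j = n")
    case True
    show ?thesis
    proof (cases n)
      case 0 then show ?thesis using True g0 by (simp add: v_def)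
    next
      case (Suc k)
      then show ?thesis using cell[of k "y (Suc k)"] y[of k] sy[of k] True by auto
    qed
  next
    case False
    then show ?thesis using cell[of j "y j"] y[of j] j by auto
  qed
  show ?thesis
  proof (rule that[OF _ node])
    show "continuous_on UNIV v" unfolding v_def by (intro continuous_intros)
    show "pw_linear n y v (\<lambda>j. (g (Suc j) - g j) / (y (Suc j) - y j))"
      unfolding pw_linear_def
    proof (intro allI impI ballI)
      fix j t assume "j < n" "t \<in> {y j..y (Suc j)}"
      then show "v t = v (y j) + (g (Suc j) - g j) / (y (Suc j) - y j) * (t - y j)"
        using cell[of j t] node[of j] by (simp add: s_def)
    qed
  qed auto
qed

lemma pw_linear_deriv:
  assumes v: "pw_linear n y v s" and j: "j < n" and t: "t \<in> {y j<..<y (Suc j)}"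
  shows "(v has_real_derivative s j) (at t)"
proof (rule has_field_derivative_transform_within_open)
  show "((\<lambda>t. v (y j) + s j * (t - y j)) has_real_derivative s j) (at t)"
    by (auto intro!: derivative_eq_intros)
  show "open {y j<..<y (Suc j)}" "t \<in> {y j<..<y (Suc j)}" using t by simp_all
  fix z assume "z \<in> {y j<..<y (Suc j)}"
  then have "z \<in> {y j..y (Suc j)}" by simp
  from pw_linearD[OF v j this] show "v (y j) + s j * (z - y j) = v z" by (rule sym)
qed

section \<open>The graded mesh\<close>

lemma powr_mvt:
  fixes r :: real
  assumes "0 < x" "x < y"
  obtains z where "x < z" "z < y" "y powr r - x powr r = (y - x) * (r * z powr (r - 1))"
proof -
  have "\<exists>z>x. z < y \<and> y powr r - x powr r = (y - x) * (r * z powr (r - 1))"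
    using assms by (intro MVT2 has_real_derivative_powr) auto
  then show ?thesis using that by blast
qed

lemma powr_diff_bound:
  fixes r :: real
  assumes xy: "0 < x" "0 < y" "x \<le> M" "y \<le> M" and r: "r \<ge> 1"
  shows "\<bar>x powr r - y powr r\<bar> \<le> r * M powr (r - 1) * \<bar>x - y\<bar>"
proof -
  have *: "\<bar>x powr r - y powr r\<bar> \<le> r * M powr (r - 1) * \<bar>x - y\<bar>"
    if h: "0 < x" "x < y" "y \<le> M" for x y
  proof -
    obtain z where z: "x < z" "z < y" "y powr r - x powr r = (y - x) * (r * z powr (r - 1))"
      using powr_mvt[OF h(1,2)] by blast
    have "(y - x) * (r * z powr (r - 1)) \<le> (y - x) * (r * M powr (r - 1))"
      using z h r by (intro mult_left_mono powr_mono2) auto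
    moreover have "x powr r \<le> y powr r" using h r by (intro powr_mono2) auto
    ultimately show ?thesis using z(3) h(2) by (simp add: mult_ac)
  qed
  consider "x < y" | "x = y" | "y < x" by linarith
  then show ?thesis
  proof cases
    case 1 then show ?thesis using * xy by blast
  next
    case 3 then show ?thesis using *[of y x] xy by (simp add: abs_minus_commute)
  qed auto
qed

text \<open>\<open>W\<close> is the power \<open>3/2\<close> of the layer distance. It is the weight of \<open>u''\<close> in the a priori estimates,
because \<open>W\<^sup>2 = (sqrt \<epsilon> + \<bar>z\<bar>)\<^sup>3\<close>.\<close>

definition W :: "real \<Rightarrow> real \<Rightarrow> real" where
  "W \<epsilon> z = (sqrt \<epsilon> + \<bar>z\<bar>) * sqrt (sqrt \<epsilon> + \<bar>z\<bar>)"

text \<open>The mesh generating function is \<open>\<xi> \<mapsto> (t \<xi>)\<^bsup>1/\<alpha>\<^esup> - sqrt \<epsilon>\<close> with an affine \<open>t\<close>; \<open>step_sq\<close> is \<open>N\<^bsup>-2\<^esup>\<close> times the square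
of its derivative, expressed through the point \<open>z\<close> instead of \<open>\<xi>\<close>. It is a continuous model of the
squared step size.\<close>

definition step_sq :: "real \<Rightarrow> real \<Rightarrow> nat \<Rightarrow> real \<Rightarrow> real" where
  "step_sq \<alpha> \<epsilon> N z = (((1 + sqrt \<epsilon>) powr \<alpha> - \<epsilon> powr (\<alpha> / 2)) / (\<alpha> * real N))^2 * (sqrt \<epsilon> + \<bar>z\<bar>) powr (2 - 2 * \<alpha>)"

text \<open>On a fine cell the layer distance varies by a bounded factor only, and the step size is governed
by it. The four conditions are those consumed by the interpolation error in \<open>L\<^sup>2\<close>, by its derivative,
by the third order remainder, and by the replacement of the squared step size by its model \<open>H\<close>.\<close>

definition fine_cell :: "real \<Rightarrow> real \<Rightarrow> nat \<Rightarrow> (real \<Rightarrow> real) \<Rightarrow> real \<Rightarrow> real \<Rightarrow> bool" where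
  "fine_cell \<epsilon> K N H p q \<longleftrightarrow> (\<forall>z\<in>{p..q}.
      (q - p)^2 \<le> K / (real N)^2 * W \<epsilon> z \<and>
      sqrt \<epsilon> * (q - p) \<le> K / real N * W \<epsilon> z \<and>
      (\<forall>z'\<in>{p..q}. (sqrt \<epsilon> + \<bar>z'\<bar>) * (q - p)^2 \<le> K / (real N)^2 * ((sqrt \<epsilon> + \<bar>z\<bar>) * W \<epsilon> z)) \<and>
      \<bar>(q - p)^2 - H z\<bar> * (sqrt \<epsilon> + \<bar>z\<bar>) \<le> K / (real N)^2 * (W \<epsilon> z * (q - p)))"

text \<open>A cell at the turning point on which the layer distance varies strongly is so short that even the
trivial bound of the interpolation error suffices.\<close>

definition tiny_cell :: "real \<Rightarrow> real \<Rightarrow> nat \<Rightarrow> (real \<Rightarrow> real) \<Rightarrow> real \<Rightarrow> real \<Rightarrow> bool" where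
  "tiny_cell \<epsilon> K N H p q \<longleftrightarrow> q - p \<le> K / (real N) ^ 4 \<and> sqrt \<epsilon> \<le> K / (real N) ^ 4 \<and>
      (\<forall>z\<in>{p..q}. sqrt \<epsilon> + \<bar>z\<bar> \<le> 2 * (q - p) \<and>
        \<bar>H z\<bar> * (sqrt \<epsilon> + \<bar>z\<bar>) \<le> K / (real N)^2 * (W \<epsilon> z * (q - p)))"

text \<open>All powers of the layer distance that occur have the exponent \<open>2 - 2 \<alpha>\<close> or \<open>2 - \<alpha>\<close>; the bound
\<open>\<alpha> \<le> 1/4\<close> places them at or above \<open>3/2\<close>.\<close>

lemma powr_le_W:
  assumes e: "0 < \<epsilon>" and X: "sqrt \<epsilon> + \<bar>z\<bar> \<le> 2" and r: "3/2 \<le> r" "r \<le> 2"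
  shows "(sqrt \<epsilon> + \<bar>z\<bar>) powr r \<le> 2 * W \<epsilon> z"
proof -
  let ?X = "sqrt \<epsilon> + \<bar>z\<bar>"
  have X0: "?X > 0" using e by (intro add_pos_nonneg) auto
  have "W \<epsilon> z = ?X powr 1 * ?X powr (1/2)" using X0 by (simp add: W_def powr_half_sqrt)
  also have "\<dots> = ?X powr (3/2)" by (subst powr_add[symmetric]) simp
  finally have W: "W \<epsilon> z = ?X powr (3/2)" .
  have "?X powr (r - 3/2) \<le> 2 powr (r - 3/2)" using X X0 r by (intro powr_mono2) auto
  also have "\<dots> \<le> 2 powr 1" using r by (intro powr_mono) auto
  finally have "?X powr (r - 3/2) * ?X powr (3/2) \<le> 2 * ?X powr (3/2)" by (intro mult_right_mono) auto
  then show ?thesis unfolding W by (simp flip: powr_add)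
qed

locale graded =
  fixes \<epsilon> \<alpha> :: real and N :: nat
  assumes eps: "0 < \<epsilon>" "\<epsilon> \<le> 1" and alpha: "0 < \<alpha>" "\<alpha> \<le> 1/4" and N: "N \<ge> 1"
begin

text \<open>\<open>t i\<close> is the power \<open>\<alpha>\<close> of the layer distance of the node \<open>\<phi> i\<close>; the nodes are equidistant in this
variable, with step \<open>D / N\<close>.\<close>

definition D :: real where "D = (1 + sqrt \<epsilon>) powr \<alpha> - \<epsilon> powr (\<alpha> / 2)"
definition r :: real where "r = 1 / \<alpha>"
definition t :: "nat \<Rightarrow> real" where "t i = \<epsilon> powr (\<alpha> / 2) + real i * (D / real N)"
definition Kg :: real where "Kg = 16 * r^2 * (2 powr r) ^ 3"

lemma r_ge: "r \<ge> 4" "r * \<alpha> = 1" using alpha by (auto simp: r_def field_simps)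

lemma eps_powr: "\<epsilon> powr (\<alpha> / 2) = sqrt \<epsilon> powr \<alpha>"
  using eps by (simp add: powr_powr flip: powr_half_sqrt)

lemma D_bounds: "0 < D" "D \<le> 2"
proof -
  have "sqrt \<epsilon> powr \<alpha> < (1 + sqrt \<epsilon>) powr \<alpha>" using eps alpha by (intro powr_less_mono2) auto
  then show "0 < D" by (simp add: D_def eps_powr)
  have "(1 + sqrt \<epsilon>) powr \<alpha> \<le> 2 powr \<alpha>" using eps alpha by (intro powr_mono2) auto
  also have "\<dots> \<le> 2 powr 1" using alpha by (intro powr_mono) auto
  also have "2 powr 1 = (2::real)" by simp
  finally show "D \<le> 2" using powr_ge_zero[of \<epsilon> "\<alpha> / 2"] unfolding D_def by linarith
qed

lemma t_Suc: "t (Suc i) - t i = D / real N" by (simp add: t_def algebra_simps add_divide_distrib)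

lemma t_pos: "t i > 0" using eps D_bounds N by (auto simp: t_def intro!: add_pos_nonneg)

lemma t_less: "t i < t (Suc i)"
proof -
  have "D / real N > 0" using D_bounds N by simp
  then show ?thesis using t_Suc[of i] by linarith
qed

lemma t0: "t 0 powr r = sqrt \<epsilon>"
  using eps r_ge(2) by (simp add: t_def eps_powr powr_powr mult.commute)

lemma tN: "t N powr r = 1 + sqrt \<epsilon>"
  using eps r_ge(2) N by (simp add: t_def D_def powr_powr mult.commute)

definition \<phi> :: "nat \<Rightarrow> real" where "\<phi> i = t i powr r - sqrt \<epsilon>"

lemma phi_less: "\<phi> i < \<phi> (Suc i)"
  using t_less[of i] t_pos[of i] r_ge by (auto simp: \<phi>_def intro!: powr_less_mono2)

lemma phi_0: "\<phi> 0 = 0" and phi_N: "\<phi> N = 1" by (simp_all add: \<phi>_def t0 tN)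

lemma phi_mono: "i \<le> j \<Longrightarrow> \<phi> i \<le> \<phi> j"
  by (rule lift_Suc_mono_le) (use phi_less in \<open>auto intro: less_imp_le\<close>)

lemma mesh_phi: "mesh \<alpha> \<epsilon> N (int i) = \<phi> i" "mesh \<alpha> \<epsilon> N (- int i) = - \<phi> i"
proof -
  show 1: "mesh \<alpha> \<epsilon> N (int i) = \<phi> i"
    by (simp add: mesh_def mesh_fun_def \<phi>_def t_def D_def r_def)
  show "mesh \<alpha> \<epsilon> N (- int i) = - \<phi> i"
  proof (cases "i = 0")
    case True then show ?thesis using 1 phi_0 by simp
  next
    case False
    then have "- real i / real N < 0" using N by simp
    then show ?thesis by (simp add: mesh_def mesh_fun_def \<phi>_def t_def D_def r_def)
  qed
qed

lemma kappa: "(((1 + sqrt \<epsilon>) powr \<alpha> - \<epsilon> powr (\<alpha> / 2)) / (\<alpha> * real N)) = r * (D / real N)"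
  by (simp add: D_def r_def)

lemma step_bound: "r * (D / real N) \<le> 2 * r / real N" "0 < D / real N" "D / real N \<le> 2 / real N"
  using D_bounds r_ge N by (auto simp: divide_right_mono)

lemma Kg_ge:
  assumes "0 \<le> x" "x \<le> 16" "0 \<le> i" "i \<le> 2" "n \<le> 3"
  shows "x * r powr i * (2 powr r) ^ n \<le> Kg"
proof -
  have "r powr i \<le> r powr 2" using r_ge assms by (intro powr_mono) auto
  then have 1: "r powr i \<le> r^2" using r_ge by simp
  have "(2::real) powr r \<ge> 2 powr 0" using r_ge by (intro powr_mono) auto
  then have "((2::real) powr r) ^ n \<le> (2 powr r) ^ 3" using assms by (intro power_increasing) auto
  then show ?thesis unfolding Kg_def using 1 assms by (intro mult_mono mult_nonneg_nonneg) auto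
qed

lemma step_sq_bounds:
  assumes X: "sqrt \<epsilon> + \<bar>z\<bar> \<le> 2"
  shows "\<bar>step_sq \<alpha> \<epsilon> N z\<bar> \<le> 8 * r^2 / (real N)^2 * W \<epsilon> z"
proof -
  have W: "W \<epsilon> z \<ge> 0" using eps by (simp add: W_def)
  have k: "(r * (D / real N))^2 \<le> (2 * r / real N)^2"
    using step_bound D_bounds r_ge by (intro power_mono) auto
  have "\<bar>step_sq \<alpha> \<epsilon> N z\<bar> = (r * (D / real N))^2 * (sqrt \<epsilon> + \<bar>z\<bar>) powr (2 - 2 * \<alpha>)"
    unfolding step_sq_def kappa by (simp add: abs_mult)
  also have "\<dots> \<le> (2 * r / real N)^2 * (2 * W \<epsilon> z)"
    using k powr_le_W[OF eps(1) X, of "2 - 2 * \<alpha>"] alpha W by (intro mult_mono) auto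
  also have "\<dots> = 8 * r^2 / (real N)^2 * W \<epsilon> z" by (simp add: power_divide power_mult_distrib)
  finally show ?thesis .
qed

lemma cell_param:
  assumes i: "i < N" and z: "z \<in> {\<phi> i..\<phi> (Suc i)}"
  obtains s where "t i \<le> s" "s \<le> t (Suc i)" "sqrt \<epsilon> + \<bar>z\<bar> = s powr r" "sqrt \<epsilon> + \<bar>z\<bar> \<le> 2" "0 < sqrt \<epsilon> + \<bar>z\<bar>"
    "\<And>q. (sqrt \<epsilon> + \<bar>z\<bar>) powr q = s powr (r * q)"
proof -
  have z0: "z \<ge> 0" using z phi_mono[of 0 i] phi_0 by auto
  define X where "X = sqrt \<epsilon> + z"
  have X: "t i powr r \<le> X" "X \<le> t (Suc i) powr r" "X > 0" using z z0 eps by (auto simp: X_def \<phi>_def intro: add_pos_nonneg)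
  have pw: "(t k powr r) powr \<alpha> = t k" for k using t_pos[of k] r_ge by (simp add: powr_powr)
  have 1: "t i \<le> X powr \<alpha>" using powr_mono2[of \<alpha> "t i powr r" X] X alpha pw by simp
  have 2: "X powr \<alpha> \<le> t (Suc i)" using powr_mono2[of \<alpha> X "t (Suc i) powr r"] X alpha pw by simp
  have Xp: "X = (X powr \<alpha>) powr r" using X r_ge by (simp add: powr_powr mult.commute)
  have X2: "X \<le> 2"
  proof -
    have "z \<le> 1" using z phi_mono[of "Suc i" N] phi_N i by auto
    then show ?thesis using eps by (simp add: X_def add_mono[of "sqrt \<epsilon>" 1 z 1, simplified])
  qed
  have q: "X powr q = (X powr \<alpha>) powr (r * q)" for q
  proof -
    have "\<alpha> * (r * q) = (r * \<alpha>) * q" by simp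
    then have "\<alpha> * (r * q) = q" unfolding r_ge(2) by simp
    then have "X powr (\<alpha> * (r * q)) = X powr q" by (rule arg_cong)
    then show ?thesis by (simp only: powr_powr)
  qed
  have Xz: "sqrt \<epsilon> + \<bar>z\<bar> = X" using z0 by (simp add: X_def)
  show ?thesis
    by (rule that[OF 1 2, unfolded Xz, OF Xp X2 X(3) q])
qed

text \<open>If \<open>t\<close> at most doubles over the cell, the mean value theorem compares the step size, its square
and the model at all points of the cell. Otherwise \<open>t i < D / N\<close>, which forces \<open>i = 0\<close>, and the
right end has layer distance at most \<open>(4 / N)\<^bsup>1/\<alpha>\<^esup> = O(N\<^bsup>-4\<^esup>)\<close>.\<close>

lemma right_cell:
  assumes i: "i < N"
  shows "fine_cell \<epsilon> Kg N (step_sq \<alpha> \<epsilon> N) (\<phi> i) (\<phi> (Suc i)) \<or>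
     (i = 0 \<and> tiny_cell \<epsilon> Kg N (step_sq \<alpha> \<epsilon> N) (\<phi> i) (\<phi> (Suc i)))"
proof (cases "t (Suc i) \<le> 2 * t i")
  case True
  define \<delta> where "\<delta> = D / real N"
  define h where "h = \<phi> (Suc i) - \<phi> i"
  define P :: real where "P = 2 powr r"
  have P: "P \<ge> 1" using powr_mono[of 0 r "2::real"] r_ge by (simp add: P_def)
  have d: "0 < \<delta>" "\<delta> \<le> 2 / real N" "r * \<delta> \<le> 2 * r / real N" using step_bound by (auto simp: \<delta>_def)
  obtain \<eta> where eta: "t i < \<eta>" "\<eta> < t (Suc i)" "t (Suc i) powr r - t i powr r = (t (Suc i) - t i) * (r * \<eta> powr (r - 1))"
    using powr_mvt[OF t_pos t_less] by blast
  have eta0: "\<eta> > 0" using eta t_pos[of i] by linarith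
  have h: "h = r * \<delta> * \<eta> powr (r - 1)" using eta(3) by (simp add: h_def \<phi>_def t_Suc \<delta>_def)
  have h0: "h > 0" using phi_less[of i] by (simp add: h_def)
  show ?thesis
  proof (intro disjI1, unfold fine_cell_def h_def[symmetric], intro ballI conjI)
    fix z assume z: "z \<in> {\<phi> i..\<phi> (Suc i)}"
    define X where "X = sqrt \<epsilon> + \<bar>z\<bar>"
    obtain s where s: "t i \<le> s" "s \<le> t (Suc i)" "X = s powr r" "X \<le> 2" "0 < X"
       "\<And>q. X powr q = s powr (r * q)"
      using cell_param[OF i z] unfolding X_def by metis
    have s0: "s > 0" using s(1) t_pos[of i] by linarith
    have W0: "W \<epsilon> z \<ge> 0" using eps by (simp add: W_def)
    have es: "\<eta> \<le> 2 * s" "s / 2 \<le> \<eta>" using eta s True by linarith+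
    have "\<eta> powr (r - 1) \<le> (2 * s) powr (r - 1)" using es eta0 r_ge by (intro powr_mono2) auto
    also have "\<dots> = 2 powr (r - 1) * X powr (1 - \<alpha>)"
      using s0 s(6)[of "1 - \<alpha>"] r_ge by (simp add: powr_mult right_diff_distrib)
    also have "2 powr (r - 1) = P / 2" by (simp add: P_def powr_diff)
    finally have "h \<le> (2 * r / real N) * (P / 2 * X powr (1 - \<alpha>))"
      unfolding h using d r_ge by (intro mult_mono) auto
    also have "\<dots> = r * P / real N * X powr (1 - \<alpha>)" by simp
    finally have hX: "h \<le> r * P / real N * X powr (1 - \<alpha>)" .
    have "h^2 \<le> (r * P / real N * X powr (1 - \<alpha>))^2" using hX h0 by (intro power_mono) auto
    also have "\<dots> = r^2 * P^2 / (real N)^2 * X powr (2 - 2 * \<alpha>)"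
      using s(5) by (simp add: power_mult_distrib power_divide powr_power mult.commute[of 2] algebra_simps)
    also have "\<dots> \<le> r^2 * P^2 / (real N)^2 * (2 * W \<epsilon> z)"
      using powr_le_W[OF eps(1), of z "2 - 2 * \<alpha>"] s(4) alpha by (intro mult_left_mono) (auto simp: X_def)
    finally have hh: "h^2 \<le> (2 * r^2 * P^2) / (real N)^2 * W \<epsilon> z" by (simp add: mult_ac)
    have K1: "2 * r^2 * P^2 \<le> Kg" "2 * r * P \<le> Kg" "2 * r^2 * P ^ 3 \<le> Kg" "16 * r^2 * P ^ 3 \<le> Kg"
      using Kg_ge[of 2 2 2] Kg_ge[of 2 1 1] Kg_ge[of 2 2 3] r_ge by (auto simp: P_def Kg_def)
    have "(2 * r^2 * P^2) / (real N)^2 * W \<epsilon> z \<le> Kg / (real N)^2 * W \<epsilon> z"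
      using K1(1) W0 by (intro mult_right_mono divide_right_mono) auto
    then show "h^2 \<le> Kg / (real N)^2 * W \<epsilon> z" using hh by linarith
    have "sqrt \<epsilon> * h \<le> X * (r * P / real N * X powr (1 - \<alpha>))"
      using hX h0 eps s(5) by (intro mult_mono) (auto simp: X_def)
    also have "\<dots> = r * P / real N * (X powr 1 * X powr (1 - \<alpha>))" using s(5) by simp
    also have "\<dots> = r * P / real N * X powr (2 - \<alpha>)" by (subst powr_add[symmetric]) simp
    also have "\<dots> \<le> r * P / real N * (2 * W \<epsilon> z)"
      using powr_le_W[OF eps(1), of z "2 - \<alpha>"] s(4) alpha r_ge P by (intro mult_left_mono) (auto simp: X_def)
    also have "\<dots> = 2 * r * P / real N * W \<epsilon> z" by simp
    also have "\<dots> \<le> Kg / real N * W \<epsilon> z" using K1 W0 by (intro mult_right_mono divide_right_mono) auto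
    finally show "sqrt \<epsilon> * h \<le> Kg / real N * W \<epsilon> z" .
    show "(sqrt \<epsilon> + \<bar>z'\<bar>) * h^2 \<le> Kg / (real N)^2 * ((sqrt \<epsilon> + \<bar>z\<bar>) * W \<epsilon> z)" if z': "z' \<in> {\<phi> i..\<phi> (Suc i)}" for z'
    proof -
      obtain s' where s': "t i \<le> s'" "s' \<le> t (Suc i)" "sqrt \<epsilon> + \<bar>z'\<bar> = s' powr r"
        using cell_param[OF i z'] by metis
      have "s' powr r \<le> (2 * s) powr r" using s' s True t_pos[of i] r_ge by (intro powr_mono2) auto
      also have "\<dots> = P * X" using s0 by (simp add: powr_mult P_def s(3))
      finally have "(sqrt \<epsilon> + \<bar>z'\<bar>) * h^2 \<le> (P * X) * ((2 * r^2 * P^2) / (real N)^2 * W \<epsilon> z)"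
        unfolding s'(3) using hh P s(5) by (intro mult_mono) auto
      also have "\<dots> = (2 * r^2 * P ^ 3) / (real N)^2 * (X * W \<epsilon> z)"
        by (simp add: power2_eq_square power3_eq_cube)
      also have "\<dots> \<le> Kg / (real N)^2 * (X * W \<epsilon> z)"
        using K1 W0 s(5) by (intro mult_right_mono divide_right_mono) auto
      finally show ?thesis by (simp add: X_def)
    qed
    have Hz: "step_sq \<alpha> \<epsilon> N z = (r * \<delta>)^2 * s powr (2 * r - 2)"
          proof -
      have "r * (2 - 2 * \<alpha>) = 2 * r - 2" using r_ge(2) by algebra
      then show ?thesis unfolding step_sq_def kappa \<delta>_def X_def[symmetric] by (simp only: s(6))
    qed
    have "h^2 = (r * \<delta>)^2 * \<eta> powr (2 * r - 2)"
      unfolding h using eta0 by (simp add: power_mult_distrib powr_power algebra_simps)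
    then have "\<bar>h^2 - step_sq \<alpha> \<epsilon> N z\<bar> = (r * \<delta>)^2 * \<bar>\<eta> powr (2 * r - 2) - s powr (2 * r - 2)\<bar>"
      unfolding Hz by (simp add: abs_mult flip: right_diff_distrib)
    also have "\<dots> \<le> (r * \<delta>)^2 * ((2 * r - 2) * (2 * s) powr (2 * r - 2 - 1) * \<bar>\<eta> - s\<bar>)"
      using eta0 s0 es r_ge by (intro mult_left_mono powr_diff_bound) auto
    also have "\<dots> \<le> (r * \<delta>)^2 * ((2 * r) * (2 * s) powr (2 * r - 2 - 1) * \<delta>)"
      using eta s t_Suc[of i] r_ge by (intro mult_left_mono mult_mono) (auto simp: \<delta>_def)
    finally have 1: "\<bar>h^2 - step_sq \<alpha> \<epsilon> N z\<bar> \<le> (r * \<delta>)^2 * ((2 * r) * (2 * s) powr (2 * r - 3) * \<delta>)" by simp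
    have "(s / 2) powr (r - 1) \<le> \<eta> powr (r - 1)" using es s0 r_ge by (intro powr_mono2) auto
    then have hl: "r * \<delta> * (s / 2) powr (r - 1) \<le> h" unfolding h using r_ge d by (intro mult_left_mono) auto
    have "(2 * s) powr (2 * r - 3) = (s / 2) powr (r - 1) * (2 powr (3 * r - 4) * s powr (r - 2))"
    proof -
      have "(s / 2) powr (r - 1) = s powr (r - 1) * 2 powr (1 - r)" using s0
        by (simp add: powr_divide powr_diff)
      then have "(s / 2) powr (r - 1) * (2 powr (3 * r - 4) * s powr (r - 2))
        = (2 powr (1 - r) * 2 powr (3 * r - 4)) * (s powr (r - 1) * s powr (r - 2))" by simp
      also have "\<dots> = 2 powr (2 * r - 3) * s powr (2 * r - 3)" by (simp flip: powr_add add: algebra_simps)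
      finally show ?thesis using s0 by (simp add: powr_mult)
    qed
    then have "(r * \<delta>)^2 * ((2 * r) * (2 * s) powr (2 * r - 3) * \<delta>)
      = (r * \<delta> * (s / 2) powr (r - 1)) * ((2 * r^2 * \<delta>^2) * (2 powr (3 * r - 4) * s powr (r - 2)))"
      by (simp add: power2_eq_square mult_ac)
    also have "\<dots> \<le> h * ((2 * r^2 * (2 / real N)^2) * (P ^ 3 * X powr (1 - 2 * \<alpha>)))"
    proof (intro mult_mono hl power_mono)
      show "2 powr (3 * r - 4) \<le> P ^ 3" unfolding P_def by (simp add: powr_power)
      show "s powr (r - 2) \<le> X powr (1 - 2 * \<alpha>)"
      proof -
        have "r * (1 - 2 * \<alpha>) = r - 2" using r_ge(2) by algebra
        then show ?thesis by (simp only: s(6))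
      qed
    qed (use d r_ge P h0 in auto)
    finally have "\<bar>h^2 - step_sq \<alpha> \<epsilon> N z\<bar> * X \<le> h * ((2 * r^2 * (2 / real N)^2) * (P ^ 3 * X powr (1 - 2 * \<alpha>))) * X"
      using 1 s(5) by (intro mult_right_mono) auto
    also have "\<dots> = (8 * r^2 * P ^ 3) / (real N)^2 * h * (X powr (1 - 2 * \<alpha>) * X powr 1)"
      using s(5) by (simp add: power_divide)
    also have "\<dots> = (8 * r^2 * P ^ 3) / (real N)^2 * h * X powr (2 - 2 * \<alpha>)"
      by (subst powr_add[symmetric]) simp
    also have "\<dots> \<le> (8 * r^2 * P ^ 3) / (real N)^2 * h * (2 * W \<epsilon> z)"
      using powr_le_W[OF eps(1), of z "2 - 2 * \<alpha>"] s(4) alpha h0 P by (intro mult_left_mono) (auto simp: X_def)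
    also have "\<dots> = (16 * r^2 * P ^ 3) / (real N)^2 * (W \<epsilon> z * h)" by simp
    also have "\<dots> \<le> Kg / (real N)^2 * (W \<epsilon> z * h)"
      using K1 W0 h0 by (intro mult_right_mono divide_right_mono) auto
    finally show "\<bar>h^2 - step_sq \<alpha> \<epsilon> N z\<bar> * (sqrt \<epsilon> + \<bar>z\<bar>) \<le> Kg / (real N)^2 * (W \<epsilon> z * h)" by (simp add: X_def)
  qed
next
  case False
  define \<delta> where "\<delta> = D / real N"
  define h where "h = \<phi> (Suc i) - \<phi> i"
  have d: "0 < \<delta>" "\<delta> \<le> 2 / real N" using step_bound by (auto simp: \<delta>_def)
  have lt: "t i < \<delta>" using False t_Suc[of i] by (simp add: \<delta>_def)
  have i0: "i = 0"
  proof (rule ccontr)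
    assume "i \<noteq> 0"
    then have "1 * \<delta> \<le> real i * \<delta>" using d by (intro mult_right_mono) auto
    moreover have "real i * \<delta> \<le> t i" by (simp add: t_def \<delta>_def)
    ultimately show False using lt by simp
  qed
  have "t (Suc i) \<le> 2 * \<delta>" using lt t_Suc[of i] by (simp add: \<delta>_def)
  then have "t (Suc i) powr r \<le> (4 / real N) powr r"
    using d t_pos[of "Suc i"] r_ge by (intro powr_mono2) auto
  also have "\<dots> = (2 powr r)^2 * (1 / real N powr r)"
    using N by (simp add: powr_divide powr_power flip: powr_powr)
  also have "\<dots> \<le> (2 powr r)^2 * (1 / real N powr 4)"
    using N r_ge by (intro mult_left_mono divide_left_mono powr_mono) auto
  also have "\<dots> = (2 powr r)^2 / real N ^ 4" using N by simp
  also have "\<dots> \<le> Kg / real N ^ 4" using Kg_ge[of 1 0 2] r_ge by (intro divide_right_mono) auto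
  finally have b: "t (Suc i) powr r \<le> Kg / real N ^ 4" .
  have X0: "t i powr r \<ge> 0" by simp
  have "2 * t i powr r \<le> 2 powr r * t i powr r"
    using powr_mono[of 1 r "2::real"] r_ge by (intro mult_right_mono) auto
  also have "\<dots> = (2 * t i) powr r" using t_pos[of i] by (simp add: powr_mult)
  also have "\<dots> \<le> t (Suc i) powr r" using False t_pos[of i] r_ge by (intro powr_mono2) auto
  finally have g: "t (Suc i) powr r \<le> 2 * h" by (simp add: h_def \<phi>_def)
  have e: "sqrt \<epsilon> \<le> t (Suc i) powr r" using t0 i0 phi_less[of 0] by (simp add: \<phi>_def)
  have "tiny_cell \<epsilon> Kg N (step_sq \<alpha> \<epsilon> N) (\<phi> i) (\<phi> (Suc i))"
    unfolding tiny_cell_def h_def[symmetric]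
  proof (intro conjI ballI)
    show "h \<le> Kg / real N ^ 4" using b X0 unfolding h_def \<phi>_def by linarith
    show "sqrt \<epsilon> \<le> Kg / real N ^ 4" using e b by linarith
    fix z assume z: "z \<in> {\<phi> i..\<phi> (Suc i)}"
    have z0: "z \<ge> 0" using z phi_mono[of 0 i] phi_0 by auto
    show zh: "sqrt \<epsilon> + \<bar>z\<bar> \<le> 2 * h" using z z0 g by (auto simp: \<phi>_def)
    have W0: "W \<epsilon> z \<ge> 0" using eps by (simp add: W_def)
    have X2: "sqrt \<epsilon> + \<bar>z\<bar> \<le> 2" using cell_param[OF i z] by metis
    have h0: "h > 0" using phi_less[of i] by (simp add: h_def)
    have "\<bar>step_sq \<alpha> \<epsilon> N z\<bar> * (sqrt \<epsilon> + \<bar>z\<bar>) \<le> (8 * r^2 / (real N)^2 * W \<epsilon> z) * (2 * h)"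
      using step_sq_bounds[OF X2] zh eps W0 by (intro mult_mono) auto
    also have "\<dots> = (16 * r^2) / (real N)^2 * (W \<epsilon> z * h)" by simp
    also have "\<dots> \<le> Kg / (real N)^2 * (W \<epsilon> z * h)"
      using Kg_ge[of 16 2 0] r_ge W0 h0 by (intro mult_right_mono divide_right_mono) auto
    finally show "\<bar>step_sq \<alpha> \<epsilon> N z\<bar> * (sqrt \<epsilon> + \<bar>z\<bar>) \<le> Kg / (real N)^2 * (W \<epsilon> z * h)" .
  qed
  then show ?thesis using i0 by simp
qed

lemma W_minus: "W \<epsilon> (- z) = W \<epsilon> z" and step_sq_minus: "step_sq \<alpha> \<epsilon> N (- z) = step_sq \<alpha> \<epsilon> N z"
  by (simp_all add: W_def step_sq_def)

lemma ball_minus_Icc: "(\<forall>z\<in>{- q..- p}. P z) \<longleftrightarrow> (\<forall>z\<in>{p..q::real}. P (- z))"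
proof -
  have e: "{- q..- p} = uminus ` {p..q}" by simp
  show ?thesis unfolding e by blast
qed

text \<open>The mesh is symmetric and the conditions depend on \<open>\<bar>z\<bar>\<close> only.\<close>

lemma cell_reflect:
  "fine_cell \<epsilon> K N (step_sq \<alpha> \<epsilon> N) p q \<Longrightarrow> fine_cell \<epsilon> K N (step_sq \<alpha> \<epsilon> N) (- q) (- p)"
  "tiny_cell \<epsilon> K N (step_sq \<alpha> \<epsilon> N) p q \<Longrightarrow> tiny_cell \<epsilon> K N (step_sq \<alpha> \<epsilon> N) (- q) (- p)"
  unfolding fine_cell_def tiny_cell_def ball_minus_Icc by (simp_all add: W_minus step_sq_minus)

text \<open>The nodes are renumbered from \<open>0\<close> to \<open>2 N\<close>, so that cell \<open>j\<close> lies between \<open>y j\<close> and \<open>y (Suc j)\<close>.\<close>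

definition y :: "nat \<Rightarrow> real" where "y j = mesh \<alpha> \<epsilon> N (int j - int N)"

lemma y_right: "y (N + i) = \<phi> i" using mesh_phi(1)[of i] by (simp add: y_def)

lemma y_left: "i \<le> N \<Longrightarrow> y (N - i) = - \<phi> i" using mesh_phi(2)[of i] by (simp add: y_def of_nat_diff)

theorem mesh_cells:
  "y 0 = -1" "y (2 * N) = 1"
  "j < 2 * N \<Longrightarrow> y j < y (Suc j)"
  "j < 2 * N \<Longrightarrow> 0 \<le> y j \<or> y (Suc j) \<le> 0"
  "j < 2 * N \<Longrightarrow> fine_cell \<epsilon> Kg N (step_sq \<alpha> \<epsilon> N) (y j) (y (Suc j)) \<or>
     ((j = N \<or> Suc j = N) \<and> tiny_cell \<epsilon> Kg N (step_sq \<alpha> \<epsilon> N) (y j) (y (Suc j)))"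
proof -
  show "y 0 = -1" using y_left[of N] phi_N by simp
  show "y (2 * N) = 1" using y_right[of N] phi_N by (simp add: mult_2)
  have *: "y j < y (Suc j) \<and> (0 \<le> y j \<or> y (Suc j) \<le> 0) \<and> (fine_cell \<epsilon> Kg N (step_sq \<alpha> \<epsilon> N) (y j) (y (Suc j)) \<or>
     ((j = N \<or> Suc j = N) \<and> tiny_cell \<epsilon> Kg N (step_sq \<alpha> \<epsilon> N) (y j) (y (Suc j))))" if j: "j < 2 * N" for j
  proof (cases "N \<le> j")
    case True
    define i where "i = j - N"
    have i: "j = N + i" "i < N" using True j by (auto simp: i_def)
    have "y j = \<phi> i" "y (Suc j) = \<phi> (Suc i)" using y_right[of i] y_right[of "Suc i"] i by simp_all
    then show ?thesis using right_cell[OF i(2)] phi_less[of i] phi_mono[of 0 i] phi_0 i by auto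
  next
    case False
    define i where "i = N - Suc j"
    have i: "j = N - Suc i" "Suc j = N - i" "i < N" using False by (auto simp: i_def)
    have e: "y j = - \<phi> (Suc i)" "y (Suc j) = - \<phi> i"
      using y_left[of i] y_left[of "Suc i"] i by simp_all
    have i0: "i = 0 \<Longrightarrow> Suc j = N" using i by simp
    have "fine_cell \<epsilon> Kg N (step_sq \<alpha> \<epsilon> N) (- \<phi> (Suc i)) (- \<phi> i) \<or>
       ((j = N \<or> Suc j = N) \<and> tiny_cell \<epsilon> Kg N (step_sq \<alpha> \<epsilon> N) (- \<phi> (Suc i)) (- \<phi> i))"
      using right_cell[OF i(3)] cell_reflect i0 by blast
    moreover have "\<phi> i \<ge> 0" using phi_mono[of 0 i] phi_0 by simp
    ultimately show ?thesis unfolding e using phi_less[of i] by simp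
  qed
  show "j < 2 * N \<Longrightarrow> y j < y (Suc j)" "j < 2 * N \<Longrightarrow> 0 \<le> y j \<or> y (Suc j) \<le> 0"
    "j < 2 * N \<Longrightarrow> fine_cell \<epsilon> Kg N (step_sq \<alpha> \<epsilon> N) (y j) (y (Suc j)) \<or>
     ((j = N \<or> Suc j = N) \<and> tiny_cell \<epsilon> Kg N (step_sq \<alpha> \<epsilon> N) (y j) (y (Suc j)))" using * by blast+
qed

end

section \<open>Estimates on one mesh cell\<close>

lemma integral_square_le:
  fixes g :: "real \<Rightarrow> real"
  assumes "p \<le> q" "continuous_on {p..q} g"
  shows "(integral {p..q} g)^2 \<le> (q - p) * integral {p..q} (\<lambda>x. (g x)^2)"
proof (cases "p = q")
  case False
  define I where "I = integral {p..q} g"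
  define h where "h = q - p"
  have h: "h > 0" using False assms by (simp add: h_def)
  have c1: "continuous_on {p..q} (\<lambda>x. (g x)^2)" "continuous_on {p..q} (\<lambda>x. 2 * (I / h) * g x)"
    by (intro continuous_intros assms)+
  have "0 \<le> integral {p..q} (\<lambda>x. (g x - I / h)^2)"
    by (intro integral_nonneg integrable_continuous_real continuous_intros assms) auto
  also have "(\<lambda>x. (g x - I / h)^2) = (\<lambda>x. ((g x)^2 - 2 * (I / h) * g x) + (I / h)^2)"
    by (simp add: power2_eq_square algebra_simps)
  also have "integral {p..q} \<dots> = integral {p..q} (\<lambda>x. (g x)^2) - 2 * (I / h) * I + h * (I / h)^2"
    by (simp only: integral_add_continuous[OF continuous_on_diff[OF c1] continuous_on_const] integral_diff_continuous[OF c1] integral_mult_right)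
       (use assms in \<open>simp add: I_def h_def\<close>)
  also have "\<dots> = integral {p..q} (\<lambda>x. (g x)^2) - I^2 / h" using h by (simp add: power2_eq_square field_simps)
  finally show ?thesis using h by (simp add: I_def h_def field_simps)
qed simp

lemma square_increment_le:
  fixes g g' :: "real \<Rightarrow> real"
  assumes d: "\<And>x. x \<in> {p..q} \<Longrightarrow> (g has_real_derivative g' x) (at x within {p..q})"
    and c: "continuous_on {p..q} g'" and xy: "x \<in> {p..q}" "y \<in> {p..q}"
  shows "(g x - g y)^2 \<le> (q - p) * integral {p..q} (\<lambda>x. (g' x)^2)"
proof -
  have *: "(g y - g x)^2 \<le> (q - p) * integral {p..q} (\<lambda>x. (g' x)^2)"
    if xy: "x \<in> {p..q}" "y \<in> {p..q}" "x \<le> y" for x y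
  proof -
    have sub: "{x..y} \<subseteq> {p..q}" using xy by auto
    have cs: "continuous_on {x..y} g'" using c sub by (rule continuous_on_subset)
    have "(g' has_integral g y - g x) {x..y}"
      by (rule ftc_has_integral[OF xy(3)]) (use sub in \<open>blast intro: DERIV_subset[OF d]\<close>)
    then have "(g y - g x)^2 = (integral {x..y} g')^2" by (simp add: integral_unique)
    also have "\<dots> \<le> (y - x) * integral {x..y} (\<lambda>x. (g' x)^2)" by (rule integral_square_le[OF xy(3) cs])
    also have "\<dots> \<le> (q - p) * integral {p..q} (\<lambda>x. (g' x)^2)"
      using xy c cs by (intro mult_mono integral_subset_le sub integrable_continuous_real continuous_intros integral_nonneg) auto
    finally show ?thesis .
  qed
  then show ?thesis using *[of x y] *[of y x] xy by (cases "x \<le> y") (auto simp: power2_commute)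
qed

text \<open>The mean value term of \<open>v0 + r (x - p)\<close> only increases the norm beyond that of its linear part.\<close>

lemma linear_inverse_inequality:
  fixes p q v0 r :: real
  assumes "p \<le> q"
  shows "r^2 * (q - p) ^ 3 \<le> 12 * integral {p..q} (\<lambda>x. (v0 + r * (x - p))^2)"
proof -
  define h where "h = q - p"
  define F where "F = (\<lambda>x. v0^2 * (x - p) + v0 * r * (x - p)^2 + r^2 / 3 * (x - p) ^ 3)"
  have "((\<lambda>x. (v0 + r * (x - p))^2) has_integral F q - F p) {p..q}"
    by (rule ftc_has_integral[OF assms])
      (auto simp: F_def power2_eq_square power3_eq_cube algebra_simps intro!: derivative_eq_intros)
  then have "integral {p..q} (\<lambda>x. (v0 + r * (x - p))^2) = v0^2 * h + v0 * r * h^2 + r^2 / 3 * h ^ 3"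
    by (simp add: F_def h_def integral_unique)
  moreover have "12 * (v0^2 * h + v0 * r * h^2 + r^2 / 3 * h ^ 3) - r^2 * h ^ 3 = 12 * h * (v0 + r * h / 2)^2"
    by (simp add: power2_eq_square power3_eq_cube algebra_simps)
  moreover have "12 * h * (v0 + r * h / 2)^2 \<ge> 0" using assms by (simp add: h_def)
  ultimately show ?thesis by (simp add: h_def)
qed

lemma young_ineq:
  fixes x y \<theta> :: real
  assumes "\<theta> > 0"
  shows "\<bar>x * y\<bar> \<le> \<theta> * x^2 + y^2 / (4 * \<theta>)"
proof -
  have "0 \<le> (2 * \<theta> * \<bar>x\<bar> - \<bar>y\<bar>)^2 / (4 * \<theta>)" using assms by simp
  also have "\<dots> = \<theta> * x^2 + y^2 / (4 * \<theta>) - \<bar>x * y\<bar>"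
    using assms by (simp add: power2_diff abs_mult field_simps power2_eq_square)
  finally show ?thesis by simp
qed

lemma integral_abs_le:
  fixes f g :: "real \<Rightarrow> real"
  assumes "continuous_on {p..q} f" "continuous_on {p..q} g" "\<And>x. x \<in> {p..q} \<Longrightarrow> \<bar>f x\<bar> \<le> g x"
  shows "\<bar>integral {p..q} f\<bar> \<le> integral {p..q} g"
proof -
  have "integral {p..q} f \<le> integral {p..q} g"
    using assms by (intro integral_mono_continuous) (auto dest: abs_le_D1)
  moreover have "integral {p..q} (\<lambda>x. - f x) \<le> integral {p..q} g"
    using assms by (intro integral_mono_continuous continuous_intros) (auto dest: abs_le_D2)
  ultimately show ?thesis by (simp add: abs_le_iff)
qed

text \<open>One cell \<open>[p, q]\<close> with the solution, the coefficient \<open>a\<close> and a model \<open>H\<close> of the squared step size.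
\<open>H\<close> enters through bounds of its size and of its derivative, both in terms of the weight \<open>W\<close>.\<close>

locale cell_solution =
  fixes p q \<epsilon> K M B :: real and N :: nat and H H' a a1 u u1 u2 u3 :: "real \<Rightarrow> real"
  assumes pq: "p < q" and eps: "\<epsilon> > 0" and N: "N \<ge> 1" and KMB: "K > 0" "M > 0" "B > 0"
    and du: "\<And>x. x \<in> {p..q} \<Longrightarrow> (u has_real_derivative u1 x) (at x within {p..q})"
    and du1: "\<And>x. x \<in> {p..q} \<Longrightarrow> (u1 has_real_derivative u2 x) (at x within {p..q})"
    and du2: "\<And>x. x \<in> {p..q} \<Longrightarrow> (u2 has_real_derivative u3 x) (at x within {p..q})"
    and da: "\<And>x. x \<in> {p..q} \<Longrightarrow> (a has_real_derivative a1 x) (at x within {p..q})"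
    and dH: "\<And>x. x \<in> {p..q} \<Longrightarrow> (H has_real_derivative H' x) (at x within {p..q})"
    and cu3: "continuous_on {p..q} u3" and ca1: "continuous_on {p..q} a1" and cH': "continuous_on {p..q} H'"
    and bu: "\<And>x. x \<in> {p..q} \<Longrightarrow> \<bar>u x\<bar> \<le> M"
    and ba: "\<And>x. x \<in> {p..q} \<Longrightarrow> \<bar>a x\<bar> \<le> B * \<bar>x\<bar>"
    and ba1: "\<And>x. x \<in> {p..q} \<Longrightarrow> \<bar>a1 x\<bar> \<le> B"
    and bH: "\<And>x. x \<in> {p..q} \<Longrightarrow> \<bar>H x\<bar> \<le> K / (real N)^2 * W \<epsilon> x"
    and bH': "\<And>x. x \<in> {p..q} \<Longrightarrow> \<bar>H' x\<bar> * (sqrt \<epsilon> + \<bar>x\<bar>) \<le> K / (real N)^2 * W \<epsilon> x"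
begin

text \<open>\<open>s\<close> and \<open>e\<close> are the slope and the error of the linear interpolant; \<open>A1\<close>, \<open>A2\<close>, \<open>A3\<close> are the shares of the
cell in the weighted integrals.\<close>

abbreviation X :: "real \<Rightarrow> real" where "X x \<equiv> sqrt \<epsilon> + \<bar>x\<bar>"

definition h where "h = q - p"
definition s where "s = (u q - u p) / (q - p)"
definition e where "e x = u x - (u p + s * (x - p))"
definition A1 where "A1 = integral {p..q} (\<lambda>x. X x * (u1 x)^2)"
definition A2 where "A2 = integral {p..q} (\<lambda>x. X x ^ 3 * (u2 x)^2)"
definition A3 where "A3 = integral {p..q} (\<lambda>x. X x ^ 5 * (u3 x)^2)"

lemma h_pos: "h > 0" using pq by (simp add: h_def)

lemma conts: "continuous_on {p..q} u" "continuous_on {p..q} u1" "continuous_on {p..q} u2"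
  "continuous_on {p..q} a" "continuous_on {p..q} H"
  using DERIV_continuous_on[OF du] DERIV_continuous_on[OF du1] DERIV_continuous_on[OF du2]
    DERIV_continuous_on[OF da] DERIV_continuous_on[OF dH] by blast+

lemma ce: "continuous_on {p..q} e" unfolding e_def by (intro continuous_intros conts)

lemma cW: "continuous_on {p..q} (W \<epsilon>)" unfolding W_def by (intro continuous_intros)

lemma X_pos: "X x > 0" using eps by (intro add_pos_nonneg) auto

lemma W_nonneg: "W \<epsilon> x \<ge> 0" using X_pos[of x] by (simp add: W_def)

lemma W_sq: "(W \<epsilon> x)^2 = X x ^ 3" "(X x * W \<epsilon> x)^2 = X x ^ 5"
  using X_pos[of x] by (simp_all add: W_def power_mult_distrib) (simp_all add: power_numeral_reduce)

lemma e_ends: "e p = 0" "e q = 0" using pq by (auto simp: e_def s_def)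

lemma de: "x \<in> {p..q} \<Longrightarrow> (e has_real_derivative u1 x - s) (at x within {p..q})"
proof -
  assume x: "x \<in> {p..q}"
  have "((\<lambda>x. u p + s * (x - p)) has_real_derivative s) (at x within {p..q})"
    by (auto intro!: derivative_eq_intros)
  then show ?thesis unfolding e_def[abs_def] by (intro DERIV_diff du x)
qed

lemma A_nonneg: "A1 \<ge> 0" "A2 \<ge> 0" "A3 \<ge> 0"
proof -
  have *: "integral {p..q} (\<lambda>x. X x ^ k * (w x)^2) \<ge> 0" if "continuous_on {p..q} w" for k w
  proof (intro integral_nonneg integrable_continuous_real continuous_intros that)
    fix x show "X x ^ k * (w x)^2 \<ge> 0" using less_imp_le[OF X_pos[of x]] by simp
  qed
  show "A1 \<ge> 0" "A2 \<ge> 0" "A3 \<ge> 0"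
    using *[OF conts(2), of 1] *[OF conts(3), of 3] *[OF cu3, of 5] by (simp_all add: A1_def A2_def A3_def)
qed

lemma a_le_X: "x \<in> {p..q} \<Longrightarrow> \<bar>a x\<bar> \<le> B * X x"
proof -
  assume x: "x \<in> {p..q}"
  have "B * \<bar>x\<bar> \<le> B * X x" using eps KMB by (intro mult_left_mono) auto
  then show ?thesis using ba[OF x] by linarith
qed

lemma e'_sq_le: "x \<in> {p..q} \<Longrightarrow> (u1 x - s)^2 \<le> h * integral {p..q} (\<lambda>x. (u2 x)^2)"
proof -
  assume x: "x \<in> {p..q}"
  have at: "(u has_real_derivative u1 z) (at z)" if "p < z" "z < q" for z
    using du[of z] that at_within_interior[of z "{p..q}"] by (simp add: interior_atLeastAtMost_real)
  have "\<exists>l z. z > p \<and> z < q \<and> (u has_real_derivative l) (at z) \<and> u q - u p = (q - p) * l"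
    by (rule MVT[OF pq conts(1)]) (use at in \<open>auto simp: real_differentiable_def\<close>)
  then obtain l z where z: "z > p" "z < q" "(u has_real_derivative l) (at z)" "u q - u p = (q - p) * l" by auto
  have "l = u1 z" using z(3) at[OF z(1,2)] DERIV_unique by blast
  then have "s = u1 z" using z(4) pq by (simp add: s_def)
  then show ?thesis using square_increment_le[OF du1 conts(3) x, of z] z by (simp add: h_def)
qed

lemma e'_integral: "integral {p..q} (\<lambda>x. (u1 x - s)^2) \<le> h^2 * integral {p..q} (\<lambda>x. (u2 x)^2)"
proof -
  have "integral {p..q} (\<lambda>x. (u1 x - s)^2) \<le> integral {p..q} (\<lambda>x. h * integral {p..q} (\<lambda>x. (u2 x)^2))"
    by (intro integral_mono_continuous continuous_intros conts e'_sq_le)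
  then show ?thesis using pq by (simp add: h_def power2_eq_square mult_ac)
qed

lemma e_integral: "integral {p..q} (\<lambda>x. (e x)^2) \<le> h ^ 4 * integral {p..q} (\<lambda>x. (u2 x)^2)"
proof -
  let ?J = "integral {p..q} (\<lambda>x. (u2 x)^2)"
  have J: "?J \<ge> 0" by (intro integral_nonneg integrable_continuous_real continuous_intros conts) auto
  have b: "(e x)^2 \<le> h ^ 3 * ?J" if x: "x \<in> {p..q}" for x
  proof -
    have "(e x - e p)^2 \<le> h * integral {p..q} (\<lambda>x. (u1 x - s)^2)"
      unfolding h_def by (rule square_increment_le[OF de]) (use x in \<open>auto intro!: continuous_intros conts\<close>)
    also have "\<dots> \<le> h * (h^2 * ?J)" using e'_integral h_pos by (intro mult_left_mono) auto
    finally show ?thesis by (simp add: e_ends power2_eq_square power3_eq_cube mult_ac)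
  qed
  have "integral {p..q} (\<lambda>x. (e x)^2) \<le> integral {p..q} (\<lambda>x. h ^ 3 * ?J)"
    by (intro integral_mono_continuous continuous_intros ce b)
  then show ?thesis using pq by (simp add: h_def power_numeral_reduce mult_ac)
qed

definition Q where "Q x = (x - p) ^ 3 / 6 - h * (x - p)^2 / 4 + h^2 * (x - p) / 12"

lemma Q_cont: "continuous_on {p..q} Q" unfolding Q_def by (intro continuous_intros) auto

lemma Q_bound: "x \<in> {p..q} \<Longrightarrow> \<bar>Q x\<bar> \<le> h ^ 3"
proof -
  assume x: "x \<in> {p..q}"
  define w where "w = x - p"
  have w: "0 \<le> w" "w \<le> h" using x by (auto simp: w_def h_def)
  have "w ^ 3 \<le> h ^ 3" using w by (intro power_mono) auto
  moreover have "h * w^2 \<le> h * h^2" using w by (intro mult_left_mono power_mono) auto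
  moreover have "h^2 * w \<le> h^2 * h" using w by (intro mult_left_mono) auto
  moreover have "0 \<le> w ^ 3" "0 \<le> h * w^2" "0 \<le> h^2 * w" using w by auto
  moreover have "h * h^2 = h ^ 3" "h^2 * h = h ^ 3" by (simp_all add: power2_eq_square power3_eq_cube)
  ultimately have l: "0 \<le> w ^ 3" "w ^ 3 \<le> h ^ 3" "0 \<le> h * w^2" "h * w^2 \<le> h ^ 3" "0 \<le> h^2 * w" "h^2 * w \<le> h ^ 3"
    by simp_all
  have "\<bar>w1 / 6 - w2 / 4 + w3 / 12\<bar> \<le> d"
    if "0 \<le> w1" "w1 \<le> d" "0 \<le> w2" "w2 \<le> d" "0 \<le> w3" "w3 \<le> d" for w1 w2 w3 d :: real
    using that by linarith
  from this[OF l] show ?thesis by (simp add: Q_def w_def)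
qed

text \<open>The kernel \<open>P\<close> is the quadratic with \<open>P'' = 1\<close> vanishing at both ends, so \<open>\<integral> e = \<integral> u'' P\<close>; and \<open>Q\<close> is the
primitive of \<open>P - mean P = P + h\<^sup>2/12\<close> vanishing at both ends. Thus the mean of the interpolation error
is \<open>- h\<^sup>2/12\<close> times that of \<open>u''\<close>, up to a term with \<open>u'''\<close> that is smaller by one power of \<open>h\<close>.\<close>

lemma interpolation_error_identity:
  "integral {p..q} (\<lambda>x. e x + h^2 / 12 * u2 x + u3 x * Q x) = 0"
proof -
  define P P' where "P = (\<lambda>x. (x - p) * (x - q) / 2)" "P' = (\<lambda>x. (x - p) - h / 2)"
  define F where "F = (\<lambda>x. e x * P' x - (u1 x - s) * P x + u2 x * Q x)"
  have "((\<lambda>x. e x + h^2 / 12 * u2 x + u3 x * Q x) has_integral F q - F p) {p..q}"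
  proof (rule ftc_has_integral)
    fix x assume x: "x \<in> {p..q}"
    have dP: "(P has_real_derivative P' x) (at x within {p..q})"
      unfolding P_P'_def h_def by (auto intro!: derivative_eq_intros simp: field_simps)
    have dP': "(P' has_real_derivative 1) (at x within {p..q})"
      unfolding P_P'_def by (auto intro!: derivative_eq_intros)
    have dQ: "(Q has_real_derivative P x + h^2 / 12) (at x within {p..q})"
      unfolding Q_def[abs_def] P_P'_def h_def
      by (auto intro!: derivative_eq_intros simp: power2_eq_square field_simps)
    have d1: "((\<lambda>x. u1 x - s) has_real_derivative u2 x - 0) (at x within {p..q})"
      by (intro DERIV_diff du1 x DERIV_const)
    have "(F has_real_derivative ((u1 x - s) * P' x + 1 * e x) - ((u2 x - 0) * P x + P' x * (u1 x - s))
         + (u3 x * Q x + (P x + h^2 / 12) * u2 x)) (at x within {p..q})"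
      unfolding F_def by (intro DERIV_add DERIV_diff DERIV_mult de du2 x dP dP' dQ d1)
    then show "(F has_real_derivative e x + h^2 / 12 * u2 x + u3 x * Q x) (at x within {p..q})"
      by (simp add: algebra_simps)
  qed (use pq in auto)
  moreover have "Q q = 0" by (simp add: Q_def flip: h_def) (simp add: power_numeral_reduce field_simps)
  then have "F q - F p = 0" by (simp add: F_def e_ends P_P'_def Q_def)
  ultimately show ?thesis by (simp add: integral_unique)
qed

lemma fine_h4:
  assumes "fine_cell \<epsilon> K N H p q"
  shows "h ^ 4 * integral {p..q} (\<lambda>x. (u2 x)^2) \<le> K^2 / real N ^ 4 * A2"
    "\<epsilon> * h^2 * integral {p..q} (\<lambda>x. (u2 x)^2) \<le> K^2 / (real N)^2 * A2"
proof -
  have *: "k^2 * integral {p..q} (\<lambda>x. (u2 x)^2) \<le> k'^2 * A2"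
    if "\<And>x. x \<in> {p..q} \<Longrightarrow> k \<le> k' * W \<epsilon> x" "0 \<le> k" for k k'
  proof -
    have "integral {p..q} (\<lambda>x. k^2 * (u2 x)^2) \<le> integral {p..q} (\<lambda>x. k'^2 * (X x ^ 3 * (u2 x)^2))"
    proof (intro integral_mono_continuous continuous_intros conts)
      fix x assume "x \<in> {p..q}"
      then have "k^2 \<le> (k' * W \<epsilon> x)^2" using that by (intro power_mono) auto
      then have "k^2 \<le> k'^2 * X x ^ 3" by (simp add: power_mult_distrib W_sq)
      then show "k^2 * (u2 x)^2 \<le> k'^2 * (X x ^ 3 * (u2 x)^2)"
        unfolding mult.assoc[symmetric] by (intro mult_right_mono) auto
    qed
    then show ?thesis by (simp add: A2_def)
  qed
  have "(h^2)^2 * integral {p..q} (\<lambda>x. (u2 x)^2) \<le> (K / (real N)^2)^2 * A2"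
    by (rule *) (use assms in \<open>auto simp: fine_cell_def h_def\<close>)
  then show "h ^ 4 * integral {p..q} (\<lambda>x. (u2 x)^2) \<le> K^2 / real N ^ 4 * A2" by (simp add: power_divide)
  have "(sqrt \<epsilon> * h)^2 * integral {p..q} (\<lambda>x. (u2 x)^2) \<le> (K / real N)^2 * A2"
    by (rule *) (use assms eps h_pos in \<open>auto simp: fine_cell_def h_def\<close>)
  then show "\<epsilon> * h^2 * integral {p..q} (\<lambda>x. (u2 x)^2) \<le> K^2 / (real N)^2 * A2"
    using eps by (simp add: power_divide power_mult_distrib)
qed

lemma e_bound: "x \<in> {p..q} \<Longrightarrow> \<bar>e x\<bar> \<le> 2 * M"
proof -
  assume x: "x \<in> {p..q}"
  define w where "w = (x - p) / h"
  have w: "0 \<le> w" "w \<le> 1" using x h_pos by (auto simp: w_def h_def)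
  have "s * (x - p) = w * (u q - u p)" by (simp add: s_def w_def h_def)
  then have "u p + s * (x - p) = (1 - w) * u p + w * u q" by (simp add: algebra_simps)
  then have "e x = u x - ((1 - w) * u p + w * u q)" by (simp add: e_def)
  moreover have "\<bar>(1 - w) * u p\<bar> \<le> (1 - w) * M" "\<bar>w * u q\<bar> \<le> w * M"
    using w bu[of p] bu[of q] pq by (auto intro!: abs_mult_le)
  moreover have "(1 - w) * M = M - w * M" by (simp add: algebra_simps)
  ultimately show ?thesis using bu[OF x] unfolding abs_le_iff by linarith
qed

text \<open>On a tiny cell the error is merely bounded by \<open>2 M\<close>, and the length of the cell supplies \<open>N\<^bsup>-4\<^esup>\<close>; the
parameter \<open>\<delta>\<close> counts such cells.\<close>

lemma interpolation_L2:
  assumes "fine_cell \<epsilon> K N H p q \<or> (\<delta> = 1 \<and> tiny_cell \<epsilon> K N H p q)" "\<delta> \<ge> 0"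
  shows "integral {p..q} (\<lambda>x. (e x)^2) \<le> (K^2 + 4 * M^2 * K) / real N ^ 4 * (A2 + \<delta>)"
proof -
  have f: "(K^2 + 4 * M^2 * K) / real N ^ 4 * (A2 + \<delta>) \<ge> K^2 / real N ^ 4 * A2"
    using A_nonneg assms(2) KMB by (intro mult_mono divide_right_mono) auto
  from assms(1) show ?thesis
  proof
    assume "fine_cell \<epsilon> K N H p q"
    then show ?thesis using fine_h4(1) e_integral f by linarith
  next
    assume t: "\<delta> = 1 \<and> tiny_cell \<epsilon> K N H p q"
    have "integral {p..q} (\<lambda>x. (e x)^2) \<le> integral {p..q} (\<lambda>x. (2 * M)^2)"
      using e_bound by (intro integral_mono_continuous continuous_intros ce square_of_bound)
    also have "\<dots> = 4 * M^2 * h" using pq by (simp add: h_def)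
    also have "\<dots> \<le> 4 * M^2 * (K / real N ^ 4)" using t by (intro mult_left_mono) (auto simp: tiny_cell_def h_def)
    also have "\<dots> = (4 * M^2 * K) / real N ^ 4 * \<delta>" using t by simp
    also have "\<dots> \<le> (K^2 + 4 * M^2 * K) / real N ^ 4 * (A2 + \<delta>)"
      using A_nonneg assms(2) KMB by (intro mult_mono divide_right_mono) auto
    finally show ?thesis .
  qed
qed

text \<open>On a tiny cell the derivative of the interpolant is the mean of \<open>u'\<close>, hence does not increase the
norm, and \<open>\<epsilon> u'\<^sup>2 \<le> sqrt \<epsilon> (sqrt \<epsilon> + \<bar>x\<bar>) u'\<^sup>2\<close> with a small \<open>sqrt \<epsilon>\<close>.\<close>

lemma interpolation_energy:
  assumes "fine_cell \<epsilon> K N H p q \<or> (\<delta> = (1::real) \<and> tiny_cell \<epsilon> K N H p q)"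
  shows "\<epsilon> * integral {p..q} (\<lambda>x. (u1 x - s)^2) \<le> (K^2 + K) / (real N)^2 * (A1 + A2)"
  using assms
proof
  assume "fine_cell \<epsilon> K N H p q"
  then have "\<epsilon> * h^2 * integral {p..q} (\<lambda>x. (u2 x)^2) \<le> K^2 / (real N)^2 * A2" by (rule fine_h4)
  moreover have "\<epsilon> * integral {p..q} (\<lambda>x. (u1 x - s)^2) \<le> \<epsilon> * (h^2 * integral {p..q} (\<lambda>x. (u2 x)^2))"
    using e'_integral eps by (intro mult_left_mono) auto
  moreover have "K^2 / (real N)^2 * A2 \<le> (K^2 + K) / (real N)^2 * (A1 + A2)"
    using A_nonneg KMB by (intro mult_mono divide_right_mono) auto
  ultimately show ?thesis by linarith
next
  assume t: "\<delta> = 1 \<and> tiny_cell \<epsilon> K N H p q"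
  have iu: "integral {p..q} u1 = s * h"
    using ftc_has_integral[OF _ du] pq by (simp add: integral_unique s_def h_def)
  have c1: "continuous_on {p..q} (\<lambda>x. (u1 x)^2)" "continuous_on {p..q} (\<lambda>x. 2 * s * u1 x)"
    by (intro continuous_intros conts)+
  have "integral {p..q} (\<lambda>x. (u1 x - s)^2) = integral {p..q} (\<lambda>x. ((u1 x)^2 - 2 * s * u1 x) + s^2)"
    by (simp add: power2_eq_square algebra_simps)
  also have "\<dots> = integral {p..q} (\<lambda>x. (u1 x)^2) - 2 * s * (s * h) + h * s^2"
    by (simp only: integral_add_continuous[OF continuous_on_diff[OF c1] continuous_on_const] integral_diff_continuous[OF c1] integral_mult_right iu)
       (use pq in \<open>simp add: h_def\<close>)
  also have "\<dots> = integral {p..q} (\<lambda>x. (u1 x)^2) - h * s^2" by (simp add: power2_eq_square algebra_simps)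
  also have "\<dots> \<le> integral {p..q} (\<lambda>x. (u1 x)^2)" using h_pos by simp
  finally have "\<epsilon> * integral {p..q} (\<lambda>x. (u1 x - s)^2) \<le> sqrt \<epsilon> * (sqrt \<epsilon> * integral {p..q} (\<lambda>x. (u1 x)^2))"
    using eps by (simp flip: mult.assoc)
  also have "\<dots> \<le> sqrt \<epsilon> * A1"
  proof (intro mult_left_mono)
    have "integral {p..q} (\<lambda>x. sqrt \<epsilon> * (u1 x)^2) \<le> A1" unfolding A1_def
      using eps by (intro integral_mono_continuous continuous_intros conts mult_right_mono) auto
    then show "sqrt \<epsilon> * integral {p..q} (\<lambda>x. (u1 x)^2) \<le> A1" by simp
  qed (use eps in auto)
  also have "\<dots> \<le> K / real N ^ 4 * A1" using t A_nonneg by (intro mult_right_mono) (auto simp: tiny_cell_def)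
  also have "\<dots> \<le> (K^2 + K) / (real N)^2 * (A1 + A2)"
  proof (intro mult_mono frac_le)
    show "(real N)^2 \<le> real N ^ 4" using N by (intro power_increasing) auto
  qed (use A_nonneg KMB N in auto)
  finally show ?thesis .
qed

text \<open>The two quantities to which all error terms are reduced; their squares integrate to multiples of
\<open>A2\<close> and \<open>A3\<close>.\<close>

definition Zf where "Zf x = K / (real N)^2 * (W \<epsilon> x * \<bar>u2 x\<bar>)"
definition Yf where "Yf x = K / (real N)^2 * (X x * W \<epsilon> x * \<bar>u3 x\<bar>)"

lemma ZY_cont: "continuous_on {p..q} Zf" "continuous_on {p..q} Yf"
  unfolding Zf_def Yf_def by (intro continuous_intros conts cW cu3)+

lemma ZY_int: "integral {p..q} (\<lambda>x. (Zf x)^2) = K^2 / real N ^ 4 * A2"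
   "integral {p..q} (\<lambda>x. (Yf x)^2) = K^2 / real N ^ 4 * A3"
proof -
  have "(Zf x)^2 = K^2 / real N ^ 4 * (X x ^ 3 * (u2 x)^2)" for x
    unfolding Zf_def power_mult_distrib W_sq power_divide by simp
  then show "integral {p..q} (\<lambda>x. (Zf x)^2) = K^2 / real N ^ 4 * A2" by (simp only: A2_def integral_mult_right)
  have "(Yf x)^2 = K^2 / real N ^ 4 * (X x ^ 5 * (u3 x)^2)" for x
    unfolding Yf_def power_mult_distrib[of "X x * W \<epsilon> x"] power_mult_distrib[of "K / (real N)^2"] W_sq power_divide by simp
  then show "integral {p..q} (\<lambda>x. (Yf x)^2) = K^2 / real N ^ 4 * A3" by (simp only: A3_def integral_mult_right)
qed

text \<open>Pointwise Young inequality, integrated. In every application \<open>w\<close> is either the discrete error or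
its slope times \<open>h\<close>, so that the first term on the right can be absorbed.\<close>

lemma young_integral:
  fixes G g1 g2 g3 w :: "real \<Rightarrow> real"
  assumes th: "\<theta> > 0" and k: "k \<ge> 0"
    and c: "continuous_on {p..q} G" "continuous_on {p..q} g1" "continuous_on {p..q} g2" "continuous_on {p..q} g3"
       "continuous_on {p..q} w"
    and b: "\<And>x. x \<in> {p..q} \<Longrightarrow> \<bar>G x\<bar> \<le> \<bar>w x\<bar> * (k * (g1 x + g2 x + g3 x))"
    and nn: "\<And>x. x \<in> {p..q} \<Longrightarrow> 0 \<le> g1 x + g2 x + g3 x"
  shows "\<bar>integral {p..q} G\<bar> \<le> \<theta> * integral {p..q} (\<lambda>x. (w x)^2)
     + k^2 / \<theta> * (integral {p..q} (\<lambda>x. (g1 x)^2) + integral {p..q} (\<lambda>x. (g2 x)^2) + integral {p..q} (\<lambda>x. (g3 x)^2))"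
proof -
  have c2: "continuous_on {p..q} (\<lambda>x. (w x)^2)" "continuous_on {p..q} (\<lambda>x. (g1 x)^2)"
     "continuous_on {p..q} (\<lambda>x. (g2 x)^2)" "continuous_on {p..q} (\<lambda>x. (g3 x)^2)"
    by (intro continuous_intros c)+
  have "\<bar>integral {p..q} G\<bar> \<le> integral {p..q} (\<lambda>x. \<theta> * (w x)^2 + k^2 / \<theta> * ((g1 x)^2 + (g2 x)^2 + (g3 x)^2))"
  proof (intro integral_abs_le c continuous_intros)
    fix x assume x: "x \<in> {p..q}"
    let ?g = "g1 x + g2 x + g3 x"
    have "\<bar>G x\<bar> \<le> \<bar>w x * (k * ?g)\<bar>" using b[OF x] nn[OF x] k by (simp add: abs_mult)
    also have "\<dots> \<le> \<theta> * (w x)^2 + (k * ?g)^2 / (4 * \<theta>)" by (rule young_ineq[OF th])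
    also have "(k * ?g)^2 / (4 * \<theta>) = k^2 / \<theta> * (?g^2 / 4)" using th by (simp add: power_mult_distrib)
    also have "\<dots> \<le> k^2 / \<theta> * ((g1 x)^2 + (g2 x)^2 + (g3 x)^2)"
    proof (intro mult_left_mono)
      have "?g^2 \<le> 3 * (g1 x)^2 + 3 * (g2 x)^2 + 3 * (g3 x)^2"
        using zero_le_power2[of "g1 x - g2 x"] zero_le_power2[of "g1 x - g3 x"] zero_le_power2[of "g2 x - g3 x"]
        by (simp add: power2_eq_square algebra_simps)
      then show "?g^2 / 4 \<le> (g1 x)^2 + (g2 x)^2 + (g3 x)^2"
        using zero_le_power2[of "g1 x"] zero_le_power2[of "g2 x"] zero_le_power2[of "g3 x"] by linarith
    qed (use th in auto)
    finally show "\<bar>G x\<bar> \<le> \<theta> * (w x)^2 + k^2 / \<theta> * ((g1 x)^2 + (g2 x)^2 + (g3 x)^2)" by simp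
  qed
  also have "\<dots> = \<theta> * integral {p..q} (\<lambda>x. (w x)^2)
     + k^2 / \<theta> * (integral {p..q} (\<lambda>x. (g1 x)^2) + integral {p..q} (\<lambda>x. (g2 x)^2) + integral {p..q} (\<lambda>x. (g3 x)^2))"
    by (simp only: integral_add_continuous[OF continuous_on_mult_left[OF c2(1)] continuous_on_mult_left[OF continuous_on_add[OF continuous_on_add[OF c2(2,3)] c2(4)]]]
      integral_add_continuous[OF continuous_on_add[OF c2(2,3)] c2(4)] integral_add_continuous[OF c2(2,3)] integral_mult_right)
  finally show ?thesis .
qed

text \<open>The convection term of the interpolation error, tested with a linear function of slope \<open>r\<close>, after
subtraction of its leading part \<open>- (1/12) \<integral> H a u'' r\<close>. Estimated directly, the first integral is only of
order \<open>N\<^bsup>-1\<^esup>\<close>; the leading part is therefore removed here and summed by parts over all cells.\<close>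

definition T where "T r = integral {p..q} (\<lambda>x. r * a x * e x) + integral {p..q} (\<lambda>x. r * (H x * a x * u2 x)) / 12"

text \<open>Freezing \<open>a\<close> at \<open>p\<close> makes \<open>interpolation_error_identity\<close> applicable. What remains carries an additional
factor \<open>h\<close>: from \<open>a - a p\<close>, from \<open>Q\<close>, or from \<open>H - h\<^sup>2\<close>.\<close>

lemma T_fine:
  assumes f: "fine_cell \<epsilon> K N H p q" and th: "\<theta> > 0"
  shows "\<bar>T r\<bar> \<le> \<theta> * (r^2 * h ^ 3) + B^2 * (2 * K^2) / \<theta> / real N ^ 4 * (A2 + A3)"
proof -
  define G where "G = (\<lambda>x. r * (e x * (a x - a p) - a p * (u3 x * Q x) + h^2 / 12 * ((a x - a p) * u2 x)
      + (H x - h^2) * a x * u2 x / 12))"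
  have c1: "continuous_on {p..q} (\<lambda>x. r * a x * e x)" "continuous_on {p..q} (\<lambda>x. r * (H x * a x * u2 x))"
    "continuous_on {p..q} (\<lambda>x. e x + h^2 / 12 * u2 x + u3 x * Q x)"
    by (intro continuous_intros conts ce cu3 Q_cont)+
  have cG: "continuous_on {p..q} G" unfolding G_def by (intro continuous_intros conts ce cu3 Q_cont) auto
  have c2: "continuous_on {p..q} (\<lambda>x. r * a x * e x + 1 / 12 * (r * (H x * a x * u2 x)))"
     "continuous_on {p..q} (\<lambda>x. r * a p * (e x + h^2 / 12 * u2 x + u3 x * Q x))"
    by (intro continuous_on_add continuous_on_mult_left c1)+
  \<comment> \<open>the subtracted integral vanishes by \<open>interpolation_error_identity\<close>\<close>
  have "T r = integral {p..q} (\<lambda>x. r * a x * e x + 1 / 12 * (r * (H x * a x * u2 x)))"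
    unfolding T_def by (simp only: integral_add_continuous[OF c1(1) continuous_on_mult_left[OF c1(2)]] integral_mult_right)
  also have "\<dots> = integral {p..q} (\<lambda>x. r * a x * e x + 1 / 12 * (r * (H x * a x * u2 x)))
     - integral {p..q} (\<lambda>x. r * a p * (e x + h^2 / 12 * u2 x + u3 x * Q x))"
    by (simp only: integral_mult_right interpolation_error_identity)
  also have "\<dots> = integral {p..q} G"
    by (subst integral_diff_continuous[OF c2, symmetric]) (simp add: G_def algebra_simps diff_divide_distrib)
  finally have TG: "T r = integral {p..q} G" .
  have "\<bar>integral {p..q} G\<bar> \<le> \<theta> * integral {p..q} (\<lambda>x. (r * h)^2)
     + B^2 / \<theta> * (integral {p..q} (\<lambda>x. (\<bar>e x\<bar>)^2) + integral {p..q} (\<lambda>x. (Zf x)^2) + integral {p..q} (\<lambda>x. (Yf x)^2))"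
  proof (rule young_integral[OF th])
    fix x assume x: "x \<in> {p..q}"
    have ap: "\<bar>a x - a p\<bar> \<le> B * h"
    proof -
      have "\<bar>a x - a p\<bar> \<le> B * \<bar>x - p\<bar>" by (rule mvt_abs_bound[OF da ba1]) (use x pq in auto)
      also have "\<dots> \<le> B * h" using x KMB by (intro mult_left_mono) (auto simp: h_def)
      finally show ?thesis .
    qed
    have px: "p \<in> {p..q}" using pq by auto
    have hW: "h^2 \<le> K / (real N)^2 * W \<epsilon> x" and hXW: "X p * h^2 \<le> K / (real N)^2 * (X x * W \<epsilon> x)"
      and hH: "\<bar>h^2 - H x\<bar> * X x \<le> K / (real N)^2 * (W \<epsilon> x * h)"
      using f x px unfolding fine_cell_def h_def by blast+
    have 1: "\<bar>e x * (a x - a p)\<bar> \<le> \<bar>e x\<bar> * (B * h)" by (intro abs_mult_le ap order_refl)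
    have 2: "\<bar>a p * (u3 x * Q x)\<bar> \<le> h * (B * Yf x)"
    proof -
      have "\<bar>a p\<bar> \<le> B * X p" by (rule a_le_X[OF px])
      then have "\<bar>a p * (u3 x * Q x)\<bar> \<le> (B * X p) * (\<bar>u3 x\<bar> * h ^ 3)"
        by (intro abs_mult_le Q_bound x order_refl)
      also have "\<dots> = B * h * \<bar>u3 x\<bar> * (X p * h^2)" by (simp add: power2_eq_square power3_eq_cube mult_ac)
      also have "\<dots> \<le> B * h * \<bar>u3 x\<bar> * (K / (real N)^2 * (X x * W \<epsilon> x))"
        using hXW KMB h_pos by (intro mult_left_mono) auto
      also have "\<dots> = h * (B * Yf x)" unfolding Yf_def by (simp only: mult_ac)
      finally show ?thesis .
    qed
    have 3: "\<bar>h^2 / 12 * ((a x - a p) * u2 x)\<bar> \<le> h * (B * Zf x) / 12"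
    proof -
      have "\<bar>h^2 * ((a x - a p) * u2 x)\<bar> \<le> (K / (real N)^2 * W \<epsilon> x) * ((B * h) * \<bar>u2 x\<bar>)"
        using hW by (intro abs_mult_le ap order_refl) simp
      also have "\<dots> = h * (B * Zf x)" unfolding Zf_def by (simp only: mult_ac)
      finally show ?thesis by (simp add: abs_mult)
    qed
    have 4: "\<bar>(H x - h^2) * a x * u2 x / 12\<bar> \<le> h * (B * Zf x) / 12"
    proof -
      have "\<bar>a x\<bar> \<le> B * X x" by (rule a_le_X[OF x])
      then have "\<bar>(H x - h^2) * a x * u2 x\<bar> \<le> (\<bar>H x - h^2\<bar> * (B * X x)) * \<bar>u2 x\<bar>"
        by (intro abs_mult_le order_refl)
      also have "\<dots> = B * \<bar>u2 x\<bar> * (\<bar>h^2 - H x\<bar> * X x)" by (simp only: mult_ac abs_minus_commute)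
      also have "\<dots> \<le> B * \<bar>u2 x\<bar> * (K / (real N)^2 * (W \<epsilon> x * h))"
        using hH KMB by (intro mult_left_mono) auto
      also have "\<dots> = h * (B * Zf x)" unfolding Zf_def by (simp only: mult_ac)
      finally show ?thesis by (simp add: abs_mult)
    qed
    have Z0: "Zf x \<ge> 0" and Y0: "Yf x \<ge> 0"
      using KMB W_nonneg[of x] X_pos[of x] by (auto simp: Zf_def Yf_def)
    have Z1: "0 \<le> h * (B * Zf x)" using Z0 h_pos KMB by simp
    have "\<bar>e x * (a x - a p) - a p * (u3 x * Q x) + h^2 / 12 * ((a x - a p) * u2 x)
      + (H x - h^2) * a x * u2 x / 12\<bar> \<le> \<bar>e x\<bar> * (B * h) + h * (B * Yf x) + h * (B * Zf x)"
      using 1 2 3 4 Z1 unfolding abs_le_iff by linarith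
    also have "\<dots> = h * (B * (\<bar>e x\<bar> + Zf x + Yf x))" by (simp add: algebra_simps)
    finally have "\<bar>r\<bar> * \<bar>e x * (a x - a p) - a p * (u3 x * Q x) + h^2 / 12 * ((a x - a p) * u2 x)
      + (H x - h^2) * a x * u2 x / 12\<bar> \<le> \<bar>r\<bar> * (h * (B * (\<bar>e x\<bar> + Zf x + Yf x)))"
      by (intro mult_left_mono) auto
    then show "\<bar>G x\<bar> \<le> \<bar>r * h\<bar> * (B * (\<bar>e x\<bar> + Zf x + Yf x))"
      using h_pos by (simp only: G_def abs_mult abs_of_pos mult.assoc)
    show "0 \<le> \<bar>e x\<bar> + Zf x + Yf x" using Z0 Y0 by simp
  qed (use KMB in \<open>auto intro!: continuous_intros cG ce ZY_cont\<close>)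
  also have "integral {p..q} (\<lambda>x. (r * h)^2) = r^2 * h ^ 3"
    using pq by (simp add: h_def power_mult_distrib power_numeral_reduce)
  also have "integral {p..q} (\<lambda>x. (\<bar>e x\<bar>)^2) = integral {p..q} (\<lambda>x. (e x)^2)" by simp
  finally have "\<bar>T r\<bar> \<le> \<theta> * (r^2 * h ^ 3) + B^2 / \<theta> *
    (integral {p..q} (\<lambda>x. (e x)^2) + K^2 / real N ^ 4 * A2 + K^2 / real N ^ 4 * A3)" unfolding TG ZY_int .
  also have "\<dots> \<le> \<theta> * (r^2 * h ^ 3) + B^2 / \<theta> * (2 * K^2 / real N ^ 4 * (A2 + A3))"
  proof (intro add_left_mono mult_left_mono)
    have "K^2 / real N ^ 4 * A3 \<ge> 0" using A_nonneg by simp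
    moreover have "2 * K^2 / real N ^ 4 * (A2 + A3) = 2 * (K^2 / real N ^ 4 * A2) + 2 * (K^2 / real N ^ 4 * A3)"
      by (simp add: distrib_left)
    ultimately show "integral {p..q} (\<lambda>x. (e x)^2) + K^2 / real N ^ 4 * A2 + K^2 / real N ^ 4 * A3
      \<le> 2 * K^2 / real N ^ 4 * (A2 + A3)"
      using e_integral fine_h4(1)[OF f] by linarith
  qed (use th in auto)
  finally show ?thesis by (simp add: mult_ac)
qed

text \<open>Here both integrals are small by themselves, since \<open>\<bar>a\<bar> \<le> 2 B h\<close> on the cell.\<close>

lemma T_tiny:
  assumes f: "tiny_cell \<epsilon> K N H p q" and th: "\<theta> > 0"
  shows "\<bar>T r\<bar> \<le> 2 * \<theta> * (r^2 * h ^ 3) + B^2 * (16 * M^2 * K + K^2) / \<theta> / real N ^ 4 * (A2 + 1)"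
proof -
  have i1: "integral {p..q} (\<lambda>x. (r * h)^2) = r^2 * h ^ 3"
    using pq by (simp add: h_def power_mult_distrib power_numeral_reduce)
  have Xh: "X x \<le> 2 * h" and hH: "\<bar>H x\<bar> * X x \<le> K / (real N)^2 * (W \<epsilon> x * h)" if "x \<in> {p..q}" for x
    using f that unfolding tiny_cell_def h_def by blast+
  have aX: "\<bar>a x\<bar> \<le> B * X x" if x: "x \<in> {p..q}" for x by (rule a_le_X[OF x])
  have "\<bar>integral {p..q} (\<lambda>x. r * a x * e x)\<bar> \<le> \<theta> * integral {p..q} (\<lambda>x. (r * h)^2)
     + B^2 / \<theta> * (integral {p..q} (\<lambda>x. (4 * M)^2) + integral {p..q} (\<lambda>x. 0^2) + integral {p..q} (\<lambda>x. 0^2))"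
  proof (rule young_integral[OF th])
    fix x assume x: "x \<in> {p..q}"
    have "\<bar>a x\<bar> \<le> B * (2 * h)"
    proof -
      have "B * X x \<le> B * (2 * h)" using Xh[OF x] KMB by (intro mult_left_mono) auto
      then show ?thesis using aX[OF x] by linarith
    qed
    then have "\<bar>r * a x * e x\<bar> \<le> \<bar>r\<bar> * (B * (2 * h)) * (2 * M)"
      by (intro abs_mult_le e_bound x order_refl)
    also have "\<dots> = \<bar>r * h\<bar> * (B * (4 * M + 0 + 0))" using h_pos by (simp add: abs_mult)
    finally show "\<bar>r * a x * e x\<bar> \<le> \<bar>r * h\<bar> * (B * (4 * M + 0 + 0))" .
  qed (use KMB in \<open>auto intro!: continuous_intros conts ce\<close>)
  also have "integral {p..q} (\<lambda>x. (4 * M)^2) = 16 * M^2 * h" using pq by (simp add: h_def power_mult_distrib)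
  finally have 1: "\<bar>integral {p..q} (\<lambda>x. r * a x * e x)\<bar> \<le> \<theta> * (r^2 * h ^ 3) + B^2 / \<theta> * (16 * M^2 * h)"
    unfolding i1 by simp
  have "\<bar>integral {p..q} (\<lambda>x. r * (H x * a x * u2 x))\<bar> \<le> \<theta> * integral {p..q} (\<lambda>x. (r * h)^2)
     + B^2 / \<theta> * (integral {p..q} (\<lambda>x. (Zf x)^2) + integral {p..q} (\<lambda>x. 0^2) + integral {p..q} (\<lambda>x. 0^2))"
  proof (rule young_integral[OF th])
    fix x assume x: "x \<in> {p..q}"
    have "\<bar>r * (H x * a x * u2 x)\<bar> \<le> \<bar>r\<bar> * ((\<bar>H x\<bar> * (B * X x)) * \<bar>u2 x\<bar>)"
      by (intro abs_mult_le aX x order_refl)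
    also have "\<dots> = (\<bar>r\<bar> * B * \<bar>u2 x\<bar>) * (\<bar>H x\<bar> * X x)" by (simp only: mult_ac)
    also have "\<dots> \<le> (\<bar>r\<bar> * B * \<bar>u2 x\<bar>) * (K / (real N)^2 * (W \<epsilon> x * h))"
      using hH[OF x] KMB by (intro mult_left_mono) auto
    also have "\<dots> = \<bar>r * h\<bar> * (B * (Zf x + 0 + 0))"
      using h_pos by (simp add: Zf_def abs_mult)
    finally show "\<bar>r * (H x * a x * u2 x)\<bar> \<le> \<bar>r * h\<bar> * (B * (Zf x + 0 + 0))" .
    show "0 \<le> Zf x + 0 + 0" using KMB W_nonneg[of x] by (auto simp: Zf_def)
  qed (use KMB in \<open>auto intro!: continuous_intros conts ZY_cont\<close>)
  then have 2: "\<bar>integral {p..q} (\<lambda>x. r * (H x * a x * u2 x))\<bar> \<le> \<theta> * (r^2 * h ^ 3) + B^2 / \<theta> * (K^2 / real N ^ 4 * A2)"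
    unfolding i1 ZY_int by simp
  have "\<bar>T r\<bar> \<le> \<bar>integral {p..q} (\<lambda>x. r * a x * e x)\<bar> + \<bar>integral {p..q} (\<lambda>x. r * (H x * a x * u2 x))\<bar>"
    unfolding T_def by linarith
  also have "\<dots> \<le> 2 * \<theta> * (r^2 * h ^ 3) + B^2 / \<theta> * (16 * M^2 * h + K^2 / real N ^ 4 * A2)"
    using 1 2 by (simp add: algebra_simps)
  also have "\<dots> \<le> 2 * \<theta> * (r^2 * h ^ 3) + B^2 / \<theta> * ((16 * M^2 * K + K^2) / real N ^ 4 * (A2 + 1))"
  proof (intro add_left_mono mult_left_mono)
    have "16 * M^2 * h \<le> 16 * M^2 * (K / real N ^ 4)" using f by (intro mult_left_mono) (auto simp: tiny_cell_def h_def)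
    moreover have "(16 * M^2 * K + K^2) / real N ^ 4 * (A2 + 1) =
      16 * M^2 * (K / real N ^ 4) + K^2 / real N ^ 4 * A2 + (16 * M^2 * K / real N ^ 4 * A2 + K^2 / real N ^ 4)"
      by (simp add: algebra_simps add_divide_distrib)
    moreover have "16 * M^2 * K / real N ^ 4 * A2 \<ge> 0" "K^2 / real N ^ 4 \<ge> 0" using A_nonneg KMB by auto
    ultimately show "16 * M^2 * h + K^2 / real N ^ 4 * A2 \<le> (16 * M^2 * K + K^2) / real N ^ 4 * (A2 + 1)" by linarith
  qed (use th in auto)
  finally show ?thesis by (simp add: mult_ac)
qed

lemma T_bound:
  assumes "fine_cell \<epsilon> K N H p q \<or> (\<delta> = 1 \<and> tiny_cell \<epsilon> K N H p q)" "\<delta> \<ge> 0" "\<theta> > 0"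
  shows "\<bar>T r\<bar> \<le> 2 * \<theta> * (r^2 * h ^ 3) + B^2 * (16 * M^2 * K + 2 * K^2) / \<theta> / real N ^ 4 * (A2 + A3 + \<delta>)"
  using assms(1)
proof
  assume f: "fine_cell \<epsilon> K N H p q"
  have "\<theta> * (r^2 * h ^ 3) \<le> 2 * \<theta> * (r^2 * h ^ 3)" using assms h_pos by (intro mult_right_mono) auto
  moreover have "B^2 * (2 * K^2) / \<theta> / real N ^ 4 * (A2 + A3) \<le> B^2 * (16 * M^2 * K + 2 * K^2) / \<theta> / real N ^ 4 * (A2 + A3 + \<delta>)"
    using assms A_nonneg KMB by (intro mult_mono divide_right_mono mult_left_mono) auto
  ultimately show ?thesis using T_fine[OF f assms(3), of r] by linarith
next
  assume f: "\<delta> = 1 \<and> tiny_cell \<epsilon> K N H p q"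
  have "B^2 * (16 * M^2 * K + K^2) / \<theta> / real N ^ 4 * (A2 + 1) \<le> B^2 * (16 * M^2 * K + 2 * K^2) / \<theta> / real N ^ 4 * (A2 + A3 + \<delta>)"
    using assms f A_nonneg KMB by (intro mult_mono divide_right_mono mult_left_mono) auto
  then show ?thesis using T_tiny[OF conjunct2[OF f] assms(3), of r] by linarith
qed

text \<open>After integration by parts the derivative of the test function has disappeared, and the boundary
terms \<open>H a u'' v\<close> are continuous across the nodes, so that they will cancel in the sum.\<close>

lemma weighted_by_parts:
  assumes th: "\<theta> > 0" and v: "\<And>x. x \<in> {p..q} \<Longrightarrow> (v has_real_derivative r) (at x within {p..q})"
  shows "\<bar>integral {p..q} (\<lambda>x. r * (H x * a x * u2 x)) - (H q * a q * u2 q * v q - H p * a p * u2 p * v p)\<bar>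
    \<le> \<theta> * integral {p..q} (\<lambda>x. (v x)^2) + 2 * B^2 * K^2 / \<theta> / real N ^ 4 * (A2 + A3)"
proof -
  define G where "G = (\<lambda>x. (H' x * a x * u2 x + H x * a1 x * u2 x + H x * a x * u3 x) * v x)"
  have cv: "continuous_on {p..q} v" using DERIV_continuous_on[OF v] by blast
  have cG: "continuous_on {p..q} G" unfolding G_def by (intro continuous_intros cH' ca1 conts cu3 cv)
  have c1: "continuous_on {p..q} (\<lambda>x. r * (H x * a x * u2 x))" by (intro continuous_intros conts)
  have "((\<lambda>x. G x + r * (H x * a x * u2 x)) has_integral (H q * a q * u2 q * v q - H p * a p * u2 p * v p)) {p..q}"
  proof (rule ftc_has_integral)
    fix x assume x: "x \<in> {p..q}"
    have "((\<lambda>x. H x * a x * u2 x * v x) has_real_derivative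
      (((H' x * a x + a1 x * H x) * u2 x + u3 x * (H x * a x)) * v x + r * (H x * a x * u2 x))) (at x within {p..q})"
      by (intro DERIV_mult dH da du2 v x)
    then show "((\<lambda>x. H x * a x * u2 x * v x) has_real_derivative G x + r * (H x * a x * u2 x)) (at x within {p..q})"
      by (simp add: G_def algebra_simps)
  qed (use pq in auto)
  then have "integral {p..q} (\<lambda>x. G x + r * (H x * a x * u2 x)) = H q * a q * u2 q * v q - H p * a p * u2 p * v p"
    by (rule integral_unique)
  then have i: "integral {p..q} (\<lambda>x. r * (H x * a x * u2 x)) - (H q * a q * u2 q * v q - H p * a p * u2 p * v p)
     = - integral {p..q} G" by (simp add: integral_add_continuous[OF cG c1])
  have "\<bar>integral {p..q} G\<bar> \<le> \<theta> * integral {p..q} (\<lambda>x. (v x)^2)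
     + B^2 / \<theta> * (integral {p..q} (\<lambda>x. (Zf x)^2) + integral {p..q} (\<lambda>x. (Zf x)^2) + integral {p..q} (\<lambda>x. (Yf x)^2))"
  proof (rule young_integral[OF th])
    fix x assume x: "x \<in> {p..q}"
    have aX: "\<bar>a x\<bar> \<le> B * X x" by (rule a_le_X[OF x])
    have "\<bar>H' x * a x * u2 x\<bar> \<le> (\<bar>H' x\<bar> * (B * X x)) * \<bar>u2 x\<bar>" by (intro abs_mult_le aX order_refl)
    also have "\<dots> = (B * \<bar>u2 x\<bar>) * (\<bar>H' x\<bar> * X x)" by (simp only: mult_ac)
    also have "\<dots> \<le> (B * \<bar>u2 x\<bar>) * (K / (real N)^2 * W \<epsilon> x)" using bH'[OF x] KMB by (intro mult_left_mono) auto
    also have "\<dots> = B * Zf x" unfolding Zf_def by (simp only: mult_ac)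
    finally have 1: "\<bar>H' x * a x * u2 x\<bar> \<le> B * Zf x" .
    have "\<bar>H x * a1 x * u2 x\<bar> \<le> ((K / (real N)^2 * W \<epsilon> x) * B) * \<bar>u2 x\<bar>" by (intro abs_mult_le ba1 bH x order_refl)
    also have "\<dots> = B * Zf x" unfolding Zf_def by (simp only: mult_ac)
    finally have 2: "\<bar>H x * a1 x * u2 x\<bar> \<le> B * Zf x" .
    have "\<bar>H x * a x * u3 x\<bar> \<le> ((K / (real N)^2 * W \<epsilon> x) * (B * X x)) * \<bar>u3 x\<bar>" by (intro abs_mult_le aX bH x order_refl)
    also have "\<dots> = B * Yf x" unfolding Yf_def by (simp only: mult_ac)
    finally have 3: "\<bar>H x * a x * u3 x\<bar> \<le> B * Yf x" .
    have "\<bar>H' x * a x * u2 x + H x * a1 x * u2 x + H x * a x * u3 x\<bar> \<le> B * Zf x + B * Zf x + B * Yf x"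
      using 1 2 3 unfolding abs_le_iff by linarith
    also have "\<dots> = B * (Zf x + Zf x + Yf x)" by (simp add: algebra_simps)
    finally have "\<bar>H' x * a x * u2 x + H x * a1 x * u2 x + H x * a x * u3 x\<bar> * \<bar>v x\<bar> \<le> B * (Zf x + Zf x + Yf x) * \<bar>v x\<bar>"
      by (intro mult_right_mono) auto
    then show "\<bar>G x\<bar> \<le> \<bar>v x\<bar> * (B * (Zf x + Zf x + Yf x))" by (simp only: G_def abs_mult mult.commute)
    show "0 \<le> Zf x + Zf x + Yf x" using KMB W_nonneg[of x] X_pos[of x] by (auto simp: Zf_def Yf_def intro!: add_nonneg_nonneg)
  qed (use KMB cG cv ZY_cont in auto)
  also have "B^2 / \<theta> * (integral {p..q} (\<lambda>x. (Zf x)^2) + integral {p..q} (\<lambda>x. (Zf x)^2) + integral {p..q} (\<lambda>x. (Yf x)^2))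
     \<le> B^2 / \<theta> * (2 * K^2 / real N ^ 4 * (A2 + A3))"
    unfolding ZY_int
  proof (intro mult_left_mono)
    have "K^2 / real N ^ 4 * A3 \<ge> 0" using A_nonneg by simp
    moreover have "2 * K^2 / real N ^ 4 * (A2 + A3) = 2 * (K^2 / real N ^ 4 * A2) + 2 * (K^2 / real N ^ 4 * A3)"
      by (simp add: distrib_left)
    ultimately show "K^2 / real N ^ 4 * A2 + K^2 / real N ^ 4 * A2 + K^2 / real N ^ 4 * A3
      \<le> 2 * K^2 / real N ^ 4 * (A2 + A3)" by linarith
  qed (use th in auto)
  finally show ?thesis unfolding i by (simp add: mult_ac)
qed

end

section \<open>Error of the finite element solution\<close>

lemma square_sum_le: "(x + y)^2 \<le> 2 * x^2 + 2 * (y::real)^2"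
  using zero_le_power2[of "x - y"] by (simp add: power2_eq_square algebra_simps)

text \<open>The derivative of \<open>step_sq\<close> on the side \<open>\<sigma> = \<plusminus>1\<close> of the turning point, where \<open>step_sq\<close> has a kink.\<close>

definition step_sq' :: "real \<Rightarrow> real \<Rightarrow> nat \<Rightarrow> real \<Rightarrow> real \<Rightarrow> real" where
  "step_sq' \<alpha> \<epsilon> N \<sigma> z = (((1 + sqrt \<epsilon>) powr \<alpha> - \<epsilon> powr (\<alpha> / 2)) / (\<alpha> * real N))^2 *
     ((2 - 2 * \<alpha>) * (sqrt \<epsilon> + \<bar>z\<bar>) powr (1 - 2 * \<alpha>) * \<sigma>)"

context graded begin

lemma step_sq_deriv:
  assumes s: "(\<sigma> = 1 \<and> 0 \<le> p) \<or> (\<sigma> = -1 \<and> q \<le> 0)" and z: "z \<in> {p..q}"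
  shows "(step_sq \<alpha> \<epsilon> N has_real_derivative step_sq' \<alpha> \<epsilon> N \<sigma> z) (at z within {p..q})"
proof -
  define \<kappa> where "\<kappa> = (((1 + sqrt \<epsilon>) powr \<alpha> - \<epsilon> powr (\<alpha> / 2)) / (\<alpha> * real N))^2"
  have sz: "\<sigma> * w = \<bar>w\<bar>" if "w \<in> {p..q}" for w using s that by auto
  have X: "sqrt \<epsilon> + \<sigma> * z > 0" using eps sz[OF z] by (simp add: add_pos_nonneg)
  have l: "((\<lambda>z. sqrt \<epsilon> + \<sigma> * z) has_real_derivative 0 + \<sigma> * 1) (at z within {p..q})"
    by (intro DERIV_add DERIV_const DERIV_cmult DERIV_ident)
  have "((\<lambda>z. \<kappa> * (sqrt \<epsilon> + \<sigma> * z) powr (2 - 2 * \<alpha>)) has_real_derivative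
     \<kappa> * ((2 - 2 * \<alpha>) * (sqrt \<epsilon> + \<sigma> * z) powr (2 - 2 * \<alpha> - 1) * (0 + \<sigma> * 1))) (at z within {p..q})"
    by (intro DERIV_cmult DERIV_chain2[where f = "\<lambda>x. x powr (2 - 2 * \<alpha>)"] has_real_derivative_powr X l)
  then have "((\<lambda>z. \<kappa> * (sqrt \<epsilon> + \<sigma> * z) powr (2 - 2 * \<alpha>)) has_real_derivative step_sq' \<alpha> \<epsilon> N \<sigma> z) (at z within {p..q})"
    by (simp add: step_sq'_def \<kappa>_def sz[OF z])
  then show ?thesis
    by (rule has_field_derivative_transform_within[where d = 1]) (use z sz in \<open>auto simp: step_sq_def \<kappa>_def\<close>)
qed

lemma step_sq'_cont: "continuous_on A (step_sq' \<alpha> \<epsilon> N \<sigma>)"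
  unfolding step_sq'_def using eps by (intro continuous_intros) (auto simp: add_pos_nonneg less_imp_neq[symmetric])

lemma step_sq'_bound:
  assumes X: "sqrt \<epsilon> + \<bar>z\<bar> \<le> 2" and s: "\<sigma> = 1 \<or> \<sigma> = -1"
  shows "\<bar>step_sq' \<alpha> \<epsilon> N \<sigma> z\<bar> * (sqrt \<epsilon> + \<bar>z\<bar>) \<le> Kg / (real N)^2 * W \<epsilon> z"
proof -
  let ?X = "sqrt \<epsilon> + \<bar>z\<bar>"
  have X0: "?X > 0" using eps by (simp add: add_pos_nonneg)
  have W: "W \<epsilon> z \<ge> 0" using eps by (simp add: W_def)
  have k: "(r * (D / real N))^2 \<le> (2 * r / real N)^2"
    using step_bound D_bounds r_ge by (intro power_mono) auto
  have "?X powr (1 - 2 * \<alpha>) * ?X = ?X powr (1 - 2 * \<alpha>) * ?X powr 1" using X0 by simp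
  also have "\<dots> = ?X powr (2 - 2 * \<alpha>)" by (subst powr_add[symmetric]) simp
  finally have "?X powr (1 - 2 * \<alpha>) * ?X \<le> 2 * W \<epsilon> z"
    using powr_le_W[OF eps(1) X, of "2 - 2 * \<alpha>"] alpha by simp
  then have 1: "(2 - 2 * \<alpha>) * (?X powr (1 - 2 * \<alpha>) * ?X) \<le> 2 * (2 * W \<epsilon> z)"
    using alpha X0 by - (rule mult_mono, auto)
  have "\<bar>step_sq' \<alpha> \<epsilon> N \<sigma> z\<bar> * ?X = (r * (D / real N))^2 * ((2 - 2 * \<alpha>) * (?X powr (1 - 2 * \<alpha>) * ?X))"
    unfolding step_sq'_def kappa using s alpha by (auto simp: abs_mult)
  also have "\<dots> \<le> (2 * r / real N)^2 * (2 * (2 * W \<epsilon> z))"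
    using k 1 W alpha X0 by - (rule mult_mono, auto)
  also have "\<dots> = (16 * r powr 2 * (2 powr r) ^ 0) / (real N)^2 * W \<epsilon> z"
    using r_ge by (simp add: power_divide power_mult_distrib)
  also have "\<dots> \<le> Kg / (real N)^2 * W \<epsilon> z"
    using W by (intro mult_right_mono divide_right_mono Kg_ge) auto
  finally show ?thesis .
qed

lemma step_sq_bound_Kg:
  assumes X: "sqrt \<epsilon> + \<bar>z\<bar> \<le> 2"
  shows "\<bar>step_sq \<alpha> \<epsilon> N z\<bar> \<le> Kg / (real N)^2 * W \<epsilon> z"
proof -
  have "8 * r^2 \<le> Kg" using Kg_ge[of 8 2 0] r_ge by simp
  then have "8 * r^2 / (real N)^2 * W \<epsilon> z \<le> Kg / (real N)^2 * W \<epsilon> z"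
    using eps by (intro mult_right_mono divide_right_mono) (auto simp: W_def)
  then show ?thesis using step_sq_bounds[OF X] by linarith
qed

end

text \<open>\<open>v\<close> is the difference of the interpolant of \<open>u\<close> and the finite element solution \<open>uN\<close>; \<open>s\<close> and \<open>r'\<close> are
the slopes of \<open>uN\<close> and \<open>v\<close>. Galerkin orthogonality enters through the test
function \<open>v\<close>.\<close>

locale fem_error = graded +
  fixes a a1 c f u u1 u2 u3 uN v :: "real \<Rightarrow> real" and M B \<gamma> :: real and s r' :: "nat \<Rightarrow> real"
  assumes data: "convection_data a a1 c f B \<gamma>" and Mpos: "M > 0"
    and sol: "layer_solution \<epsilon> M a c f u u1 u2 u3"
    and uN: "continuous_on {-1..1} uN" "pw_linear (2 * N) y uN s"
    and v: "continuous_on {-1..1} v" "pw_linear (2 * N) y v r'"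
    and vn: "\<And>j. j \<le> 2 * N \<Longrightarrow> v (y j) = u (y j) - uN (y j)"
    and v0: "v (y 0) = 0" "v (y (2 * N)) = 0"
    and galerkin: "bilinear_form \<epsilon> a c uN v = L2_inner f v"
begin

lemma pos: "M > 0" "B > 0" "\<gamma> > 0"
  and ca1: "continuous_on {-1..1} a1" and cc: "continuous_on {-1..1} c" and cf: "continuous_on {-1..1} f"
  using data Mpos by (auto simp: convection_data_def)

lemma
  assumes "x \<in> {-1..1}"
  shows da: "(a has_real_derivative a1 x) (at x within {-1..1})" and ba: "\<bar>a x\<bar> \<le> B * \<bar>x\<bar>"
    and ba1: "\<bar>a1 x\<bar> \<le> B" and bc: "\<bar>c x\<bar> \<le> B" and coer: "c x - a1 x / 2 \<ge> \<gamma>"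
  using data assms by (auto simp: convection_data_def)

abbreviation "n \<equiv> 2 * N"
abbreviation "cl j \<equiv> {y j..y (Suc j)}"
abbreviation I :: "nat \<Rightarrow> (real \<Rightarrow> real) \<Rightarrow> real" where "I j g \<equiv> integral {y j..y (Suc j)} g"

lemma cell_sub: "j < n \<Longrightarrow> cl j \<subseteq> {-1..1}"
  using mesh_mono_nat[of n y 0 j, OF mesh_cells(3)] mesh_mono_nat[of n y "Suc j" n, OF mesh_cells(3)] mesh_cells(1,2)
  by auto

lemma sol': "u (-1) = 0" "u 1 = 0"
  "\<And>x. x \<in> {-1..1} \<Longrightarrow> (u has_real_derivative u1 x) (at x within {-1..1})"
  "\<And>x. x \<in> {-1..1} \<Longrightarrow> (u1 has_real_derivative u2 x) (at x within {-1..1})"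
  "\<And>x. x \<in> {-1..1} \<Longrightarrow> (u2 has_real_derivative u3 x) (at x within {-1..1})"
  "\<And>x. x \<in> {-1..1} \<Longrightarrow> \<epsilon> * u2 x = a x * u1 x + c x * u x - f x"
  "\<And>x. x \<in> {-1..1} \<Longrightarrow> \<bar>u x\<bar> \<le> M" "continuous_on {-1..1} u3"
  using sol unfolding layer_solution_def by blast+

lemma conts: "continuous_on {-1..1} u" "continuous_on {-1..1} u1" "continuous_on {-1..1} u2" "continuous_on {-1..1} a"
  using DERIV_continuous_on[OF sol'(3)] DERIV_continuous_on[OF sol'(4)] DERIV_continuous_on[OF sol'(5)]
    DERIV_continuous_on[OF da] by blast+

lemma cell_cont:
  assumes "j < n"
  shows "continuous_on (cl j) u" "continuous_on (cl j) u1" "continuous_on (cl j) u2"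
    "continuous_on (cl j) u3" "continuous_on (cl j) a" "continuous_on (cl j) a1"
    "continuous_on (cl j) c" "continuous_on (cl j) f" "continuous_on (cl j) uN"
    "continuous_on (cl j) v"
  using conts ca1 cc cf uN(1) v(1) sol'(8) continuous_on_subset[OF _ cell_sub[OF assms]] by blast+

lemma cell_deriv:
  assumes "j < n" "x \<in> cl j"
  shows "(u has_real_derivative u1 x) (at x within cl j)"
    "(u1 has_real_derivative u2 x) (at x within cl j)"
    "(u2 has_real_derivative u3 x) (at x within cl j)"
    "(a has_real_derivative a1 x) (at x within cl j)"
proof -
  have x1: "x \<in> {-1..1}" using cell_sub[OF assms(1)] assms(2) by blast
  note ds = DERIV_subset[OF _ cell_sub[OF assms(1)]]
  show "(u has_real_derivative u1 x) (at x within cl j)" by (rule ds[OF sol'(3)[OF x1]])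
  show "(u1 has_real_derivative u2 x) (at x within cl j)" by (rule ds[OF sol'(4)[OF x1]])
  show "(u2 has_real_derivative u3 x) (at x within cl j)" by (rule ds[OF sol'(5)[OF x1]])
  show "(a has_real_derivative a1 x) (at x within cl j)" by (rule ds[OF da[OF x1]])
qed

lemma X_le_2: "x \<in> {-1..1} \<Longrightarrow> sqrt \<epsilon> + \<bar>x\<bar> \<le> 2"
proof -
  assume "x \<in> {-1..1}"
  then have "\<bar>x\<bar> \<le> 1" by auto
  moreover have "sqrt \<epsilon> \<le> 1" using eps by simp
  ultimately show ?thesis by linarith
qed

lemma Kg_pos: "Kg > 0" using r_ge by (simp add: Kg_def)

definition \<sigma> :: "nat \<Rightarrow> real" where "\<sigma> j = (if 0 \<le> y j then 1 else -1)"

lemma cell: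
  assumes j: "j < n"
  shows "cell_solution (y j) (y (Suc j)) \<epsilon> Kg M B N (step_sq \<alpha> \<epsilon> N) (step_sq' \<alpha> \<epsilon> N (\<sigma> j)) a a1 u u1 u2 u3"
proof
  fix x assume x: "x \<in> cl j"
  then have x1: "x \<in> {-1..1}" using cell_sub[OF j] by auto
  show "(step_sq \<alpha> \<epsilon> N has_real_derivative step_sq' \<alpha> \<epsilon> N (\<sigma> j) x) (at x within cl j)"
    by (rule step_sq_deriv[OF _ x]) (use mesh_cells(4)[OF j] in \<open>auto simp: \<sigma>_def\<close>)
  show "\<bar>step_sq \<alpha> \<epsilon> N x\<bar> \<le> Kg / (real N)^2 * W \<epsilon> x" by (rule step_sq_bound_Kg[OF X_le_2[OF x1]])
  show "\<bar>step_sq' \<alpha> \<epsilon> N (\<sigma> j) x\<bar> * (sqrt \<epsilon> + \<bar>x\<bar>) \<le> Kg / (real N)^2 * W \<epsilon> x"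
    by (rule step_sq'_bound[OF X_le_2[OF x1]]) (simp add: \<sigma>_def)
  show "\<bar>u x\<bar> \<le> M" "\<bar>a x\<bar> \<le> B * \<bar>x\<bar>" "\<bar>a1 x\<bar> \<le> B" using sol'(7)[OF x1] ba[OF x1] ba1[OF x1] by auto
qed (use mesh_cells(3)[OF j] eps N Kg_pos pos cell_deriv[OF j] cell_cont[OF j] step_sq'_cont in auto)

definition p :: "nat \<Rightarrow> real" where "p j = cell_solution.s (y j) (y (Suc j)) u"
definition e :: "nat \<Rightarrow> real \<Rightarrow> real" where "e j = cell_solution.e (y j) (y (Suc j)) u"
definition h :: "nat \<Rightarrow> real" where "h j = y (Suc j) - y j"
definition V :: "nat \<Rightarrow> real" where "V j = I j (\<lambda>x. (v x)^2)"
text \<open>\<open>\<delta>\<close> marks the two cells adjacent to the turning point, the only ones that may be tiny.\<close>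

definition \<delta> :: "nat \<Rightarrow> real" where "\<delta> j = (if j = N then 1 else 0) + (if j = N - 1 then 1 else 0)"

lemma cell_type:
  assumes j: "j < n"
  shows "fine_cell \<epsilon> Kg N (step_sq \<alpha> \<epsilon> N) (y j) (y (Suc j)) \<or> (\<delta> j = 1 \<and> tiny_cell \<epsilon> Kg N (step_sq \<alpha> \<epsilon> N) (y j) (y (Suc j)))"
  using mesh_cells(5)[OF j] N by (auto simp: \<delta>_def)

lemma delta: "\<delta> j \<ge> 0" "(\<Sum>j<n. \<delta> j) \<le> 2"
  by (auto simp: \<delta>_def sum.distrib)

lemma v_lin: "j < n \<Longrightarrow> x \<in> cl j \<Longrightarrow> v x = v (y j) + r' j * (x - y j)"
  using v(2) by (rule pw_linearD)

lemma dv: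
  assumes j: "j < n" and x: "x \<in> cl j"
  shows "(v has_real_derivative r' j) (at x within cl j)"
proof -
  have "((\<lambda>x. v (y j) + r' j * (x - y j)) has_real_derivative r' j) (at x within cl j)"
    by (auto intro!: derivative_eq_intros)
  then show ?thesis
    by (rule has_field_derivative_transform_within[where d = 1]) (simp, rule x, rule v_lin[OF j, symmetric])
qed

lemma e_eq: "j < n \<Longrightarrow> e j x = u x - (u (y j) + p j * (x - y j))"
  unfolding e_def p_def using cell_solution.e_def[OF cell] by blast

lemma slopes:
  assumes j: "j < n"
  shows "p j = s j + r' j"
proof -
  let ?q = "y (Suc j)"
  have lt: "y j < ?q" by (rule mesh_cells(3)[OF j])
  have q: "?q \<in> {y j..?q}" using lt by simp
  have "v ?q = v (y j) + r' j * (?q - y j)" by (rule v_lin[OF j q])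
  moreover have "uN ?q = uN (y j) + s j * (?q - y j)" by (rule pw_linearD[OF uN(2) j q])
  moreover have "v ?q = u ?q - uN ?q" "v (y j) = u (y j) - uN (y j)" using vn[of j] vn[of "Suc j"] j by auto
  ultimately have "u ?q - u (y j) = (s j + r' j) * (?q - y j)" by (simp add: algebra_simps)
  moreover have "p j = (u ?q - u (y j)) / (?q - y j)" unfolding p_def by (rule cell_solution.s_def[OF cell[OF j]])
  ultimately show ?thesis using lt by simp
qed

lemma uN_eq:
  assumes j: "j < n" and x: "x \<in> cl j"
  shows "uN x = u x - e j x - v x"
proof -
  have "uN x = uN (y j) + s j * (x - y j)" by (rule pw_linearD[OF uN(2) j x])
  then show ?thesis using v_lin[OF j x] e_eq[OF j, of x] slopes[OF j] vn[of j] j by (simp add: algebra_simps)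
qed

lemma e_cont: "j < n \<Longrightarrow> continuous_on (cl j) (e j)"
  unfolding e_def by (rule cell_solution.ce[OF cell])

lemma L2_inner_cells:
  assumes "\<And>j. j < n \<Longrightarrow> continuous_on (cl j) (g j)"
    "\<And>j z. j < n \<Longrightarrow> z \<in> {y j<..<y (Suc j)} \<Longrightarrow> w1 z * w2 z = g j z"
  shows "L2_inner w1 w2 = (\<Sum>j<n. I j (g j))"
  using LBINT_sum_cells[of n y g "\<lambda>z. w1 z * w2 z", OF mesh_cells(3) assms] mesh_cells(1,2)
  by (simp add: L2_inner_def)

lemma deriv_cell:
  assumes "j < n" "z \<in> {y j<..<y (Suc j)}"
  shows "deriv v z = r' j" "deriv uN z = s j" "deriv (\<lambda>x. u x - uN x) z = u1 z - s j"
proof -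
  have d: "(uN has_real_derivative s j) (at z)" by (rule pw_linear_deriv[OF uN(2) assms])
  show "deriv v z = r' j" by (rule DERIV_imp_deriv[OF pw_linear_deriv[OF v(2) assms]])
  show "deriv uN z = s j" by (rule DERIV_imp_deriv[OF d])
  have "z \<in> cl j" using assms(2) by simp
  from cell_deriv(1)[OF assms(1) this]
  have "(u has_real_derivative u1 z) (at z)"
    using at_within_interior[of z "cl j"] assms(2) by (simp add: interior_atLeastAtMost_real)
  then show "deriv (\<lambda>x. u x - uN x) z = u1 z - s j" by (intro DERIV_imp_deriv DERIV_diff d)
qed

text \<open>The integrand of \<open>bilinear_form \<epsilon> a c uN v - L2_inner f v\<close>.\<close>

definition Gd :: "nat \<Rightarrow> real \<Rightarrow> real" where
  "Gd j x = \<epsilon> * (s j * r' j) + a x * s j * v x + c x * uN x * v x - f x * v x"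

lemma galerkin_cells: "(\<Sum>j<n. I j (Gd j)) = 0"
proof -
  have "bilinear_form \<epsilon> a c uN v = \<epsilon> * (\<Sum>j<n. I j (\<lambda>x. s j * r' j)) + (\<Sum>j<n. I j (\<lambda>x. a x * s j * v x))
     + (\<Sum>j<n. I j (\<lambda>x. c x * uN x * v x))"
    unfolding bilinear_form_def
    by (subst L2_inner_cells[where g = "\<lambda>j x. s j * r' j"] L2_inner_cells[where g = "\<lambda>j x. a x * s j * v x"]
         L2_inner_cells[where g = "\<lambda>j x. c x * uN x * v x"];
        (intro continuous_intros cell_cont; assumption)?; simp add: deriv_cell)+
  moreover have "L2_inner f v = (\<Sum>j<n. I j (\<lambda>x. f x * v x))"
    by (rule L2_inner_cells) (auto intro!: continuous_intros cell_cont)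
  ultimately have "0 = \<epsilon> * (\<Sum>j<n. I j (\<lambda>x. s j * r' j)) + (\<Sum>j<n. I j (\<lambda>x. a x * s j * v x))
     + (\<Sum>j<n. I j (\<lambda>x. c x * uN x * v x)) - (\<Sum>j<n. I j (\<lambda>x. f x * v x))" using galerkin by simp
  also have "\<dots> = (\<Sum>j<n. \<epsilon> * I j (\<lambda>x. s j * r' j) + I j (\<lambda>x. a x * s j * v x)
     + I j (\<lambda>x. c x * uN x * v x) - I j (\<lambda>x. f x * v x))"
    by (simp only: sum.distrib sum_subtractf sum_distrib_left)
  also have "\<dots> = (\<Sum>j<n. I j (Gd j))"
  proof (rule sum.cong)
    fix j assume "j \<in> {..<n}"
    then have j: "j < n" by simp
    have c1: "continuous_on (cl j) (\<lambda>x. \<epsilon> * (s j * r' j))"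
      "continuous_on (cl j) (\<lambda>x. a x * s j * v x)" "continuous_on (cl j) (\<lambda>x. c x * uN x * v x)"
      "continuous_on (cl j) (\<lambda>x. f x * v x)"
      by (intro continuous_intros cell_cont j)+
    have "I j (Gd j) = I j (\<lambda>x. \<epsilon> * (s j * r' j)) + I j (\<lambda>x. a x * s j * v x) + I j (\<lambda>x. c x * uN x * v x) - I j (\<lambda>x. f x * v x)"
      unfolding Gd_def
      by (simp only: integral_diff_continuous[OF continuous_on_add[OF continuous_on_add[OF c1(1,2)] c1(3)] c1(4)]
        integral_add_continuous[OF continuous_on_add[OF c1(1,2)] c1(3)] integral_add_continuous[OF c1(1,2)])
    then show "\<epsilon> * I j (\<lambda>x. s j * r' j) + I j (\<lambda>x. a x * s j * v x)
     + I j (\<lambda>x. c x * uN x * v x) - I j (\<lambda>x. f x * v x) = I j (Gd j)" by (simp only: integral_mult_right)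
  qed simp
  finally show ?thesis by simp
qed

text \<open>The integrand that results when the weak forms of \<open>u\<close> and of \<open>uN\<close> are subtracted, with
\<open>u - uN = e + v\<close> inserted and all derivatives of \<open>e\<close> and \<open>v\<close> integrated by parts: a coercive part in
\<open>v\<close> and the consistency error in \<open>e\<close>. No diffusive term \<open>\<epsilon> e' v'\<close> remains, since \<open>v'\<close> is constant on the
cell and \<open>e\<close> vanishes at its ends.\<close>

definition Rd :: "nat \<Rightarrow> real \<Rightarrow> real" where
  "Rd j x = \<epsilon> * (r' j)^2 + (c x - a1 x / 2) * (v x)^2 + (c x - a1 x) * e j x * v x - r' j * a x * e j x"

lemma Gd_cont: "j < n \<Longrightarrow> continuous_on (cl j) (Gd j)"
  unfolding Gd_def by (intro continuous_intros cell_cont)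
lemma Rd_cont: "j < n \<Longrightarrow> continuous_on (cl j) (Rd j)"
  unfolding Rd_def by (intro continuous_intros cell_cont e_cont) auto

lemma error_cell_identity:
  assumes j: "j < n"
  shows "I j (Gd j) + I j (Rd j) = (\<epsilon> * u1 (y (Suc j)) * v (y (Suc j)) - a (y (Suc j)) * (v (y (Suc j)))^2 / 2)
     - (\<epsilon> * u1 (y j) * v (y j) - a (y j) * (v (y j))^2 / 2)"
proof -
  let ?c = "cl j"
  define F where "F = (\<lambda>x. \<epsilon> * (u1 x * v x) - \<epsilon> * r' j * e j x - a x * e j x * v x - 1 / 2 * (a x * (v x)^2))"
  have "((\<lambda>x. Gd j x + Rd j x) has_integral F (y (Suc j)) - F (y j)) ?c"
  proof (rule ftc_has_integral)
    fix x assume x: "x \<in> ?c"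
    have de: "(e j has_real_derivative u1 x - p j) (at x within ?c)"
      unfolding e_def p_def by (rule cell_solution.de[OF cell[OF j] x])
    have dv2: "((\<lambda>x. (v x)^2) has_real_derivative 2 * v x * r' j) (at x within ?c)"
      unfolding power2_eq_square using DERIV_mult[OF dv[OF j x] dv[OF j x]] by (simp add: algebra_simps)
    have "(F has_real_derivative \<epsilon> * (u2 x * v x + r' j * u1 x) - \<epsilon> * r' j * (u1 x - p j)
       - ((a1 x * e j x + (u1 x - p j) * a x) * v x + r' j * (a x * e j x))
       - 1 / 2 * (a1 x * (v x)^2 + 2 * v x * r' j * a x)) (at x within ?c)"
      unfolding F_def
      by (intro DERIV_diff DERIV_cmult DERIV_mult cell_deriv[OF j x] dv[OF j x] de dv2)
    moreover have "\<epsilon> * (u2 x * v x + r' j * u1 x) - \<epsilon> * r' j * (u1 x - p j)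
       - ((a1 x * e j x + (u1 x - p j) * a x) * v x + r' j * (a x * e j x))
       - 1 / 2 * (a1 x * (v x)^2 + 2 * v x * r' j * a x) = Gd j x + Rd j x"
    proof -
      have e2: "\<epsilon> * (u2 x * v x) = (a x * u1 x + c x * u x - f x) * v x"
        using sol'(6)[of x] cell_sub[OF j] x by (metis mult.assoc subsetD)
      show ?thesis unfolding Gd_def Rd_def uN_eq[OF j x] slopes[OF j] distrib_left[of \<epsilon>] e2
        by (simp add: algebra_simps power2_eq_square)
    qed
    ultimately show "(F has_real_derivative Gd j x + Rd j x) (at x within ?c)" by simp
  qed (use mesh_cells(3)[OF j] in simp)
  then have "I j (\<lambda>x. Gd j x + Rd j x) = F (y (Suc j)) - F (y j)" by (rule integral_unique)
  moreover have "e j (y j) = 0" "e j (y (Suc j)) = 0"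
    unfolding e_def by (rule cell_solution.e_ends[OF cell[OF j]])+
  ultimately show ?thesis
    by (simp add: integral_add_continuous[OF Gd_cont[OF j] Rd_cont[OF j]] F_def)
qed

lemma error_identity: "(\<Sum>j<n. I j (Rd j)) = 0"
proof -
  define F where "F = (\<lambda>j. \<epsilon> * u1 (y j) * v (y j) - a (y j) * (v (y j))^2 / 2)"
  have "(\<Sum>j<n. I j (Gd j)) + (\<Sum>j<n. I j (Rd j)) = (\<Sum>j<n. F (Suc j) - F j)"
    unfolding sum.distrib[symmetric] by (rule sum.cong) (auto simp: F_def error_cell_identity)
  also have "\<dots> = F n - F 0" by (rule sum_lessThan_telescope)
  also have "\<dots> = 0" by (simp add: F_def v0)
  finally show ?thesis by (simp add: galerkin_cells)
qed

definition A1 where "A1 j = cell_solution.A1 (y j) (y (Suc j)) \<epsilon> u1"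
definition A2 where "A2 j = cell_solution.A2 (y j) (y (Suc j)) \<epsilon> u2"
definition A3 where "A3 j = cell_solution.A3 (y j) (y (Suc j)) \<epsilon> u3"

lemma A_nonneg: "j < n \<Longrightarrow> A1 j \<ge> 0" "j < n \<Longrightarrow> A2 j \<ge> 0" "j < n \<Longrightarrow> A3 j \<ge> 0"
  unfolding A1_def A2_def A3_def using cell_solution.A_nonneg[OF cell] by blast+

lemma A_sums: "(\<Sum>j<n. A1 j) \<le> M" "(\<Sum>j<n. A2 j) \<le> M" "(\<Sum>j<n. A3 j) \<le> M"
proof -
  have *: "(\<Sum>j<n. A j) = integral {-1..1} g"
    if "continuous_on {-1..1} g" "\<And>j. j < n \<Longrightarrow> A j = I j g" for A g
    using integral_sum_cells[of n y g] mesh_cells(1,2,3) that by (auto intro: less_imp_le)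
  have "(\<Sum>j<n. A1 j) = integral {-1..1} (\<lambda>x. (sqrt \<epsilon> + \<bar>x\<bar>) * (u1 x)^2)"
    by (intro * continuous_intros conts, unfold A1_def, rule cell_solution.A1_def[OF cell])
  moreover have "(\<Sum>j<n. A2 j) = integral {-1..1} (\<lambda>x. (sqrt \<epsilon> + \<bar>x\<bar>) ^ 3 * (u2 x)^2)"
    by (intro * continuous_intros conts, unfold A2_def, rule cell_solution.A2_def[OF cell])
  moreover have "(\<Sum>j<n. A3 j) = integral {-1..1} (\<lambda>x. (sqrt \<epsilon> + \<bar>x\<bar>) ^ 5 * (u3 x)^2)"
    by (intro * continuous_intros sol'(8), unfold A3_def, rule cell_solution.A3_def[OF cell])
  ultimately show "(\<Sum>j<n. A1 j) \<le> M" "(\<Sum>j<n. A2 j) \<le> M" "(\<Sum>j<n. A3 j) \<le> M"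
    using sol unfolding layer_solution_def by simp_all
qed

text \<open>The Young parameter is a fraction of the coercivity constant such that the absorbed terms, at most
\<open>26 \<theta> v\<^sup>2\<close>, leave half of it.\<close>

definition \<theta> where "\<theta> = \<gamma> / 52"
definition C1 where "C1 = B^2 / \<theta> * (Kg^2 + 4 * M^2 * Kg) + B^2 * (16 * M^2 * Kg + 2 * Kg^2) / \<theta> + 2 * B^2 * Kg^2 / \<theta>"

lemma theta: "\<theta> > 0" "52 * \<theta> = \<gamma>" using pos by (auto simp: \<theta>_def)

lemma C1_nonneg: "C1 \<ge> 0" using theta Kg_pos by (simp add: C1_def)

text \<open>The telescoping boundary terms of \<open>weighted_by_parts\<close>.\<close>

definition Bd :: "nat \<Rightarrow> real" where "Bd j = step_sq \<alpha> \<epsilon> N (y j) * a (y j) * u2 (y j) * v (y j)"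

lemma e_L2: "j < n \<Longrightarrow> I j (\<lambda>x. (e j x)^2) \<le> (Kg^2 + 4 * M^2 * Kg) / real N ^ 4 * (A2 j + \<delta> j)"
  unfolding e_def A2_def by (rule cell_solution.interpolation_L2[OF cell cell_type delta(1)])

lemma V_nonneg: "j < n \<Longrightarrow> V j \<ge> 0"
  unfolding V_def by (intro integral_nonneg integrable_continuous_real continuous_intros cell_cont) auto

text \<open>Coercivity, \<open>c - a'/2 \<ge> \<gamma>\<close>, against the consistency error. The factor \<open>r'\<^sup>2 h\<^sup>3\<close> in \<open>T_bound\<close> is returned
to \<open>\<integral> v\<^sup>2\<close> by the inverse inequality.\<close>

lemma cell_stability:
  assumes j: "j < n"
  shows "I j (Rd j) \<ge> \<epsilon> * (r' j)^2 * h j + \<gamma> / 2 * V j - C1 / real N ^ 4 * (A2 j + A3 j + \<delta> j) + (Bd (Suc j) - Bd j) / 12"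
proof -
  let ?c = "cl j"
  interpret cs: cell_solution "y j" "y (Suc j)" \<epsilon> Kg M B N "step_sq \<alpha> \<epsilon> N" "step_sq' \<alpha> \<epsilon> N (\<sigma> j)" a a1 u u1 u2 u3
    by (rule cell[OF j])
  have ee: "cs.e = e j" by (simp add: e_def)
  have hh: "cs.h = h j" by (simp add: cs.h_def h_def)
  have AA: "cs.A2 = A2 j" "cs.A3 = A3 j" by (simp_all add: A2_def A3_def)
  have lt: "y j < y (Suc j)" by (rule mesh_cells(3)[OF j])
  have c: "continuous_on ?c (\<lambda>x. \<epsilon> * (r' j)^2)" "continuous_on ?c (\<lambda>x. (c x - a1 x / 2) * (v x)^2)"
     "continuous_on ?c (\<lambda>x. (c x - a1 x) * e j x * v x)" "continuous_on ?c (\<lambda>x. r' j * a x * e j x)"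
    by (intro continuous_intros cell_cont e_cont j; simp)+
  have dec: "I j (Rd j) = \<epsilon> * (r' j)^2 * h j + I j (\<lambda>x. (c x - a1 x / 2) * (v x)^2)
     + I j (\<lambda>x. (c x - a1 x) * e j x * v x) - I j (\<lambda>x. r' j * a x * e j x)"
  proof -
    have "I j (Rd j) = I j (\<lambda>x. \<epsilon> * (r' j)^2) + I j (\<lambda>x. (c x - a1 x / 2) * (v x)^2)
     + I j (\<lambda>x. (c x - a1 x) * e j x * v x) - I j (\<lambda>x. r' j * a x * e j x)"
      unfolding Rd_def by (simp only: integral_diff_continuous[OF continuous_on_add[OF continuous_on_add[OF c(1,2)] c(3)] c(4)]
        integral_add_continuous[OF continuous_on_add[OF c(1,2)] c(3)] integral_add_continuous[OF c(1,2)])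
    then show ?thesis using lt by (simp add: h_def)
  qed
  have 1: "\<gamma> * V j \<le> I j (\<lambda>x. (c x - a1 x / 2) * (v x)^2)"
  proof -
    have "I j (\<lambda>x. \<gamma> * (v x)^2) \<le> I j (\<lambda>x. (c x - a1 x / 2) * (v x)^2)"
      using coer cell_sub[OF j] by (intro integral_mono_continuous c continuous_intros cell_cont j mult_right_mono) auto
    then show ?thesis by (simp add: V_def)
  qed
  have 2: "\<bar>I j (\<lambda>x. (c x - a1 x) * e j x * v x)\<bar> \<le> \<theta> * V j + B^2 / \<theta> * I j (\<lambda>x. (e j x)^2)"
  proof -
    have c2: "continuous_on ?c (\<lambda>x. \<theta> * (v x)^2)" "continuous_on ?c (\<lambda>x. B^2 / \<theta> * (e j x)^2)"
      by (intro continuous_intros cell_cont e_cont j)+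
    have "\<bar>I j (\<lambda>x. (c x - a1 x) * e j x * v x)\<bar> \<le> I j (\<lambda>x. \<theta> * (v x)^2 + B^2 / \<theta> * (e j x)^2)"
    proof (intro integral_abs_le c continuous_on_add c2)
      fix x assume x: "x \<in> ?c"
      then have x1: "x \<in> {-1..1}" using cell_sub[OF j] by auto
      have "\<bar>c x - a1 x\<bar> \<le> 2 * B" using bc[OF x1] ba1[OF x1] by linarith
      then have "\<bar>(c x - a1 x) * e j x * v x\<bar> \<le> 2 * B * \<bar>e j x\<bar> * \<bar>v x\<bar>" by (intro abs_mult_le order_refl)
      also have "\<dots> = \<bar>v x * (2 * B * e j x)\<bar>" using pos by (simp add: abs_mult)
      also have "\<dots> \<le> \<theta> * (v x)^2 + (2 * B * e j x)^2 / (4 * \<theta>)" by (rule young_ineq[OF theta(1)])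
      also have "(2 * B * e j x)^2 / (4 * \<theta>) = B^2 / \<theta> * (e j x)^2" by (simp add: power_mult_distrib)
      finally show "\<bar>(c x - a1 x) * e j x * v x\<bar> \<le> \<theta> * (v x)^2 + B^2 / \<theta> * (e j x)^2" .
    qed
    then show ?thesis by (simp only: integral_add_continuous[OF c2] integral_mult_right V_def)
  qed
  have 3: "B^2 / \<theta> * I j (\<lambda>x. (e j x)^2) \<le> B^2 / \<theta> * ((Kg^2 + 4 * M^2 * Kg) / real N ^ 4 * (A2 j + A3 j + \<delta> j))"
  proof (intro mult_left_mono)
    have "(Kg^2 + 4 * M^2 * Kg) / real N ^ 4 * (A2 j + \<delta> j) \<le> (Kg^2 + 4 * M^2 * Kg) / real N ^ 4 * (A2 j + A3 j + \<delta> j)"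
      using A_nonneg[OF j] Kg_pos by (intro mult_left_mono) auto
    then show "I j (\<lambda>x. (e j x)^2) \<le> (Kg^2 + 4 * M^2 * Kg) / real N ^ 4 * (A2 j + A3 j + \<delta> j)"
      using e_L2[OF j] by linarith
  qed (use theta in auto)
  have Tdef: "I j (\<lambda>x. r' j * a x * e j x) = cs.T (r' j) - I j (\<lambda>x. r' j * (step_sq \<alpha> \<epsilon> N x * a x * u2 x)) / 12"
    unfolding cs.T_def ee by simp
  have 4: "\<bar>cs.T (r' j)\<bar> \<le> 2 * \<theta> * ((r' j)^2 * h j ^ 3) + B^2 * (16 * M^2 * Kg + 2 * Kg^2) / \<theta> / real N ^ 4 * (A2 j + A3 j + \<delta> j)"
    using cs.T_bound[OF cell_type[OF j] delta(1) theta(1), of "r' j"] unfolding hh AA .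
  have "(r' j)^2 * (y (Suc j) - y j) ^ 3 \<le> 12 * I j (\<lambda>x. (v (y j) + r' j * (x - y j))^2)"
    using lt by (intro linear_inverse_inequality) simp
  also have "I j (\<lambda>x. (v (y j) + r' j * (x - y j))^2) = V j"
    unfolding V_def by (rule integral_cong) (simp add: v_lin[OF j, symmetric])
  finally have "2 * \<theta> * ((r' j)^2 * h j ^ 3) \<le> 2 * \<theta> * (12 * V j)"
    using theta by (intro mult_left_mono) (auto simp: h_def)
  then have 5: "2 * \<theta> * ((r' j)^2 * h j ^ 3) \<le> 24 * (\<theta> * V j)" by simp
  have 6: "\<bar>I j (\<lambda>x. r' j * (step_sq \<alpha> \<epsilon> N x * a x * u2 x)) - (Bd (Suc j) - Bd j)\<bar>
     \<le> \<theta> * V j + 2 * B^2 * Kg^2 / \<theta> / real N ^ 4 * (A2 j + A3 j)"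
    using cs.weighted_by_parts[OF theta(1) dv[OF j]] unfolding AA V_def Bd_def .
  have 7: "0 \<le> \<theta> * V j" using V_nonneg[OF j] theta by simp
  have 8: "2 * B^2 * Kg^2 / \<theta> / real N ^ 4 * (A2 j + A3 j) \<le> 2 * B^2 * Kg^2 / \<theta> / real N ^ 4 * (A2 j + A3 j + \<delta> j)"
    using delta theta by (intro mult_left_mono) auto
  have 9: "0 \<le> 2 * B^2 * Kg^2 / \<theta> / real N ^ 4 * (A2 j + A3 j + \<delta> j)"
    using A_nonneg[OF j] delta theta by (intro mult_nonneg_nonneg divide_nonneg_nonneg add_nonneg_nonneg) auto
  have 10: "C1 / real N ^ 4 * (A2 j + A3 j + \<delta> j) = B^2 / \<theta> * ((Kg^2 + 4 * M^2 * Kg) / real N ^ 4 * (A2 j + A3 j + \<delta> j))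
     + B^2 * (16 * M^2 * Kg + 2 * Kg^2) / \<theta> / real N ^ 4 * (A2 j + A3 j + \<delta> j)
     + 2 * B^2 * Kg^2 / \<theta> / real N ^ 4 * (A2 j + A3 j + \<delta> j)"
  proof -
    have "(B^2 / \<theta> * k1 + k2 + k3) / d * w = B^2 / \<theta> * (k1 / d * w) + k2 / d * w + k3 / d * w" for k1 k2 k3 d w :: real
      by (simp add: add_divide_distrib distrib_right)
    then show ?thesis unfolding C1_def .
  qed
  have 11: "\<gamma> / 2 * V j = \<gamma> * V j - 26 * (\<theta> * V j)" unfolding \<theta>_def by (simp add: field_simps)
  have "e0 + (gv - 26 * tv) - (k1 + k2 + k3) + db / 12 \<le> e0 + P1 + P2 - (T - J / 12)"
    if "gv \<le> P1" "\<bar>P2\<bar> \<le> tv + W1" "W1 \<le> k1" "\<bar>T\<bar> \<le> q + k2" "q \<le> 24 * tv" "\<bar>J - db\<bar> \<le> tv + k3'"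
      "0 \<le> tv" "k3' \<le> k3" "0 \<le> k3" for e0 gv tv k1 k2 k3 k3' db P1 P2 T J W1 q :: real
    using that by linarith
  from this[OF 1 2 3 4 5 6 7 8 9] show ?thesis unfolding dec Tdef 10 11 .
qed

definition C2 where "C2 = C1 * (2 * M + 2)"

text \<open>The interpolant is closer to the finite element solution than to \<open>u\<close>: its distance is of second
order even in the energy norm.\<close>

lemma discrete_error: "(\<Sum>j<n. \<epsilon> * (r' j)^2 * h j) + \<gamma> / 2 * (\<Sum>j<n. V j) \<le> C2 / real N ^ 4"
proof -
  have "(\<Sum>j<n. \<epsilon> * (r' j)^2 * h j + \<gamma> / 2 * V j - C1 / real N ^ 4 * (A2 j + A3 j + \<delta> j) + (Bd (Suc j) - Bd j) / 12)
     \<le> (\<Sum>j<n. I j (Rd j))" by (intro sum_mono cell_stability) simp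
  also have "\<dots> = 0" by (rule error_identity)
  finally have "(\<Sum>j<n. \<epsilon> * (r' j)^2 * h j) + \<gamma> / 2 * (\<Sum>j<n. V j)
     \<le> C1 / real N ^ 4 * ((\<Sum>j<n. A2 j) + (\<Sum>j<n. A3 j) + (\<Sum>j<n. \<delta> j)) - (\<Sum>j<n. Bd (Suc j) - Bd j) / 12"
    by (simp only: sum.distrib sum_subtractf sum_distrib_left[symmetric] sum_divide_distrib[symmetric])
  also have "(\<Sum>j<n. Bd (Suc j) - Bd j) = 0" by (simp only: sum_lessThan_telescope) (simp add: Bd_def v0)
  also have "C1 / real N ^ 4 * ((\<Sum>j<n. A2 j) + (\<Sum>j<n. A3 j) + (\<Sum>j<n. \<delta> j)) \<le> C1 / real N ^ 4 * (2 * M + 2)"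
    using A_sums delta C1_nonneg by (intro mult_left_mono) auto
  finally show ?thesis by (simp add: C2_def)
qed

definition C3 where "C3 = 2 * (Kg^2 + 4 * M^2 * Kg) * (M + 2) + 4 / \<gamma> * C2"
definition C4 where "C4 = 2 * (Kg^2 + Kg) * (2 * M) + 2 * C2"

lemma C_nonneg: "C2 \<ge> 0" "C3 \<ge> 0" "C4 \<ge> 0"
proof -
  show c2: "C2 \<ge> 0" using C1_nonneg pos by (simp add: C2_def)
  show "C3 \<ge> 0" "C4 \<ge> 0" using c2 Kg_pos pos by (auto simp: C3_def C4_def)
qed

lemma L2_norm_sq: "(L2_norm w)^2 = L2_inner w w"
proof -
  have "L2_inner w w \<ge> 0" unfolding L2_inner_def set_lebesgue_integral_def
    by (intro Bochner_Integration.integral_nonneg) auto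
  then show ?thesis by (simp add: L2_norm_def)
qed

lemma h_pos: "j < n \<Longrightarrow> h j > 0" using mesh_cells(3) by (simp add: h_def)

lemma L2_error: "(L2_norm (\<lambda>x. u x - uN x))^2 \<le> C3 / real N ^ 4"
proof -
  have "(L2_norm (\<lambda>x. u x - uN x))^2 = (\<Sum>j<n. I j (\<lambda>x. (u x - uN x)^2))"
    unfolding L2_norm_sq by (rule L2_inner_cells) (auto intro!: continuous_intros cell_cont simp: power2_eq_square)
  also have "\<dots> \<le> (\<Sum>j<n. 2 * ((Kg^2 + 4 * M^2 * Kg) / real N ^ 4 * (A2 j + \<delta> j)) + 2 * V j)"
  proof (intro sum_mono)
    fix j assume "j \<in> {..<n}"
    then have j: "j < n" by simp
    have c: "continuous_on (cl j) (\<lambda>x. 2 * (e j x)^2)" "continuous_on (cl j) (\<lambda>x. 2 * (v x)^2)"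
      by (intro continuous_intros cell_cont e_cont j)+
    have "I j (\<lambda>x. (u x - uN x)^2) \<le> I j (\<lambda>x. 2 * (e j x)^2 + 2 * (v x)^2)"
    proof (intro integral_mono_continuous continuous_on_add c)
      fix x assume x: "x \<in> cl j"
      have "u x - uN x = e j x + v x" using uN_eq[OF j x] by simp
      then show "(u x - uN x)^2 \<le> 2 * (e j x)^2 + 2 * (v x)^2"
        using square_sum_le[of "e j x" "v x"] by (simp only:)
    qed (intro continuous_intros cell_cont j)
    also have "\<dots> = 2 * I j (\<lambda>x. (e j x)^2) + 2 * V j"
      by (simp only: integral_add_continuous[OF c] integral_mult_right V_def)
    finally show "I j (\<lambda>x. (u x - uN x)^2) \<le> 2 * ((Kg^2 + 4 * M^2 * Kg) / real N ^ 4 * (A2 j + \<delta> j)) + 2 * V j"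
      using e_L2[OF j] by linarith
  qed
  also have "\<dots> = 2 * ((Kg^2 + 4 * M^2 * Kg) / real N ^ 4 * ((\<Sum>j<n. A2 j) + (\<Sum>j<n. \<delta> j))) + 2 * (\<Sum>j<n. V j)"
    by (simp only: sum.distrib sum_distrib_left[symmetric])
  also have "\<dots> \<le> 2 * ((Kg^2 + 4 * M^2 * Kg) / real N ^ 4 * (M + 2)) + 4 / \<gamma> * (C2 / real N ^ 4)"
  proof (intro add_mono mult_left_mono)
    have "0 \<le> (\<Sum>j<n. \<epsilon> * (r' j)^2 * h j)"
      using eps h_pos by (intro sum_nonneg mult_nonneg_nonneg) (auto intro: less_imp_le)
    then have "\<gamma> / 2 * (\<Sum>j<n. V j) \<le> C2 / real N ^ 4" using discrete_error by linarith
    then have "4 / \<gamma> * (\<gamma> / 2 * (\<Sum>j<n. V j)) \<le> 4 / \<gamma> * (C2 / real N ^ 4)" using pos by (intro mult_left_mono) auto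
    moreover have "4 / \<gamma> * (\<gamma> / 2 * (\<Sum>j<n. V j)) = 2 * (\<Sum>j<n. V j)" using pos by simp
    ultimately show "2 * (\<Sum>j<n. V j) \<le> 4 / \<gamma> * (C2 / real N ^ 4)" by linarith
  qed (use A_sums delta Kg_pos in auto)
  also have "\<dots> = C3 / real N ^ 4"
  proof -
    have "2 * (k / d * m) + g * (w / d) = (2 * k * m + g * w) / d" for k d m g w :: real
      by (simp add: add_divide_distrib)
    then show ?thesis unfolding C3_def .
  qed
  finally show ?thesis .
qed

lemma derivative_error: "\<epsilon> * (L2_norm (deriv (\<lambda>x. u x - uN x)))^2 \<le> C4 / (real N)^2"
proof -
  have "(L2_norm (deriv (\<lambda>x. u x - uN x)))^2 = (\<Sum>j<n. I j (\<lambda>x. (u1 x - s j)^2))"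
    unfolding L2_norm_sq
    by (rule L2_inner_cells) (auto intro!: continuous_intros cell_cont simp: power2_eq_square deriv_cell)
  then have "\<epsilon> * (L2_norm (deriv (\<lambda>x. u x - uN x)))^2 = (\<Sum>j<n. \<epsilon> * I j (\<lambda>x. (u1 x - s j)^2))"
    by (simp only: sum_distrib_left)
  also have "\<dots> \<le> (\<Sum>j<n. 2 * ((Kg^2 + Kg) / (real N)^2 * (A1 j + A2 j)) + 2 * (\<epsilon> * (r' j)^2 * h j))"
  proof (intro sum_mono)
    fix j assume "j \<in> {..<n}"
    then have j: "j < n" by simp
    have lt: "y j < y (Suc j)" by (rule mesh_cells(3)[OF j])
    have c: "continuous_on (cl j) (\<lambda>x. 2 * (u1 x - p j)^2)" "continuous_on (cl j) (\<lambda>x. 2 * (r' j)^2)"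
      by (intro continuous_intros cell_cont j)+
    have "I j (\<lambda>x. (u1 x - s j)^2) \<le> I j (\<lambda>x. 2 * (u1 x - p j)^2 + 2 * (r' j)^2)"
    proof (intro integral_mono_continuous continuous_on_add c)
      fix x
      have "u1 x - s j = (u1 x - p j) + r' j" using slopes[OF j] by simp
      then show "(u1 x - s j)^2 \<le> 2 * (u1 x - p j)^2 + 2 * (r' j)^2"
        using square_sum_le[of "u1 x - p j" "r' j"] by (simp only:)
    qed (intro continuous_intros cell_cont j)
    also have "\<dots> = 2 * I j (\<lambda>x. (u1 x - p j)^2) + 2 * ((r' j)^2 * h j)"
      by (simp only: integral_add_continuous[OF c] integral_mult_right) (use lt in \<open>simp add: h_def\<close>)
    finally have "\<epsilon> * I j (\<lambda>x. (u1 x - s j)^2) \<le> \<epsilon> * (2 * I j (\<lambda>x. (u1 x - p j)^2) + 2 * ((r' j)^2 * h j))"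
      using eps by (intro mult_left_mono) auto
    also have "\<dots> = 2 * (\<epsilon> * I j (\<lambda>x. (u1 x - p j)^2)) + 2 * (\<epsilon> * (r' j)^2 * h j)" by (simp add: algebra_simps)
    also have "\<epsilon> * I j (\<lambda>x. (u1 x - p j)^2) \<le> (Kg^2 + Kg) / (real N)^2 * (A1 j + A2 j)"
      unfolding p_def A1_def A2_def by (rule cell_solution.interpolation_energy[OF cell[OF j] cell_type[OF j]])
    finally show "\<epsilon> * I j (\<lambda>x. (u1 x - s j)^2) \<le> 2 * ((Kg^2 + Kg) / (real N)^2 * (A1 j + A2 j)) + 2 * (\<epsilon> * (r' j)^2 * h j)"
      by simp
  qed
  also have "\<dots> = 2 * ((Kg^2 + Kg) / (real N)^2 * ((\<Sum>j<n. A1 j) + (\<Sum>j<n. A2 j))) + 2 * (\<Sum>j<n. \<epsilon> * (r' j)^2 * h j)"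
    by (simp only: sum.distrib sum_distrib_left[symmetric])
  also have "\<dots> \<le> 2 * ((Kg^2 + Kg) / (real N)^2 * (2 * M)) + 2 * (C2 / (real N)^2)"
  proof (intro add_mono mult_left_mono)
    have "0 \<le> \<gamma> / 2 * (\<Sum>j<n. V j)" using pos V_nonneg by (intro mult_nonneg_nonneg sum_nonneg) auto
    then have "(\<Sum>j<n. \<epsilon> * (r' j)^2 * h j) \<le> C2 / real N ^ 4" using discrete_error by linarith
    also have "\<dots> \<le> C2 / (real N)^2"
    proof (intro divide_left_mono)
      show "(real N)^2 \<le> real N ^ 4" using N by (intro power_increasing) auto
    qed (use C_nonneg N in auto)
    finally show "(\<Sum>j<n. \<epsilon> * (r' j)^2 * h j) \<le> C2 / (real N)^2" .
  qed (use A_sums Kg_pos in auto)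
  also have "\<dots> = C4 / (real N)^2"
  proof -
    have "2 * (k / d * m) + g * (w / d) = (2 * k * m + g * w) / d" for k d m g w :: real
      by (simp add: add_divide_distrib)
    then show ?thesis unfolding C4_def .
  qed
  finally show ?thesis .
qed

theorem error_estimates:
  "energy_norm \<epsilon> (\<lambda>x. u x - uN x) \<le> (1 + sqrt C3 + sqrt (C3 + C4)) / real N"
  "L2_norm (\<lambda>x. u x - uN x) \<le> (1 + sqrt C3 + sqrt (C3 + C4)) / (real N)^2"
proof -
  let ?L = "L2_norm (\<lambda>x. u x - uN x)"
  have N4: "C3 / real N ^ 4 \<le> C3 / (real N)^2"
  proof (intro divide_left_mono)
    show "(real N)^2 \<le> real N ^ 4" using N by (intro power_increasing) auto
  qed (use C_nonneg N in auto)
  have "energy_norm \<epsilon> (\<lambda>x. u x - uN x) \<le> sqrt ((C3 + C4) / (real N)^2)"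
    unfolding energy_norm_def
  proof (intro real_sqrt_le_mono)
    show "\<epsilon> * (L2_norm (deriv (\<lambda>x. u x - uN x)))^2 + ?L^2 \<le> (C3 + C4) / (real N)^2"
      using L2_error derivative_error N4 unfolding add_divide_distrib by linarith
  qed
  also have "\<dots> = sqrt (C3 + C4) / real N" using N by (simp add: real_sqrt_divide)
  also have "\<dots> \<le> (1 + sqrt C3 + sqrt (C3 + C4)) / real N" using C_nonneg by (intro divide_right_mono) auto
  finally show "energy_norm \<epsilon> (\<lambda>x. u x - uN x) \<le> (1 + sqrt C3 + sqrt (C3 + C4)) / real N" .
  have "?L \<le> sqrt (C3 / real N ^ 4)" using L2_error by (rule real_le_rsqrt)
  also have "\<dots> = sqrt C3 / (real N)^2"
  proof -
    have "real N ^ 4 = ((real N)^2)^2" by simp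
    then show ?thesis by (simp only: real_sqrt_divide real_sqrt_abs) simp
  qed
  also have "\<dots> \<le> (1 + sqrt C3 + sqrt (C3 + C4)) / (real N)^2" using C_nonneg by (intro divide_right_mono) auto
  finally show "?L \<le> (1 + sqrt C3 + sqrt (C3 + C4)) / (real N)^2" .
qed

end

text \<open>The test function required by \<open>fem_error\<close> is constructed as a piecewise linear function with
prescribed nodal values. The constants \<open>C3\<close> and \<open>C4\<close> depend on \<open>\<alpha>\<close> and the data only.\<close>

lemma fem_error_bound:
  fixes \<alpha> B M \<gamma> :: real
  assumes al: "0 < \<alpha>" "\<alpha> \<le> 1 / 4" and data: "convection_data a a1 c f B \<gamma>" and M: "M > 0"
  shows "\<exists>C>0. \<forall>\<epsilon>\<in>{0<..1}. \<forall>N\<ge>1. \<forall>u u1 u2 u3 uN. layer_solution \<epsilon> M a c f u u1 u2 u3 \<longrightarrow>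
    fe_solution \<epsilon> a c f (fe_space N (mesh \<alpha> \<epsilon> N)) uN \<longrightarrow>
    energy_norm \<epsilon> (\<lambda>x. u x - uN x) \<le> C / real N \<and> L2_norm (\<lambda>x. u x - uN x) \<le> C / (real N)^2"
proof -
  define C where "C = 1 + sqrt (fem_error.C3 \<alpha> M B \<gamma>) + sqrt (fem_error.C3 \<alpha> M B \<gamma> + fem_error.C4 \<alpha> M B \<gamma>)"
  have est: "energy_norm \<epsilon> (\<lambda>x. u x - uN x) \<le> C / real N \<and> L2_norm (\<lambda>x. u x - uN x) \<le> C / (real N)^2 \<and> C > 0"
    if e: "\<epsilon> \<in> {0<..1}" and N: "N \<ge> 1" and sol: "layer_solution \<epsilon> M a c f u u1 u2 u3"
      and fe: "fe_solution \<epsilon> a c f (fe_space N (mesh \<alpha> \<epsilon> N)) uN" for \<epsilon> N u u1 u2 u3 uN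
  proof -
    interpret graded \<epsilon> \<alpha> N by unfold_locales (use e N al in auto)
    have uN: "uN \<in> fe_space N (mesh \<alpha> \<epsilon> N)" "continuous_on {-1..1} uN" "uN (-1) = 0" "uN 1 = 0"
      using fe unfolding fe_solution_def fe_space_def by blast+
    have yd: "y = (\<lambda>j. mesh \<alpha> \<epsilon> N (int j - int N))" by (rule ext) (rule y_def)
    obtain s where s: "pw_linear (2 * N) y uN s"
      using fe_space_slopes[OF uN(1)] mesh_cells(1-3) unfolding yd by blast
    define g where "g = (\<lambda>j. u (y j) - uN (y j))"
    have u0: "u (-1) = 0" "u 1 = 0" using sol unfolding layer_solution_def by blast+
    have g0: "g 0 = 0" "g (2 * N) = 0" using u0 uN mesh_cells(1,2) by (simp_all add: g_def)
    obtain v where v: "continuous_on UNIV v" "\<And>j. j \<le> 2 * N \<Longrightarrow> v (y j) = g j"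
       "pw_linear (2 * N) y v (\<lambda>j. (g (Suc j) - g j) / (y (Suc j) - y j))"
      using pw_linear_interpolant[of "2 * N" y g, OF mesh_cells(3) g0(1)] by blast
    have vc: "continuous_on {-1..1} v" using v(1) continuous_on_subset by blast
    have vb: "v (-1) = 0" "v 1 = 0" using v(2)[of 0] v(2)[of "2 * N"] g0 mesh_cells(1,2) by simp_all
    have "v \<in> fe_space N (mesh \<alpha> \<epsilon> N)"
      by (rule pw_linear_in_fe_space[OF v(3)[unfolded yd] vc vb])
    then have gal: "bilinear_form \<epsilon> a c uN v = L2_inner f v" using fe unfolding fe_solution_def by blast
    interpret fem_error \<epsilon> \<alpha> N a a1 c f u u1 u2 u3 uN v M B \<gamma> s "\<lambda>j. (g (Suc j) - g j) / (y (Suc j) - y j)"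
    proof
      show "bilinear_form \<epsilon> a c uN v = L2_inner f v" by (rule gal)
      show "v (y 0) = 0" "v (y (2 * N)) = 0" using v(2) g0 by simp_all
      show "v (y j) = u (y j) - uN (y j)" if "j \<le> 2 * N" for j using v(2)[OF that] by (simp add: g_def)
    qed (fact data M sol uN s v vc)+
    have "C > 0" using C_nonneg by (auto simp: C_def intro!: add_pos_nonneg)
    then show ?thesis using error_estimates by (simp add: C_def)
  qed
  show ?thesis
  proof (cases "C > 0")
    case True
    then show ?thesis using est by blast
  next
    case False
    then show ?thesis using est by (intro exI[of _ "1 :: real"] conjI zero_less_one) blast
  qed
qed

lemma uniform_error_bound:
  assumes data: "turning_point_data 2 a a' b c f \<gamma>" and al: "0 < \<alpha>" "\<alpha> \<le> 1 / 4"
  shows "\<exists>C>0. \<forall>\<epsilon>\<in>{0<..1}. \<forall>N\<ge>1. \<forall>u uN. bvp_solution \<epsilon> a c f u \<and>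
      fe_solution \<epsilon> a c f (fe_space N (mesh \<alpha> \<epsilon> N)) uN \<longrightarrow>
      energy_norm \<epsilon> (\<lambda>x. u x - uN x) \<le> C / real N \<and> L2_norm (\<lambda>x. u x - uN x) \<le> C / (real N)^2"
proof (rule weighted_a_priori_estimates[OF data])
  fix a1 B M
  assume d: "convection_data a a1 c f B \<gamma>" "M > 0" and sol: "\<And>\<epsilon> u. 0 < \<epsilon> \<Longrightarrow> \<epsilon> \<le> 1 \<Longrightarrow>
    bvp_solution \<epsilon> a c f u \<Longrightarrow> \<exists>u1 u2 u3. layer_solution \<epsilon> M a c f u u1 u2 u3"
  obtain C where C: "C > 0" "\<And>\<epsilon> N u u1 u2 u3 uN. \<epsilon> \<in> {0<..1} \<Longrightarrow> N \<ge> 1 \<Longrightarrow>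
      layer_solution \<epsilon> M a c f u u1 u2 u3 \<Longrightarrow> fe_solution \<epsilon> a c f (fe_space N (mesh \<alpha> \<epsilon> N)) uN \<Longrightarrow>
      energy_norm \<epsilon> (\<lambda>x. u x - uN x) \<le> C / real N \<and> L2_norm (\<lambda>x. u x - uN x) \<le> C / (real N)^2"
    using fem_error_bound[OF al d] by blast
  show ?thesis
  proof (intro exI[of _ C] conjI[OF C(1)] ballI allI impI)
    fix \<epsilon> :: real and N :: nat and u uN
    assume h: "\<epsilon> \<in> {0<..1}" "1 \<le> N"
      "bvp_solution \<epsilon> a c f u \<and> fe_solution \<epsilon> a c f (fe_space N (mesh \<alpha> \<epsilon> N)) uN"
    then obtain u1 u2 u3 where "layer_solution \<epsilon> M a c f u u1 u2 u3" using sol[of \<epsilon> u] by auto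
    then show "energy_norm \<epsilon> (\<lambda>x. u x - uN x) \<le> C / real N \<and> L2_norm (\<lambda>x. u x - uN x) \<le> C / (real N)^2"
      using C(2) h by blast
  qed
qed

theorem theorem3p10:
  shows "\<exists>k :: nat. \<forall>(a :: real \<Rightarrow> real) a' b c f (\<gamma> :: real).
    turning_point_data k a a' b c f \<gamma> \<longrightarrow>
    (\<exists>\<epsilon>\<^sub>0 :: real. 0 < \<epsilon>\<^sub>0 \<and> \<epsilon>\<^sub>0 \<le> 1 \<and>
      (\<forall>(lam :: real) (\<alpha> :: real).
        0 < lam \<and>
        (lam < c 0 / \<bar>a' 0\<bar> \<or> (lam = c 0 / \<bar>a' 0\<bar> \<and> c 0 / \<bar>a' 0\<bar> \<notin> \<int>)) \<and>
        0 < \<alpha> \<and> \<alpha> \<le> min (lam / 2) (1 / 4) \<longrightarrow>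
        (\<exists>C :: real. C > 0 \<and>
          (\<forall>\<epsilon> \<in> {0<..\<epsilon>\<^sub>0}. \<forall>N :: nat. N \<ge> 1 \<longrightarrow>
            (\<forall>u u\<^sub>N. bvp_solution \<epsilon> a c f u \<and>
                fe_solution \<epsilon> a c f (fe_space N (mesh \<alpha> \<epsilon> N)) u\<^sub>N \<longrightarrow>
                energy_norm \<epsilon> (\<lambda>x. u x - u\<^sub>N x) \<le> C / real N \<and>
                L2_norm (\<lambda>x. u x - u\<^sub>N x) \<le> C / (real N)\<^sup>2)))))"
  \<comment> \<open>two derivatives of the data give \<open>u \<in> C\<^sup>4\<close>, as the energy estimate for \<open>u'''\<close> requires\<close>
  by (intro exI[of _ "2 :: nat"] exI[of _ "1 :: real"] allI impI conjI uniform_error_bound) auto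

end
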